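(* Let $a \in \mathbb{Z}^n$, $b \in \mathbb{Z}$, and let $P = [0,1]^n \cap \{x \in \mathbb{R}^n : a^\top x \le b\}$. Let $L$ be the maximum encoding length of an input parameter (an entry of $a$ or $b$). There is a deterministic algorithm which, given $a$, $b$ and $\varepsilon > 0$, computes $Z' \in \mathbb{R}$ such that \[ \mathrm{vol}(P) \le Z' \le (1+\varepsilon)\,\mathrm{vol}(P), \] using $O\!\left(\frac{n^3}{\varepsilon}\left(\log\frac{n}{\varepsilon} + L\right)^4\right)$ arithmetic operations on $O(L + \log(n/\varepsilon))$-bit numbers.
   Context: $\mathrm{vol}$ denotes $n$-dimensional Lebesgue measure. The encoding length of a rational number $p/q$ (with $p\in\mathbb{Z}$, $q\in\mathbb{Z}_{>0}$) is $\lceil \log(|p|+1)\rceil + \lceil \log(q+1)\rceil$.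
   Formalization: In the operation and bit bounds ε is replaced by min(1, ε), since the stated bounds degenerate to 0 for large ε (n=1, a=b=0, ε=2); Z' is returned as a mantissa and a binary exponent, as a single fraction of O(L+log(n/ε)) bits cannot hold tiny volumes. *)

theory Defs
  imports "HOL-Analysis.Analysis"
begin

section \<open>The polytope and encoding lengths\<close>

text \<open>Points of $n$-dimensional space are extensional functions on the index set \<open>{..<n}\<close>.\<close>

definition knapsack_polytope :: "nat \<Rightarrow> (nat \<Rightarrow> int) \<Rightarrow> int \<Rightarrow> (nat \<Rightarrow> real) set" where
  "knapsack_polytope n a b =
     {x \<in> {..<n} \<rightarrow>\<^sub>E {0..1}. (\<Sum>i<n. of_int (a i) * x i) \<le> of_int b}"

definition vol :: "nat \<Rightarrow> (nat \<Rightarrow> real) set \<Rightarrow> real" where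
  "vol n S = measure (\<Pi>\<^sub>M i\<in>{..<n}. lborel) S"

lemma knapsack_polytope_measurable:
  "knapsack_polytope n a b \<in> sets (\<Pi>\<^sub>M i\<in>{..<n}. (lborel :: real measure))"
proof -
  let ?M = "\<Pi>\<^sub>M i\<in>{..<n}. (lborel :: real measure)"
  have cube: "({..<n} \<rightarrow>\<^sub>E {0..1}) \<in> sets ?M"
    by (intro sets_PiM_I_finite) auto
  have "(\<lambda>x. \<Sum>i<n. of_int (a i) * x i) \<in> borel_measurable ?M"
  proof (intro borel_measurable_sum borel_measurable_times borel_measurable_const)
    fix i assume "i \<in> {..<n}"
    then have "(\<lambda>x. x i) \<in> measurable ?M lborel"
      by (rule measurable_component_singleton)
    then show "(\<lambda>x. x i) \<in> borel_measurable ?M" by simp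
  qed
  then have "{x \<in> space ?M. (\<Sum>i<n. of_int (a i) * x i) \<le> real_of_int b} \<in> sets ?M"
    by (intro borel_measurable_le) auto
  from sets.Int[OF cube this]
  have "({..<n} \<rightarrow>\<^sub>E {0..1}) \<inter>
      {x \<in> space ?M. (\<Sum>i<n. of_int (a i) * x i) \<le> real_of_int b} \<in> sets ?M" .
  moreover have "({..<n} \<rightarrow>\<^sub>E {0..1::real}) \<subseteq> space ?M"
    using sets.sets_into_space[OF cube] .
  then have "knapsack_polytope n a b = ({..<n} \<rightarrow>\<^sub>E {0..1}) \<inter>
      {x \<in> space ?M. (\<Sum>i<n. of_int (a i) * x i) \<le> of_int b}"
    unfolding knapsack_polytope_def Collect_conj_eq Collect_mem_eq
      Int_assoc[symmetric] by (simp only: Int_absorb2)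
  ultimately show ?thesis by (simp only:)
qed

definition enc_len :: "rat \<Rightarrow> nat" where
  "enc_len r = (case quotient_of r of (p, q) \<Rightarrow>
     nat \<lceil>log 2 (of_int \<bar>p\<bar> + 1)\<rceil> + nat \<lceil>log 2 (of_int q + 1)\<rceil>)"

definition max_enc_len :: "nat \<Rightarrow> (nat \<Rightarrow> int) \<Rightarrow> int \<Rightarrow> nat" where
  "max_enc_len n a b =
     Max (insert (enc_len (of_int b)) ((\<lambda>i. enc_len (of_int (a i))) ` {..<n}))"

definition is_bit_number :: "real \<Rightarrow> real \<Rightarrow> bool" where
  "is_bit_number k v \<longleftrightarrow> (\<exists>r. v = of_rat r \<and> real (enc_len r) \<le> k)"

section \<open>The machine model\<close>

text \<open>
  Algorithms are programs of a deterministic imperative language whose memory consists of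
  named arrays of numbers; a scalar is kept in cell 0 of its array. Program constants are
  integers. Cells are real-valued only because the accuracy parameter may be any positive real:
  the bit bound of the theorem forces every number that is computed to be rational.
\<close>

type_synonym state = "string \<Rightarrow> nat \<Rightarrow> real"

datatype arith = Plus | Minus | Times | Divide

datatype aexp = Num int | Read string aexp | Arith arith aexp aexp | Floor aexp

datatype bexp = Leq aexp aexp | Not bexp | And bexp bexp

datatype com =
    Skip
  | Store string aexp aexp  \<comment> \<open>\<open>Store x i e\<close> is the assignment \<open>x[i] := e\<close>\<close>
  | Seq com com
  | If bexp com com
  | While bexp com

fun arith_val :: "arith \<Rightarrow> real \<Rightarrow> real \<Rightarrow> real" where
  "arith_val Plus u v = u + v"
| "arith_val Minus u v = u - v"
| "arith_val Times u v = u * v"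
| "arith_val Divide u v = u / v"

fun aval :: "aexp \<Rightarrow> state \<Rightarrow> real" where
  "aval (Num k) s = of_int k"
| "aval (Read x i) s = s x (nat \<lfloor>aval i s\<rfloor>)"
| "aval (Arith f e1 e2) s = arith_val f (aval e1 s) (aval e2 s)"
| "aval (Floor e) s = of_int \<lfloor>aval e s\<rfloor>"

fun bval :: "bexp \<Rightarrow> state \<Rightarrow> bool" where
  "bval (Leq e1 e2) s \<longleftrightarrow> aval e1 s \<le> aval e2 s"
| "bval (Not t) s \<longleftrightarrow> \<not> bval t s"
| "bval (And t1 t2) s \<longleftrightarrow> bval t1 s \<and> bval t2 s"

fun aops :: "aexp \<Rightarrow> nat" where
  "aops (Num k) = 0"
| "aops (Read x i) = Suc (aops i)"
| "aops (Arith f e1 e2) = Suc (aops e1 + aops e2)"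
| "aops (Floor e) = Suc (aops e)"

fun bops :: "bexp \<Rightarrow> nat" where
  "bops (Leq e1 e2) = Suc (aops e1 + aops e2)"
| "bops (Not t) = Suc (bops t)"
| "bops (And t1 t2) = Suc (bops t1 + bops t2)"

text \<open>
  \<open>anums e s\<close> collects the constants and all intermediate results in the evaluation of \<open>e\<close>.
  A number that is merely read from memory is not listed: it is an input or was listed when
  it was computed. In particular the input accuracy itself, which need not be a rational of
  short encoding, is exempt, but nothing computed from it is.
\<close>

fun anums :: "aexp \<Rightarrow> state \<Rightarrow> real set" where
  "anums (Num k) s = {of_int k}"
| "anums (Read x i) s = anums i s"
| "anums (Arith f e1 e2) s = insert (aval (Arith f e1 e2) s) (anums e1 s \<union> anums e2 s)"
| "anums (Floor e) s = insert (aval (Floor e) s) (anums e s)"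

fun bnums :: "bexp \<Rightarrow> state \<Rightarrow> real set" where
  "bnums (Leq e1 e2) s = anums e1 s \<union> anums e2 s"
| "bnums (Not t) s = bnums t s"
| "bnums (And t1 t2) s = bnums t1 s \<union> bnums t2 s"

text \<open>
  \<open>exec c s T W s'\<close>: started in \<open>s\<close>, the program \<open>c\<close> halts in \<open>s'\<close> after \<open>T\<close> operations, and
  \<open>W\<close> is the set of all numbers computed on the way. Every arithmetic operation, memory
  access, logical operation, comparison and branch counts as one operation.
\<close>

inductive exec :: "com \<Rightarrow> state \<Rightarrow> nat \<Rightarrow> real set \<Rightarrow> state \<Rightarrow> bool" where
  exec_Skip: "exec Skip s 0 {} s"
| exec_Store: "exec (Store x i e) s (Suc (aops i + aops e)) (anums i s \<union> anums e s)
    (s(x := (s x)(nat \<lfloor>aval i s\<rfloor> := aval e s)))"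
| exec_Seq: "exec c1 s T1 W1 s' \<Longrightarrow> exec c2 s' T2 W2 s'' \<Longrightarrow>
    exec (Seq c1 c2) s (T1 + T2) (W1 \<union> W2) s''"
| exec_If_True: "bval t s \<Longrightarrow> exec c1 s T W s' \<Longrightarrow>
    exec (If t c1 c2) s (Suc (bops t + T)) (bnums t s \<union> W) s'"
| exec_If_False: "\<not> bval t s \<Longrightarrow> exec c2 s T W s' \<Longrightarrow>
    exec (If t c1 c2) s (Suc (bops t + T)) (bnums t s \<union> W) s'"
| exec_While_False: "\<not> bval t s \<Longrightarrow> exec (While t c) s (Suc (bops t)) (bnums t s) s"
| exec_While_True: "bval t s \<Longrightarrow> exec c s T1 W1 s' \<Longrightarrow> exec (While t c) s' T2 W2 s'' \<Longrightarrow>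
    exec (While t c) s (Suc (bops t + T1 + T2)) (bnums t s \<union> W1 \<union> W2) s''"

lemma exec_deterministic:
  assumes "exec c s T1 W1 s1" and "exec c s T2 W2 s2"
  shows "T1 = T2 \<and> W1 = W2 \<and> s1 = s2"
  using assms
proof (induction arbitrary: T2 W2 s2 rule: exec.induct)
  case (exec_Skip s)
  from exec_Skip.prems show ?case by cases auto
next
  case (exec_Store x i e s)
  from exec_Store.prems show ?case by cases auto
next
  case (exec_Seq c1 s Ta Wa s' c2 Tb Wb s'')
  from exec_Seq.prems obtain Tc Wc u Td Wd where
    1: "exec c1 s Tc Wc u" and 2: "exec c2 u Td Wd s2" and 3: "T2 = Tc + Td" "W2 = Wc \<union> Wd"
    by cases auto
  from exec_Seq.IH(1)[OF 1] have u: "Ta = Tc \<and> Wa = Wc \<and> s' = u" .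
  then have "exec c2 s' Td Wd s2" using 2 by simp
  from exec_Seq.IH(2)[OF this] u 3 show ?case by simp
next
  case (exec_If_True t s c1 T W s' c2)
  from exec_If_True.prems obtain Tc Wc where
    1: "exec c1 s Tc Wc s2" and 2: "T2 = Suc (bops t + Tc)" "W2 = bnums t s \<union> Wc"
    by cases (use exec_If_True.hyps(1) in simp_all)
  from exec_If_True.IH[OF 1] 2 show ?case by simp
next
  case (exec_If_False t s c2 T W s' c1)
  from exec_If_False.prems obtain Tc Wc where
    1: "exec c2 s Tc Wc s2" and 2: "T2 = Suc (bops t + Tc)" "W2 = bnums t s \<union> Wc"
    by cases (use exec_If_False.hyps(1) in simp_all)
  from exec_If_False.IH[OF 1] 2 show ?case by simp
next
  case (exec_While_False t s c)
  from exec_While_False.prems show ?case by cases (use exec_While_False.hyps in simp_all)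
next
  case (exec_While_True t s c Ta Wa s' Tb Wb s'')
  from exec_While_True.prems obtain Tc Wc u Td Wd where
    1: "exec c s Tc Wc u" and 2: "exec (While t c) u Td Wd s2"
    and 3: "T2 = Suc (bops t + Tc + Td)" "W2 = bnums t s \<union> Wc \<union> Wd"
    by cases (use exec_While_True.hyps(1) in simp_all)
  from exec_While_True.IH(1)[OF 1] have u: "Ta = Tc \<and> Wa = Wc \<and> s' = u" .
  then have "exec (While t c) s' Td Wd s2" using 2 by simp
  from exec_While_True.IH(2)[OF this] u 3 show ?case by simp
qed

definition input_state :: "nat \<Rightarrow> (nat \<Rightarrow> int) \<Rightarrow> int \<Rightarrow> real \<Rightarrow> state" where
  "input_state n a b \<epsilon> = (\<lambda>_ _. 0)
     (''n'' := (\<lambda>_. 0)(0 := of_nat n),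
      ''a'' := (\<lambda>i. if i < n then of_int (a i) else 0),
      ''b'' := (\<lambda>_. 0)(0 := of_int b),
      ''eps'' := (\<lambda>_. 0)(0 := \<epsilon>))"

text \<open>
  The output is in floating-point form, mantissa \<open>Z[0]\<close> and binary exponent \<open>Z[1]\<close>. The volume
  can be as small as $1 / (n! (2^{L-1}-1)^n)$, and then a rational of comparable size has a
  denominator of about $n (L + \log n)$ bits, so that a single number of
  $O(L + \log (n/\varepsilon))$ bits cannot hold the result.
\<close>

definition output_value :: "state \<Rightarrow> real" where
  "output_value s = s ''Z'' 0 * 2 powi \<lfloor>s ''Z'' 1\<rfloor>"

end

theory Submission
  imports Defs
begin

text \<open>
  Substituting \<open>1 - x\<close> for the variables with negative coefficient, all weights may be taken
  nonnegative. Let \<open>f\<^sub>k t\<close> be the volume cut out of the \<open>k\<close>-dimensional cube by the first \<open>k\<close> weights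
  and capacity \<open>t\<close>. Then \<open>f\<^sub>k\<^sub>+\<^sub>1 t\<close> is the mean of \<open>f\<^sub>k\<close> over \<open>[t - A\<^sub>k, t]\<close>. After scaling weights and
  capacity by \<open>N\<close>, of order \<open>n\<^sup>2 / \<delta>\<close>, replace \<open>f\<^sub>k\<close> by a step function on a fixed grid with ratio
  \<open>1 + 1/N\<close>, rounding arguments up. The rounding only enlarges the capacity, after \<open>n\<close> steps by
  a factor of about \<open>1 + 2n/N\<close>, and \<open>f\<^sub>n (c t) \<le> c\<^sup>n f\<^sub>n t\<close> for \<open>c \<ge> 1\<close> turns this into a factor
  \<open>1 + O(\<delta>)\<close> of the volume. The means are differences of prefix sums. The values range over exponentially
  many orders of magnitude, so they are kept as floating-point numbers with mantissas between
  \<open>N\<close> and \<open>2 N\<close>, always rounded up.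
\<close>

section \<open>The volume as an iterated integral\<close>

text \<open>Rounding perturbs a capacity additively, by about one unit per coordinate, so a relative
  guarantee needs a capacity that is large against \<open>n\<close>. Integrality supplies it: after
  scaling by \<open>N\<close> a positive capacity is at least \<open>N\<close>, and a shift by
  \<open>n + 1\<close> is a factor \<open>1 + (n + 1) / N\<close>. Capacities at or below zero admit
  no such argument and are settled separately, the volume being 0 or 1. The total loss is
  \<open>(1 + 1/N) ^ (4 n + 2 n (n + 1))\<close>, four factors per round for the arithmetic and the
  rest for the grid; \<open>N = 16 n\<^sup>2 m\<close> with \<open>1/m \<le> \<epsilon>\<close>
  absorbs it. Window means are differences, and upper bounds on two prefix sums bound their
  difference in neither direction. Hence the rounding controls the increments of the sums, not the
  sums themselves. With \<open>\<Lambda> = log 2 (n / \<delta>) + L\<close> the grid has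
  O(\<open>N \<Lambda>\<close>) points, and each of the \<open>n\<close> rounds spends
  O(\<open>\<Lambda>\<close>) operations per point, as normalization proceeds by single
  doublings.\<close>

lemma mono_bounded_integrable_on:
  fixes f :: "real \<Rightarrow> real"
  assumes "mono f" and "\<And>x. \<bar>f x\<bar> \<le> 1"
  shows "(\<lambda>x. f (c + d * x)) integrable_on {u..v}"
proof (rule measurable_bounded_by_integrable_imp_integrable_real)
  have "f \<in> borel_measurable borel" using assms(1) by (rule borel_measurable_mono)
  then have "(\<lambda>x. f (c + d * x)) \<in> borel_measurable borel" by measurable
  then show "(\<lambda>x. f (c + d * x)) \<in> borel_measurable (lebesgue_on {u..v})"
    by (simp add: borel_measurable_if_D measurable_completion measurable_restrict_space1)
  show "(\<lambda>x. 1::real) integrable_on {u..v}" by (rule integrable_const_ivl)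
qed (use assms in auto)

text \<open>
  With \<open>r\<close> the identity, \<open>cvol r A k t\<close> is the volume of the part of the \<open>k\<close>-dimensional unit cube
  cut out by capacity \<open>t\<close>; a rounding function \<open>r\<close> is applied to the remaining capacity after
  each coordinate.
\<close>

fun cvol :: "(real \<Rightarrow> real) \<Rightarrow> (nat \<Rightarrow> real) \<Rightarrow> nat \<Rightarrow> real \<Rightarrow> real" where
  "cvol r A 0 t = (if 0 \<le> t then 1 else 0)"
| "cvol r A (Suc k) t = integral {0..1} (\<lambda>x. cvol r A k (r (t - A k * x)))"

text \<open>Monotonicity and boundedness go through one induction because integrability of the next
  integrand rests on both. Continuity cannot serve: dimension zero is already a jump, and rounding
  adds more.\<close>

lemma cvol_mono_bounds:
  assumes "mono r"
  shows "mono (cvol r A k) \<and> (\<forall>t. 0 \<le> cvol r A k t \<and> cvol r A k t \<le> 1)"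
proof (induction k)
  case 0
  show ?case by (auto simp: mono_def)
next
  case (Suc k)
  have m: "mono (\<lambda>t. cvol r A k (r t))"
    using Suc assms by (auto simp: mono_def)
  have int: "(\<lambda>x. cvol r A k (r (t - A k * x))) integrable_on {0..1}" for t
    using mono_bounded_integrable_on[OF m, of t "- A k" 0 1] Suc by simp
  have "mono (cvol r A (Suc k))"
    using m int by (auto intro!: monoI integral_le simp: mono_def)
  moreover have "0 \<le> cvol r A (Suc k) t" for t
    using Suc int by (auto intro!: integral_nonneg)
  moreover have "cvol r A (Suc k) t \<le> 1" for t
    using integral_le[OF int[of t] integrable_const_ivl[of 1 0 1]] Suc by simp
  ultimately show ?case by blast
qed

lemma cvol_mono: "mono r \<Longrightarrow> x \<le> y \<Longrightarrow> cvol r A k x \<le> cvol r A k y"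
  using cvol_mono_bounds by (auto simp: mono_def)

lemma cvol_nonneg: "mono r \<Longrightarrow> 0 \<le> cvol r A k x"
  and cvol_le_1: "mono r \<Longrightarrow> cvol r A k x \<le> 1"
  using cvol_mono_bounds by auto

lemma cvol_integrable:
  assumes "mono r"
  shows "(\<lambda>x. cvol r A k (r (c + d * x))) integrable_on {u..v}"
proof (rule mono_bounded_integrable_on)
  show "mono (\<lambda>t. cvol r A k (r t))"
    using assms by (auto intro!: monoI cvol_mono simp: monoD)
  show "\<bar>cvol r A k (r x)\<bar> \<le> 1" for x
    using cvol_nonneg[OF assms, of A k "r x"] cvol_le_1[OF assms, of A k "r x"] by linarith
qed

lemma cvol_integrable_minus:
  "mono r \<Longrightarrow> (\<lambda>x. cvol r A k (r (c - d * x))) integrable_on {u..v}"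
  using cvol_integrable[of r A k c "- d" u v] by simp

lemma mono_ident [simp]: "mono (\<lambda>u::real. u)"
  by (simp add: mono_def)

lemma cvol_id_integrable:
  "(\<lambda>x. cvol (\<lambda>u. u) A k (c - d * x)) integrable_on {u..v}"
  using cvol_integrable_minus[of "\<lambda>u. u" A k c d u v] by (simp add: mono_def)

text \<open>Nonnegative weights only lower the capacity and \<open>r\<close> keeps it negative, so
  the final test \<open>0 \<le> t\<close> in dimension zero always fails.\<close>

lemma cvol_neg:
  assumes "mono r" "\<And>u. u < 0 \<Longrightarrow> r u < 0" "\<And>i. A i \<ge> 0" "t < 0"
  shows "cvol r A k t = 0"
  using assms(4)
proof (induction k arbitrary: t)
  case (Suc k)
  have "cvol r A k (r (t - A k * x)) = 0" if "x \<in> {0..1}" for x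
    by (rule Suc.IH, rule assms(2)) (use Suc.prems assms(3)[of k] that in
        \<open>auto intro: less_le_trans[of _ 0]\<close>)
  then have "cvol r A (Suc k) t = integral {0..1} (\<lambda>x::real. 0)"
    unfolding cvol.simps by (rule Henstock_Kurzweil_Integration.integral_cong)
  then show ?case by simp
qed simp

lemma cvol_le_cvol:
  assumes "mono r" "mono r'" "\<And>u. r u \<le> r' u"
  shows "cvol r A k t \<le> cvol r' A k t"
proof (induction k arbitrary: t)
  case (Suc k)
  have "cvol r A k (r u) \<le> cvol r' A k (r' u)" for u
    using Suc.IH[of "r u"] cvol_mono[OF assms(2) assms(3)[of u], of A k] by linarith
  then show ?case
    by (auto intro!: integral_le cvol_integrable_minus assms)
qed simp

text \<open>
  Rounding the capacity up costs an additive shift and a relative enlargement of the capacity, not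
  of the volume, and these simply accumulate over the coordinates.
\<close>

lemma cvol_rounding_le:
  assumes "mono r" "\<And>u. u < 0 \<Longrightarrow> r u < 0" "\<And>i. A i \<ge> 0"
    and r: "\<And>u. u \<ge> 0 \<Longrightarrow> r u \<le> l * u + 1" and l: "l \<ge> 1"
  shows "cvol r A k t \<le> cvol (\<lambda>u. u) A k (l ^ k * (t + real k))"
proof (induction k arbitrary: t)
  case (Suc k)
  let ?t = "l ^ Suc k * (t + real (Suc k))"
  have "cvol r A k (r (t - A k * x)) \<le> cvol (\<lambda>u. u) A k (?t - A k * x)" if "x \<in> {0..1}" for x
  \<comment> \<open>The bound on \<open>r\<close> covers nonnegative arguments only; below 0 the
    left side vanishes.\<close>
  proof (cases "t - A k * x < 0")
    case True
    then have "cvol r A k (r (t - A k * x)) = 0"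
      by (intro cvol_neg assms)
    then show ?thesis by (simp add: cvol_nonneg)
  next
    case False
    have lk: "l ^ k \<ge> 1" using l by simp
    have lS: "l ^ Suc k \<ge> 1" using l by (rule one_le_power)
    have "l ^ k * (r (t - A k * x) + real k) \<le> l ^ k * (l * (t - A k * x) + 1 + real k)"
      using r[of "t - A k * x"] False lk by (intro mult_left_mono) auto
    also have "\<dots> = l ^ Suc k * (t - A k * x) + l ^ k * (1 + real k)"
      by (simp add: algebra_simps)
    also have "\<dots> \<le> l ^ Suc k * (t - A k * x) + l ^ Suc k * (1 + real k)"
      using l by (intro add_left_mono mult_right_mono power_increasing) auto
    also have "\<dots> = ?t - l ^ Suc k * (A k * x)" by (simp add: algebra_simps)
    \<comment> \<open>The factor \<open>l ^ Suc k\<close> enlarges the subtracted weight as well;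
      dropping it there only raises the remaining capacity, so the weights stay the same.\<close>
    also have "\<dots> \<le> ?t - A k * x"
      using mult_right_mono[OF lS, of "A k * x"] assms(3)[of k] that by simp
    finally have "cvol (\<lambda>u. u) A k (l ^ k * (r (t - A k * x) + real k)) \<le> cvol (\<lambda>u. u) A k (?t - A k * x)"
      by (intro cvol_mono) auto
    with Suc.IH[of "r (t - A k * x)"] show ?thesis by linarith
  qed
  then show ?case
    by (auto intro!: integral_le cvol_integrable_minus cvol_id_integrable assms)
qed simp

text \<open>Shrinking by \<open>1/l\<close> maps the larger body into the smaller one, since
  \<open>l \<ge> 1\<close> keeps the shrunken cube inside the unit cube. In one coordinate this is
  the substitution of \<open>x / l\<close> followed by the inclusion of \<open>{0..1/l}\<close> in
  \<open>{0..1}\<close>.\<close>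

lemma cvol_dilate:
  assumes A: "\<And>i. A i \<ge> 0" and l: "l \<ge> 1"
  shows "cvol (\<lambda>u. u) A k (l * t) \<le> l ^ k * cvol (\<lambda>u. u) A k t"
proof (induction k arbitrary: t)
  case 0
  then show ?case using l by (simp add: zero_le_mult_iff)
next
  case (Suc k)
  let ?f = "\<lambda>x. cvol (\<lambda>u. u) A k (t - A k * x)"
  have "(?f has_integral integral {0..1/l} ?f) {0..1/l}"
    using cvol_id_integrable by (simp add: integrable_integral)
  note s = has_integral_stretch_real[OF this, of "1/l"]
  have "(\<lambda>x. x * l) ` {0..1 / l} = {0..1}"
    using l image_mult_atLeastAtMost[of l 0 "1 / l"] by (simp add: mult.commute)
  with s
  have s: "((\<lambda>x. cvol (\<lambda>u. u) A k (t - A k * x / l)) has_integral l * integral {0..1/l} ?f) {0..1}"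
    using l by simp
  have "cvol (\<lambda>u. u) A k (l * t - A k * x) \<le> l ^ k * cvol (\<lambda>u. u) A k (t - A k * x / l)" for x
    using Suc.IH[of "t - A k * x / l"] l by (simp add: right_diff_distrib)
  then have "cvol (\<lambda>u. u) A (Suc k) (l * t) \<le> l ^ k * (l * integral {0..1/l} ?f)"
    unfolding cvol.simps
    by (intro has_integral_le[OF integrable_integral has_integral_mult_right[OF s]]
        cvol_id_integrable) auto
  also have "integral {0..1/l} ?f \<le> integral {0..1} ?f"
    using l by (intro integral_subset_le cvol_id_integrable) (auto simp: cvol_nonneg)
  finally show ?case using l by (simp add: mult_left_mono mult_ac)
qed

lemma cvol_scale:
  assumes "c > 0"
  shows "cvol (\<lambda>u. u) (\<lambda>i. c * A i) k (c * t) = cvol (\<lambda>u. u) A k t"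
proof (induction k arbitrary: t)
  case 0
  then show ?case using assms by (simp add: zero_le_mult_iff)
next
  case (Suc k)
  have "cvol (\<lambda>u. u) (\<lambda>i. c * A i) k (c * t - c * A k * x) = cvol (\<lambda>u. u) A k (t - A k * x)" for x
    using Suc.IH[of "t - A k * x"] by (simp add: right_diff_distrib mult.assoc)
  then show ?case by simp
qed

lemma cvol_flip:
  "cvol (\<lambda>u. u) (\<lambda>i. \<bar>A i\<bar>) k (t + (\<Sum>i<k. max 0 (- A i))) = cvol (\<lambda>u. u) A k t"
proof (induction k arbitrary: t)
  case 0
  then show ?case by simp
next
  case (Suc k)
  let ?s = "\<Sum>i<k. max 0 (- A i)"
  let ?g = "\<lambda>x. cvol (\<lambda>u. u) (\<lambda>i. \<bar>A i\<bar>) k (t + ?s + max 0 (- A k) - \<bar>A k\<bar> * x)"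
  have "integral {0..1} ?g = integral {0..1} (\<lambda>x. cvol (\<lambda>u. u) A k (t - A k * x))"
  proof (cases "A k \<ge> 0")
    case True
    have "?g x = cvol (\<lambda>u. u) A k (t - A k * x)" for x
      using Suc.IH[of "t - A k * x"] True by (simp add: algebra_simps)
    then show ?thesis by simp
  next
    case False
    have g: "?g x = cvol (\<lambda>u. u) A k (t - A k * (1 - x))" for x
      using Suc.IH[of "t - A k * (1 - x)"] False by (simp add: algebra_simps)
    let ?h = "\<lambda>x. cvol (\<lambda>u. u) A k (t - A k * x)"
    have "(?h has_integral integral {0..1} ?h) (cbox 0 1)"
      using cvol_id_integrable[of A k t "A k" 0 1] by (simp add: integrable_integral)
    from has_integral_affinity[OF this, of "-1" 1]
    have "((\<lambda>x. ?h (1 - x)) has_integral integral {0..1} ?h) {0..1}"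
      by (simp add: image_diff_atLeastAtMost)
    then show ?thesis unfolding g by (rule integral_unique)
  qed
  then show ?case by (simp add: add_ac)
qed

text \<open>Tonelli, with the last coordinate as the outer variable, in line with the recursion of
  \<open>cvol\<close>.\<close>

lemma emeasure_knapsack:
  "emeasure (\<Pi>\<^sub>M i\<in>{..<k}. (lborel :: real measure))
     {x \<in> {..<k} \<rightarrow>\<^sub>E {0..1}. (\<Sum>i<k. A i * x i) \<le> t} = ennreal (cvol (\<lambda>u. u) A k t)"
proof (induction k arbitrary: t)
  case 0
  have "(\<Pi>\<^sub>M i\<in>{..<0::nat}. (lborel :: real measure)) = count_space {\<lambda>_. undefined}"
    by (simp add: PiM_empty)
  moreover have "{x \<in> {..<0::nat} \<rightarrow>\<^sub>E {0..1::real}. (\<Sum>i<0. A i * x i) \<le> t}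
     = (if 0 \<le> t then {\<lambda>_. undefined} else {})" by auto
  ultimately show ?case by simp
next
  case (Suc k)
  interpret product_sigma_finite "\<lambda>_. lborel :: real measure" ..
  let ?P = "\<lambda>k t. {x \<in> {..<k} \<rightarrow>\<^sub>E {0..1}. (\<Sum>i<k. A i * x i) \<le> t}"
  let ?M = "\<lambda>k. \<Pi>\<^sub>M i\<in>{..<k}. (lborel :: real measure)"
  have meas: "?P k t \<in> sets (?M k)" for k t
  proof -
    have "{x \<in> space (?M k). (\<forall>i\<in>{..<k}. x i \<in> {0..1}) \<and> (\<Sum>i<k. A i * x i) \<le> t} \<in> sets (?M k)"
      by measurable
    moreover have "?P k t = {x \<in> space (?M k). (\<forall>i\<in>{..<k}. x i \<in> {0..1}) \<and> (\<Sum>i<k. A i * x i) \<le> t}"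
      by (auto simp: space_PiM PiE_def)
    ultimately show ?thesis by simp
  qed
  have ins: "{..<Suc k} = insert k {..<k}" by auto
  have "emeasure (?M (Suc k)) (?P (Suc k) t) = (\<integral>\<^sup>+x. indicator (?P (Suc k) t) x \<partial>?M (Suc k))"
    using meas by (simp add: nn_integral_indicator)
  also have "\<dots> = (\<integral>\<^sup>+ y. (\<integral>\<^sup>+ x. indicator (?P (Suc k) t) (x(k := y)) \<partial>?M k) \<partial>lborel)"
    unfolding ins using meas[of "Suc k" t]
    by (intro product_nn_integral_insert_rev) (auto simp: ins)
  also have "\<dots> = (\<integral>\<^sup>+ y. ennreal (cvol (\<lambda>u. u) A k (t - A k * y)) * indicator {0..1} y \<partial>lborel)"
  proof (intro nn_integral_cong)
    fix y :: real
    have "(\<integral>\<^sup>+ x. indicator (?P (Suc k) t) (x(k := y)) \<partial>?M k)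
        = (\<integral>\<^sup>+ x. indicator (?P k (t - A k * y)) x * indicator {0..1} y \<partial>?M k)"
    proof (intro nn_integral_cong)
      fix x assume "x \<in> space (?M k)"
      then have x: "x \<in> extensional {..<k}" by (simp add: space_PiM PiE_def)
      have "x(k := y) \<in> ?P (Suc k) t \<longleftrightarrow> x \<in> ?P k (t - A k * y) \<and> y \<in> {0..1}"
      proof -
        have "(\<Sum>i<Suc k. A i * (x(k := y)) i) = (\<Sum>i<k. A i * x i) + A k * y" by simp
        moreover have "x(k := y) \<in> {..<Suc k} \<rightarrow>\<^sub>E {0..1} \<longleftrightarrow> x \<in> {..<k} \<rightarrow>\<^sub>E {0..1} \<and> y \<in> {0..1}"
          using x by (force simp: PiE_def extensional_def Pi_def less_Suc_eq)
        ultimately show ?thesis by auto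
      qed
      then show "indicator (?P (Suc k) t) (x(k := y))
          = (indicator (?P k (t - A k * y)) x * indicator {0..1} y :: ennreal)"
        by (auto simp: indicator_def)
    qed
    also have "\<dots> = emeasure (?M k) (?P k (t - A k * y)) * indicator {0..1} y"
      using meas by (simp add: nn_integral_multc nn_integral_indicator)
    finally show "(\<integral>\<^sup>+ x. indicator (?P (Suc k) t) (x(k := y)) \<partial>?M k)
      = ennreal (cvol (\<lambda>u. u) A k (t - A k * y)) * indicator {0..1} y" using Suc.IH by simp
  qed
  also have "\<dots> = ennreal (cvol (\<lambda>u. u) A (Suc k) t)"
    unfolding cvol.simps
    by (intro nn_integral_has_integral_lebesgue' integrable_integral cvol_id_integrable)
      (simp add: cvol_nonneg)
  finally show ?case .
qed

lemma vol_knapsack_polytope: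
  "vol n (knapsack_polytope n a b) = cvol (\<lambda>u. u) (\<lambda>i. real_of_int (a i)) n (real_of_int b)"
  unfolding vol_def knapsack_polytope_def measure_def emeasure_knapsack
  by (simp add: cvol_nonneg)

section \<open>The capacity grid\<close>

text \<open>
  Consecutive points have gap 1 up to \<open>N\<close> and ratio about \<open>1 + 1/N\<close> beyond, so rounding up to the
  grid is a relative error \<open>1/N\<close> plus an additive error 1.
\<close>

fun grid :: "nat \<Rightarrow> nat \<Rightarrow> nat" where
  "grid N 0 = 0"
| "grid N (Suc j) = grid N j + 1 + grid N j div N"

lemma grid_strict_mono: "strict_mono (grid N)"
  by (rule strict_monoI_Suc) simp

lemma grid_less_iff [simp]: "grid N i < grid N j \<longleftrightarrow> i < j"
  and grid_le_iff [simp]: "grid N i \<le> grid N j \<longleftrightarrow> i \<le> j"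
  using strict_mono_less[OF grid_strict_mono] strict_mono_less_eq[OF grid_strict_mono] by auto

lemma le_grid: "j \<le> grid N j"
  by (rule strict_mono_imp_increasing[OF grid_strict_mono])

lemma real_div_bounds:
  "real (m div N) \<le> real m / real N" "real m / real N \<le> real (m div N) + 1"
proof -
  have "real (m div N) = of_int \<lfloor>real m / real N\<rfloor>"
    by (simp add: floor_divide_of_nat_eq)
  then show "real (m div N) \<le> real m / real N" "real m / real N \<le> real (m div N) + 1"
    by linarith+
qed

lemma grid_Suc_le:
  assumes "N > 0" shows "real (grid N (Suc j)) \<le> (1 + 1 / real N) * real (grid N j) + 1"
  using real_div_bounds(1)[of "grid N j" N] by (simp add: algebra_simps)

lemma grid_Suc_ge:
  assumes "N > 0" shows "real (grid N (Suc j)) \<ge> (1 + 1 / real N) * real (grid N j)"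
proof -
  have "real (grid N j) / real N \<le> real (grid N j div N) + 1"
    using real_div_bounds(2)[of "grid N j" N] by linarith
  then show ?thesis by (simp add: algebra_simps)
qed

text \<open>Ratios are at least \<open>1 + 1/N\<close> and \<open>(1 + 1/N) ^ N \<ge> 2\<close> by
  Bernoulli, so \<open>N\<close> steps double the grid point. The count starts at index 1, as point
  0 is 0. This keeps the number of grid points linear in the logarithm of the capacity.\<close>

lemma grid_ge_power2:
  assumes N: "N > 0" shows "2 ^ i \<le> real (grid N (Suc (i * N)))"
proof -
  let ?l = "1 + 1 / real N"
  have "?l ^ j \<le> real (grid N (Suc j))" for j
  proof (induction j)
    case (Suc j)
    have "?l ^ Suc j \<le> ?l * real (grid N (Suc j))"
      using Suc by (simp only: power_Suc) (intro mult_left_mono, auto)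
    with grid_Suc_ge[OF N, of "Suc j"] show ?case by linarith
  qed simp
  then have *: "?l ^ (i * N) \<le> real (grid N (Suc (i * N)))" .
  have "1 + real N * (1 / real N) \<le> ?l ^ N"
    by (rule Bernoulli_inequality) (use order.trans[of "-1" 0 "1 / real N"] in simp)
  with N have "2 \<le> ?l ^ N" by simp
  then have "2 ^ i \<le> (?l ^ N) ^ i" by (rule power_mono) simp
  with * show ?thesis by (simp add: power_mult[symmetric] mult.commute)
qed

declare grid.simps(2) [simp del]

text \<open>Negative arguments stay as they are: rounded up to 0 they would count as feasible
  capacities.\<close>

definition grid_up :: "nat \<Rightarrow> real \<Rightarrow> real" where
  "grid_up N u = (if u < 0 then u else real (grid N (LEAST j. u \<le> real (grid N j))))"

lemma ex_grid_ge: "\<exists>j. u \<le> real (grid N j)"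
proof -
  obtain j where "u \<le> real j" using real_arch_simple by blast
  with le_grid[of j N] show ?thesis by (meson of_nat_mono order.trans)
qed

lemma grid_up_ge: "u \<le> grid_up N u"
  using LeastI_ex[OF ex_grid_ge[of u N]] by (simp add: grid_up_def)

lemma grid_up_neg: "u < 0 \<Longrightarrow> grid_up N u < 0"
  by (simp add: grid_up_def)

lemma grid_up_mono: "mono (grid_up N)"
proof (rule monoI)
  fix u v :: real assume "u \<le> v"
  then have "v \<le> real (grid N j) \<Longrightarrow> u \<le> real (grid N j)" for j by linarith
  then have "(LEAST j. u \<le> real (grid N j)) \<le> (LEAST j. v \<le> real (grid N j))"
    by (intro Least_le) (use LeastI_ex[OF ex_grid_ge[of v N]] in blast)
  with \<open>u \<le> v\<close> show "grid_up N u \<le> grid_up N v"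
    by (auto simp: grid_up_def intro: order.trans[of _ 0])
qed

lemma grid_up_eq:
  assumes "real (grid N i) < u" "u \<le> real (grid N (Suc i))"
  shows "grid_up N u = real (grid N (Suc i))"
proof -
  have "(LEAST j. u \<le> real (grid N j)) = Suc i"
  proof (rule Least_equality)
    fix j assume "u \<le> real (grid N j)"
    with assms(1) have "grid N i < grid N j" by linarith
    then show "Suc i \<le> j" by (simp only: grid_less_iff Suc_le_eq)
  qed (rule assms)
  moreover have "\<not> u < 0" using assms(1) by (simp add: order.strict_implies_order le_less_trans)
  ultimately show ?thesis by (simp add: grid_up_def)
qed

lemma grid_up_grid [simp]: "grid_up N (real (grid N j)) = real (grid N j)"
proof (cases j)
  case (Suc i)
  then show ?thesis using grid_up_eq[of N i "real (grid N j)"] by simp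
next
  case 0
  have "(LEAST j. 0 \<le> real (grid N j)) = 0" by (rule Least_eq_0) simp
  then show ?thesis using 0 by (simp add: grid_up_def)
qed

lemma ex_grid_cell:
  assumes "u > 0" shows "\<exists>i. real (grid N i) < u \<and> u \<le> real (grid N (Suc i))"
proof -
  define j where "j = (LEAST j. u \<le> real (grid N j))"
  have j: "u \<le> real (grid N j)" unfolding j_def using LeastI_ex[OF ex_grid_ge] .
  with assms obtain i where i: "j = Suc i" by (cases j) auto
  have "\<not> u \<le> real (grid N i)" using not_less_Least[of i "\<lambda>j. u \<le> real (grid N j)"] i
    by (simp add: j_def[symmetric])
  with j i have "real (grid N i) < u \<and> u \<le> real (grid N (Suc i))" by (simp only: not_le)
  then show ?thesis by blast
qed

lemma grid_up_le:
  assumes "N > 0" "u \<ge> 0" shows "grid_up N u \<le> (1 + 1 / real N) * u + 1"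
proof (cases "u = 0")
  case True
  then show ?thesis using grid_up_grid[of N 0] by simp
next
  case False
  with assms obtain i where i: "real (grid N i) < u" "u \<le> real (grid N (Suc i))"
    using ex_grid_cell[of u N] by auto
  have "(1 + 1 / real N) * real (grid N i) \<le> (1 + 1 / real N) * u"
    using i by (intro mult_left_mono) auto
  with grid_Suc_le[OF assms(1), of i] grid_up_eq[OF i] show ?thesis by linarith
qed

text \<open>The integrand is a step function, constant on each half-open cell with the value at its
  right end, and zero below 0. So the integral over the window is a finite sum: the part of the cell
  above \<open>U\<close>, then whole cells up to \<open>j\<close>. \<open>U\<close> is the lower end
  of the window clipped at 0.\<close>

lemma cvol_grid_Suc:
  fixes A :: "nat \<Rightarrow> real"
  assumes A: "\<And>i. 0 \<le> A i" "0 < A k"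
    and U: "U = max 0 (real (grid N j) - A k)"
    and p: "p < j" "real (grid N p) \<le> U" "U \<le> real (grid N (Suc p))"
  shows "A k * cvol (grid_up N) A (Suc k) (real (grid N j)) =
    cvol (grid_up N) A k (real (grid N (Suc p))) * (real (grid N (Suc p)) - U) +
    (\<Sum>i\<in>{Suc p<..j}. cvol (grid_up N) A k (real (grid N i)) *
       (real (grid N i) - real (grid N (i - 1))))" (is "_ = ?w j")
proof -
  let ?T = "\<lambda>i. real (grid N i)"
  let ?H = "cvol (grid_up N) A k"
  let ?f = "\<lambda>u. ?H (grid_up N u)"
  have cell: "(?f has_integral ?H (?T (Suc i)) * (?T (Suc i) - v)) {v..?T (Suc i)}"
    if "?T i \<le> v" "v \<le> ?T (Suc i)" for i v
  proof -
    have "((\<lambda>u. ?H (?T (Suc i))) has_integral (?T (Suc i) - v) *\<^sub>R ?H (?T (Suc i))) {v..?T (Suc i)}"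
      using has_integral_const_real[of "?H (?T (Suc i))" v "?T (Suc i)"] that by simp
    \<comment> \<open>At the left end \<open>v\<close> the rounding may yield the previous grid
      point; a single point does not change the integral.\<close>
    then have "(?f has_integral (?T (Suc i) - v) *\<^sub>R ?H (?T (Suc i))) {v..?T (Suc i)}"
    proof (rule has_integral_spike_finite[rotated 2])
      fix u assume "u \<in> {v..?T (Suc i)} - {v}"
      with that show "?f u = ?H (?T (Suc i))" by (subst grid_up_eq[of N i u]) auto
    qed simp
    then show ?thesis by (simp add: mult.commute)
  qed
  \<comment> \<open>\<open>d\<close> is the number of whole cells above the partial one.\<close>
  have "(?f has_integral ?w (Suc p + d)) {U..?T (Suc p + d)}" for d
  proof (induction d)
    case 0
    then show ?case using cell[OF p(2,3)] by simp
  next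
    case (Suc d)
    have "U \<le> ?T (Suc p + d)" 
      using p(3) by (rule order.trans) (simp only: of_nat_le_iff grid_le_iff le_add1)
    moreover have "?T (Suc p + d) \<le> ?T (Suc p + Suc d)" by simp
    moreover have "{Suc p<..Suc p + Suc d} = insert (Suc (Suc p + d)) {Suc p<..Suc p + d}" by auto
    ultimately show ?case
      using has_integral_combine[OF _ _ Suc.IH cell[of "Suc p + d" "?T (Suc p + d)"]]
      by (simp add: add.commute add.left_commute)
  qed
  from this[of "j - Suc p"] p(1) have "(?f has_integral ?w j) {U..?T j}" by simp
  \<comment> \<open>Either nothing was clipped and the interval is a point, or \<open>U = 0\<close>
    and the interval lies where the integrand vanishes, except perhaps at 0.\<close>
  moreover have "(?f has_integral 0) {?T j - A k..U}"
  proof (cases "?T j - A k \<ge> 0")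
    case True
    then show ?thesis using U has_integral_refl(2)[of ?f U] by simp
  next
    case False
    then have U0: "U = 0" using U by simp
    show ?thesis
    proof (rule has_integral_spike_finite[OF _ _ has_integral_0])
      show "finite {0::real}" by simp
      fix u assume "u \<in> {?T j - A k..U} - {0}"
      then have "grid_up N u < 0" using U0 by (intro grid_up_neg) auto
      then show "?f u = 0" by (intro cvol_neg) (auto simp: grid_up_mono grid_up_neg A)
    qed
  qed
  moreover have "U \<le> ?T j" using U A by auto
  moreover have "?T j - A k \<le> U" using U by simp
  ultimately have "(?f has_integral ?w j) {?T j - A k..?T j}"
    using has_integral_combine[of "?T j - A k" U "?T j" ?f 0 "?w j"] by simp
  then obtain w where w: "w = ?w j" "(?f has_integral w) (cbox (?T j - A k) (?T j))" by simp
  \<comment> \<open>The substitution \<open>u = T j - A k * x\<close> returns to the unit interval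
    and brings in the factor \<open>1 / A k\<close>.\<close>
  from has_integral_affinity[OF w(2), of "- A k" "?T j"] A(2)
  have "((\<lambda>x. ?f (?T j - A k * x)) has_integral w / A k)
     ((\<lambda>x. - (x / A k) + ?T j / A k) ` {?T j - A k..?T j})"
    by simp
  moreover have "(\<lambda>x. - (x / A k) + ?T j / A k) ` {?T j - A k..?T j} = {0..1}"
  proof -
    have "(\<lambda>x. (- 1 / A k) * x + ?T j / A k) ` {?T j - A k..?T j} = {0..1}"
      using A(2) by (subst image_affinity_atLeastAtMost) (auto simp: field_simps)
    then show ?thesis by simp
  qed
  ultimately have "cvol (grid_up N) A (Suc k) (?T j) = w / A k"
    by (simp add: integral_unique)
  then show ?thesis unfolding w(1)[symmetric] using A(2) by simp
qed

lemma cvol_grid_Suc_zero: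
  "A k = 0 \<Longrightarrow> cvol (grid_up N) A (Suc k) (real (grid N j)) = cvol (grid_up N) A k (real (grid N j))"
  by simp

text \<open>With \<open>l = 1 + 1/N\<close>, the rounding turns \<open>t\<close> into
  \<open>l ^ n * (t + n)\<close>, and \<open>t + n \<le> l * (B + n + 1)\<close>. Since
  \<open>N \<le> B\<close>, the shift \<open>n + 1\<close> is at most
  \<open>(n + 1) / N * B\<close>, so \<open>B + n + 1 \<le> l ^ (n + 1) * B\<close> by Bernoulli.
  The capacity grows by \<open>l ^ (2 (n + 1))\<close> in all, and dilation raises this to the power
  \<open>n\<close>. The form of the bound on \<open>t\<close> fits the first grid point above
  \<open>B\<close>.\<close>

lemma cvol_grid_upper:
  assumes "N > 0" "\<And>i. 0 \<le> A i" "real N \<le> B" "t \<le> (1 + 1 / real N) * B + 1"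
  shows "cvol (grid_up N) A n t \<le> (1 + 1 / real N) ^ (2 * n * (n + 1)) * cvol (\<lambda>u. u) A n B"
proof -
  let ?l = "1 + 1 / real N"
  have l: "?l \<ge> 1" by simp
  have B: "B > 0" using assms by linarith
  have "cvol (grid_up N) A n t \<le> cvol (\<lambda>u. u) A n (?l ^ n * (t + real n))"
    using assms l by (intro cvol_rounding_le grid_up_le) (auto simp: grid_up_mono grid_up_neg)
  also have "\<dots> \<le> cvol (\<lambda>u. u) A n (?l ^ (2 * (n + 1)) * B)"
  proof (intro cvol_mono)
    have "1 + real (n + 1) * (1 / real N) \<le> ?l ^ (n + 1)"
      by (rule Bernoulli_inequality) (use order.trans[of "-1" 0 "1 / real N"] in simp)
    then have "(1 + real (n + 1) / real N) * B \<le> ?l ^ (n + 1) * B"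
      using B by (intro mult_right_mono) auto
    moreover have "real (n + 1) \<le> real (n + 1) / real N * B"
      using mult_left_mono[OF assms(3), of "real (n+1) / real N"] assms(1) by simp
    moreover have "t + real n \<le> ?l * (B + real (n + 1))"
    proof -
      have "real (n + 1) \<le> ?l * real (n + 1)"
        using mult_right_mono[OF l, of "real (n + 1)"] by simp
      moreover have "?l * (B + real (n + 1)) = ?l * B + ?l * real (n + 1)"
        by (rule distrib_left)
      ultimately show ?thesis using assms(4) of_nat_add[of n 1, where ?'a = real] by linarith
    qed
    ultimately have "t + real n \<le> ?l * (?l ^ (n + 1) * B)"
      using mult_left_mono[of "B + real (n + 1)" "?l ^ (n + 1) * B" ?l]
      by (simp add: algebra_simps)
    then have "?l ^ n * (t + real n) \<le> ?l ^ n * (?l * (?l ^ (n + 1) * B))"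
      by (intro mult_left_mono) auto
    also have "\<dots> = ?l ^ (2 * (n + 1)) * B"
      by (simp add: power_add[symmetric] mult.assoc[symmetric] power_Suc2[symmetric] mult_2 del: power_Suc)
    finally show "?l ^ n * (t + real n) \<le> ?l ^ (2 * (n + 1)) * B" .
  qed simp
  also have "\<dots> \<le> (?l ^ (2 * (n + 1))) ^ n * cvol (\<lambda>u. u) A n B"
    using assms l by (intro cvol_dilate one_le_power) auto
  also have "(?l ^ (2 * (n + 1))) ^ n = ?l ^ (2 * n * (n + 1))"
    unfolding power_mult[symmetric] by (simp only: mult_ac)
  finally show ?thesis .
qed

section \<open>One round in floating-point arithmetic\<close>

text \<open>
  \<open>M j\<close>, \<open>E j\<close> are mantissa and exponent of an approximation of \<open>N * H j\<close>, and \<open>GM j\<close>, \<open>GE j\<close> those of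
  its prefix sums, rounded up so that their increments still dominate the summands. The table \<open>h\<close>
  of powers of 1/2 reads 0 beyond \<open>K\<close>, which is harmless as all mantissas are at most \<open>2 ^ K\<close>.
\<close>

locale float_prefix_sums =
  fixes N J K :: nat and \<kappa> :: real and H M E GM GE h :: "nat \<Rightarrow> real"
  assumes N: "N > 0" and J: "J > 0" and \<kappa>: "\<kappa> \<ge> 1"
    and K: "(2 * real N + 2) * real (grid N J) \<le> 2 ^ K"
    and h: "\<And>i. h i = (if i \<le> K then 1 / 2 ^ i else 0)"
    and H_mono: "\<And>i j. i \<le> j \<Longrightarrow> H i \<le> H j"
    and M_Ints: "\<And>j. 1 \<le> j \<Longrightarrow> j \<le> J \<Longrightarrow> M j \<in> \<int>"
    and M_ge: "\<And>j. 1 \<le> j \<Longrightarrow> j \<le> J \<Longrightarrow> real N \<le> M j"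
    and M_le: "\<And>j. 1 \<le> j \<Longrightarrow> j \<le> J \<Longrightarrow> M j \<le> 2 * real N"
    and E_Ints: "\<And>j. 1 \<le> j \<Longrightarrow> j \<le> J \<Longrightarrow> E j \<in> \<int>"
    and lower: "\<And>j. 1 \<le> j \<Longrightarrow> j \<le> J \<Longrightarrow> real N * H j \<le> M j * 2 powr E j"
    and upper: "\<And>j. 1 \<le> j \<Longrightarrow> j \<le> J \<Longrightarrow> M j * 2 powr E j \<le> \<kappa> * (real N * H j)"
    and GM_0: "GM 0 = 0" and GE_0: "GE 0 = E 1"
    and GE_Suc: "\<And>j. j < J \<Longrightarrow> GE (Suc j) = max (GE j) (E (Suc j))"
    and GM_Suc: "\<And>j. j < J \<Longrightarrow> GM (Suc j) =
      of_int \<lfloor>GM j * h (nat \<lfloor>GE (Suc j) - GE j\<rfloor>)\<rfloor> +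
      of_int \<lfloor>M (Suc j) * (real (grid N (Suc j)) - real (grid N j)) *
        h (nat \<lfloor>GE (Suc j) - E (Suc j)\<rfloor>)\<rfloor> + 2"
begin

abbreviation "T j \<equiv> real (grid N j)"
abbreviation "G j \<equiv> GM j * 2 powr GE j"

lemma T_step: "T (Suc j) - T j \<ge> 1"
  by (simp add: grid.simps)

lemma T_mono: "i \<le> j \<Longrightarrow> T i \<le> T j"
  by simp

text \<open>Within the table the shift is exact. Beyond it the product is read as 0, while its true
  value is at most 1 because \<open>y \<le> 2 ^ K\<close>; thus a floor and a missing table entry
  never cost more than 1 together.\<close>

lemma shift:
  assumes r: "r \<in> \<int>" "r \<ge> 0" and y: "0 \<le> y" "y \<le> 2 ^ K"
  defines "d \<equiv> h (nat \<lfloor>r\<rfloor>)"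
  shows "0 \<le> d" "y * d \<le> y * 2 powr - r" "y * 2 powr - r \<le> y * d + 1"
    "y * 2 powr - r \<le> of_int \<lfloor>y * d\<rfloor> + 1"
proof -
  obtain i :: nat where i: "r = real i"
    using r by (metis Ints_cases of_int_0_le_iff nonneg_int_cases of_int_of_nat_eq)
  have p: "2 powr - real i = 1 / 2 ^ i" by (simp add: powr_minus_divide powr_realpow)
  show "0 \<le> d" unfolding d_def h by simp
  show "y * d \<le> y * 2 powr - r" unfolding d_def h i p using y by simp
  have *: "y * 2 powr - r \<le> y * d \<or> (d = 0 \<and> y * 2 powr - r \<le> 1)"
  proof (cases "i \<le> K")
    case True
    then show ?thesis unfolding d_def h i p by simp
  next
    case False
    then have "(2::real) ^ K \<le> 2 ^ i" by (intro power_increasing) auto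
    with y have "y \<le> 2 ^ i" by linarith
    then show ?thesis unfolding i p using False by (simp add: d_def h i)
  qed
  then show "y * 2 powr - r \<le> y * d + 1" by auto
  show "y * 2 powr - r \<le> of_int \<lfloor>y * d\<rfloor> + 1" using * by (auto intro: order.trans)
qed

text \<open>\<open>GE\<close> is the running maximum of the exponents. That it is attained transfers
  integrality and bounds from \<open>E\<close>; \<open>max 1 j\<close> covers the start value
  \<open>GE 0 = E 1\<close>.\<close>

lemma GE_spec:
  "j \<le> J \<Longrightarrow> (\<exists>i. 1 \<le> i \<and> i \<le> max 1 j \<and> GE j = E i) \<and> (\<forall>i. 1 \<le> i \<and> i \<le> j \<longrightarrow> E i \<le> GE j)"
proof (induction j)
  case 0
  show ?case using GE_0 by auto
next
  case (Suc j)
  from Suc.IH Suc.prems obtain i where "1 \<le> i" "i \<le> max 1 j" "GE j = E i" by auto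
  moreover have "GE (Suc j) = GE j \<or> GE (Suc j) = E (Suc j)"
    using GE_Suc[of j] Suc.prems by (auto simp: max_def)
  moreover have "max 1 j \<le> max 1 (Suc j)" "Suc j \<le> max 1 (Suc j)" by auto
  ultimately have "\<exists>i. 1 \<le> i \<and> i \<le> max 1 (Suc j) \<and> GE (Suc j) = E i"
    by (metis One_nat_def Suc_leI le_trans zero_less_Suc)
  moreover have "\<forall>i. 1 \<le> i \<and> i \<le> Suc j \<longrightarrow> E i \<le> GE (Suc j)"
    using Suc GE_Suc[of j] by (auto simp: le_Suc_eq max_def intro: order.trans)
  ultimately show ?case by blast
qed

lemma GE_Ints: "j \<le> J \<Longrightarrow> GE j \<in> \<int>"
  using GE_spec[of j] E_Ints J by (metis le_max_iff_disj max.bounded_iff Suc_leI One_nat_def le_trans)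

lemma GE_ge: "1 \<le> i \<Longrightarrow> i \<le> j \<Longrightarrow> j \<le> J \<Longrightarrow> E i \<le> GE j"
  using GE_spec by blast

lemma GE_mono: "i \<le> j \<Longrightarrow> j \<le> J \<Longrightarrow> GE i \<le> GE j"
proof (induction j)
  case (Suc j)
  then show ?case using GE_Suc[of j] by (cases "i = Suc j") auto
qed simp

text \<open>The exponent \<open>GE j\<close> comes from some \<open>i \<le> j\<close>, whose
  mantissa is at least \<open>N\<close>. Hence \<open>N\<close> units in the last place are at most
  the approximation at \<open>i\<close>, and \<open>H\<close> is monotone.\<close>

lemma ulp_le:
  assumes "1 \<le> j" "j \<le> J" shows "2 powr GE j \<le> \<kappa> * H j"
proof -
  from GE_spec[OF assms(2)] assms obtain i where i: "1 \<le> i" "i \<le> j" "GE j = E i" by auto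
  have "real N * 2 powr E i \<le> M i * 2 powr E i" using M_ge[of i] i assms by simp
  also have "\<dots> \<le> \<kappa> * (real N * H i)" using upper i assms by simp
  also have "\<dots> \<le> \<kappa> * (real N * H j)" using H_mono[of i j] i \<kappa> by (intro mult_left_mono) auto
  finally have "real N * 2 powr E i \<le> real N * (\<kappa> * H j)" by (simp add: mult_ac)
  with i N show ?thesis by simp
qed

text \<open>Forced by the normalization: a mantissa of at least \<open>N > 0\<close> leaves no room
  for \<open>H j \<le> 0\<close> under the upper bound.\<close>

lemma H_pos: assumes "1 \<le> j" "j \<le> J" shows "H j > 0"
proof -
  have "0 < \<kappa> * H j" using ulp_le[OF assms] by (rule less_le_trans[rotated]) simp
  with \<kappa> show ?thesis by (simp add: zero_less_mult_iff)
qed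

lemma le_2K: assumes "j \<le> J" "y \<le> (2 * real N + 2) * T j" shows "y \<le> 2 ^ K"
proof -
  have "(2 * real N + 2) * T j \<le> (2 * real N + 2) * T J"
    using assms by (intro mult_left_mono) auto
  with assms K show ?thesis by linarith
qed

lemma term_bounds:
  assumes "j < J"
  shows "0 \<le> M (Suc j) * (T (Suc j) - T j)"
    "M (Suc j) * (T (Suc j) - T j) \<le> 2 * real N * (T (Suc j) - T j)"
    "M (Suc j) * (T (Suc j) - T j) \<le> 2 ^ K"
proof -
  have M: "0 \<le> M (Suc j)" "M (Suc j) \<le> 2 * real N" using M_ge[of "Suc j"] M_le[of "Suc j"] assms by auto
  show "0 \<le> M (Suc j) * (T (Suc j) - T j)" using T_step[of j] M by simp
  show 1: "M (Suc j) * (T (Suc j) - T j) \<le> 2 * real N * (T (Suc j) - T j)"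
    using T_step[of j] M by (intro mult_right_mono) auto
  have "2 * real N * (T (Suc j) - T j) \<le> (2 * real N + 2) * T (Suc j)"
    using T_step[of j] by (intro mult_mono) auto
  from order.trans[OF 1 this] show "M (Suc j) * (T (Suc j) - T j) \<le> 2 ^ K"
    using assms by (intro le_2K[of "Suc j"]) auto
qed

text \<open>A step adds at most \<open>2 N\<close> times the cell length plus 2, and cells have
  length at least 1, so \<open>(2 N + 2)\<close> times the grid point telescopes. This bound is what
  \<open>K\<close> is chosen for.\<close>

lemma GM_bounds:
  "j \<le> J \<Longrightarrow> GM j \<in> \<int> \<and> 0 \<le> GM j \<and> GM j \<le> (2 * real N + 2) * T j"
proof (induction j)
  case 0
  then show ?case using GM_0 by simp
next
  case (Suc j)
  then have IH: "0 \<le> GM j" "GM j \<le> (2 * real N + 2) * T j" and j: "j < J" by auto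
  define d1 where "d1 = h (nat \<lfloor>GE (Suc j) - GE j\<rfloor>)"
  define d2 where "d2 = h (nat \<lfloor>GE (Suc j) - E (Suc j)\<rfloor>)"
  define y where "y = M (Suc j) * (T (Suc j) - T j)"
  have y: "0 \<le> y" "y \<le> 2 * real N * (T (Suc j) - T j)"
    using term_bounds[OF j] by (auto simp: y_def)
  have d: "0 \<le> d1" "d1 \<le> 1" "0 \<le> d2" "d2 \<le> 1" unfolding d1_def d2_def h by auto
  have eq: "GM (Suc j) = of_int \<lfloor>GM j * d1\<rfloor> + of_int \<lfloor>y * d2\<rfloor> + 2"
    using GM_Suc[OF j] by (simp add: d1_def d2_def y_def)
  have "0 \<le> GM j * d1" "0 \<le> y * d2" using IH y d by auto
  then have "0 \<le> \<lfloor>GM j * d1\<rfloor>" "0 \<le> \<lfloor>y * d2\<rfloor>" by auto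
  then have "0 \<le> GM (Suc j)" unfolding eq by simp
  moreover have "GM (Suc j) \<le> (2 * real N + 2) * T (Suc j)"
  proof -
    have "GM j * d1 \<le> GM j" "y * d2 \<le> y" using IH y d by (auto intro: mult_left_le)
    then have "GM (Suc j) \<le> GM j + y + 2" unfolding eq by linarith
    also have "\<dots> \<le> (2 * real N + 2) * T j + (2 * real N + 2) * (T (Suc j) - T j)"
      using IH(2) y(2) T_step[of j] by (simp add: distrib_right)
    finally show ?thesis by (simp add: algebra_simps)
  qed
  ultimately show ?case unfolding eq by auto
qed

lemma GM_le_2K: "j \<le> J \<Longrightarrow> GM j \<le> 2 ^ K"
  using GM_bounds le_2K by blast

text \<open>The two floors lose at most one unit each and the constant 2 in the recursion repays
  them, whence the lower bound. The excess is at most two units of size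
  \<open>\<kappa> * H (Suc j)\<close>, and a cell has length at least 1: this turns \<open>N\<close>
  into \<open>N + 2\<close>.\<close>

lemma G_step:
  assumes j: "j < J"
  shows "real N * H (Suc j) * (T (Suc j) - T j) \<le> G (Suc j) - G j"
    "G (Suc j) - G j \<le> \<kappa> * (real N + 2) * H (Suc j) * (T (Suc j) - T j)"
proof -
  define r1 where "r1 = GE (Suc j) - GE j"
  define r2 where "r2 = GE (Suc j) - E (Suc j)"
  define y where "y = M (Suc j) * (T (Suc j) - T j)"
  define \<Delta> where "\<Delta> = T (Suc j) - T j"
  have \<Delta>: "\<Delta> \<ge> 1" using T_step by (simp add: \<Delta>_def)
  have y: "0 \<le> y" "y \<le> 2 ^ K"
    using term_bounds[OF j] by (auto simp: y_def)
  have r: "r1 \<in> \<int>" "r2 \<in> \<int>" "r1 \<ge> 0" "r2 \<ge> 0"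
    using GE_Ints[of j] GE_Ints[of "Suc j"] E_Ints[of "Suc j"] GE_mono[of j "Suc j"]
      GE_ge[of "Suc j" "Suc j"] j by (auto simp: r1_def r2_def)
  have g: "0 \<le> GM j" "GM j \<le> 2 ^ K" using GM_bounds[of j] GM_le_2K[of j] j by auto
  have eq: "GM (Suc j) = of_int \<lfloor>GM j * h (nat \<lfloor>r1\<rfloor>)\<rfloor> + of_int \<lfloor>y * h (nat \<lfloor>r2\<rfloor>)\<rfloor> + 2"
    using GM_Suc[OF j] by (simp add: r1_def r2_def y_def)
  let ?u = "2 powr GE (Suc j)"
  have u1: "2 powr GE j = 2 powr - r1 * ?u" "2 powr E (Suc j) = 2 powr - r2 * ?u"
    by (simp_all add: r1_def r2_def powr_add[symmetric])
  have l: "GM j * 2 powr - r1 + y * 2 powr - r2 \<le> GM (Suc j)"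
    using shift(4)[OF r(1,3) g] shift(4)[OF r(2,4) y] unfolding eq by linarith
  have "real N * H (Suc j) * \<Delta> \<le> M (Suc j) * 2 powr E (Suc j) * \<Delta>"
    using lower[of "Suc j"] j \<Delta> by (intro mult_right_mono) auto
  also have "\<dots> = y * 2 powr - r2 * ?u" by (simp add: y_def \<Delta>_def u1)
  also have "\<dots> \<le> (GM (Suc j) - GM j * 2 powr - r1) * ?u"
    using l by (intro mult_right_mono) auto
  also have "\<dots> = G (Suc j) - G j" by (simp add: u1 algebra_simps)
  finally show "real N * H (Suc j) * (T (Suc j) - T j) \<le> G (Suc j) - G j" by (simp add: \<Delta>_def)
  have "GM (Suc j) \<le> GM j * 2 powr - r1 + y * 2 powr - r2 + 2"
    using shift(2)[OF r(1,3) g] shift(2)[OF r(2,4) y] unfolding eq by linarith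
  then have "(GM (Suc j) - GM j * 2 powr - r1) * ?u \<le> (y * 2 powr - r2 + 2) * ?u"
    by (intro mult_right_mono) auto
  moreover have "(GM (Suc j) - GM j * 2 powr - r1) * ?u = G (Suc j) - G j"
    by (simp add: u1 algebra_simps)
  moreover have "(y * 2 powr - r2 + 2) * ?u = M (Suc j) * 2 powr E (Suc j) * \<Delta> + 2 * ?u"
    by (simp add: y_def \<Delta>_def u1 algebra_simps)
  moreover have "M (Suc j) * 2 powr E (Suc j) * \<Delta> \<le> \<kappa> * (real N * H (Suc j)) * \<Delta>"
    using upper[of "Suc j"] j \<Delta> by (intro mult_right_mono) auto
  moreover have "2 * ?u \<le> \<kappa> * (2 * H (Suc j)) * \<Delta>"
  proof -
    have "?u \<le> \<kappa> * H (Suc j)" using ulp_le[of "Suc j"] j by simp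
    also have "\<dots> \<le> \<kappa> * H (Suc j) * \<Delta>"
      using mult_left_mono[OF \<Delta>, of "\<kappa> * H (Suc j)"] \<kappa> H_pos[of "Suc j"] j by simp
    finally show ?thesis by simp
  qed
  ultimately have "G (Suc j) - G j \<le> \<kappa> * (real N * H (Suc j)) * \<Delta> + \<kappa> * (2 * H (Suc j)) * \<Delta>"
    by linarith
  also have "\<dots> = \<kappa> * (real N + 2) * H (Suc j) * \<Delta>" by (simp add: algebra_simps)
  finally show "G (Suc j) - G j \<le> \<kappa> * (real N + 2) * H (Suc j) * (T (Suc j) - T j)"
    by (simp add: \<Delta>_def)
qed

lemma G_diff:
  assumes "p \<le> j" "j \<le> J"
  shows "real N * (\<Sum>i\<in>{p<..j}. H i * (T i - T (i - 1))) \<le> G j - G p \<and>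
    G j - G p \<le> \<kappa> * (real N + 2) * (\<Sum>i\<in>{p<..j}. H i * (T i - T (i - 1)))"
  using assms
proof (induction j rule: dec_induct)
  case (step j)
  then have s: "(\<Sum>i\<in>{p<..Suc j}. H i * (T i - T (i - 1))) =
      H (Suc j) * (T (Suc j) - T j) + (\<Sum>i\<in>{p<..j}. H i * (T i - T (i - 1)))"
  proof -
    have "{p<..Suc j} = insert (Suc j) {p<..j}" using step by auto
    then show ?thesis by simp
  qed
  show ?case using step G_step[of j] unfolding s distrib_left
    by (simp add: mult.assoc)
qed simp

text \<open>
  The cancellation in a difference of prefix sums is tolerable: one unit in the last place of the
  minuend is at most \<open>\<kappa> * H j\<close>, and the window contains the unit interval below grid point \<open>j\<close>.
\<close>

lemma window:
  assumes p: "p < j" "j \<le> J" "T p \<le> U" "U \<le> T (Suc p)" "U \<le> T j - 1"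
  defines "w \<equiv> H (Suc p) * (T (Suc p) - U) + (\<Sum>i\<in>{Suc p<..j}. H i * (T i - T (i - 1)))"
    and "D \<equiv> GM j - (GM p * h (nat \<lfloor>GE j - GE p\<rfloor>) * (T (Suc p) - U) +
      GM (Suc p) * h (nat \<lfloor>GE j - GE (Suc p)\<rfloor>) * (U - T p)) / (T (Suc p) - T p)"
  shows "real N * w \<le> D * 2 powr GE j" "D * 2 powr GE j \<le> \<kappa> * (real N + 3) * w"
    "D \<le> GM j" "real N \<le> \<kappa> * D"
proof -
  define r1 where "r1 = GE j - GE p"
  define r2 where "r2 = GE j - GE (Suc p)"
  define \<Delta> where "\<Delta> = T (Suc p) - T p"
  define S where "S = (\<Sum>i\<in>{Suc p<..j}. H i * (T i - T (i - 1)))"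
  \<comment> \<open>The position of \<open>U\<close> in its cell. A partial cell of a step function
    corresponds to linear interpolation between the prefix sums at its ends.\<close>
  define \<theta> where "\<theta> = (U - T p) / \<Delta>"
  let ?u = "2 powr GE j"
  have \<Delta>: "\<Delta> \<ge> 1" using T_step by (simp add: \<Delta>_def)
  have \<theta>: "0 \<le> \<theta>" "\<theta> \<le> 1" "(T (Suc p) - U) / \<Delta> = 1 - \<theta>"
    using p \<Delta> by (auto simp: \<theta>_def \<Delta>_def field_simps)
  have r: "r1 \<in> \<int>" "r2 \<in> \<int>" "r1 \<ge> 0" "r2 \<ge> 0"
    using GE_Ints[of j] GE_Ints[of p] GE_Ints[of "Suc p"] GE_mono[of p j] GE_mono[of "Suc p" j]
      p by (auto simp: r1_def r2_def)
  have u: "2 powr GE p = 2 powr - r1 * ?u" "2 powr GE (Suc p) = 2 powr - r2 * ?u"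
    by (simp_all add: r1_def r2_def powr_add[symmetric])
  have g1: "0 \<le> GM p" "GM p \<le> 2 ^ K" using GM_bounds[of p] GM_le_2K[of p] p by auto
  have g2: "0 \<le> GM (Suc p)" "GM (Suc p) \<le> 2 ^ K"
    using GM_bounds[of "Suc p"] GM_le_2K[of "Suc p"] p by auto
  define a where "a = GM p * h (nat \<lfloor>r1\<rfloor>)"
  define b where "b = GM (Suc p) * h (nat \<lfloor>r2\<rfloor>)"
  have a: "0 \<le> a" "a \<le> GM p * 2 powr - r1" "GM p * 2 powr - r1 \<le> a + 1"
    using shift[OF r(1,3) g1] g1 by (auto simp: a_def)
  have b: "0 \<le> b" "b \<le> GM (Suc p) * 2 powr - r2" "GM (Suc p) * 2 powr - r2 \<le> b + 1"
    using shift[OF r(2,4) g2] g2 by (auto simp: b_def)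
  have D: "D = GM j - (a * (1 - \<theta>) + b * \<theta>)"
  proof -
    have "(a * (T (Suc p) - U) + b * (U - T p)) / \<Delta> = a * ((T (Suc p) - U) / \<Delta>) + b * \<theta>"
      by (simp add: \<theta>_def add_divide_distrib)
    then show ?thesis unfolding \<theta>(3) by (simp add: D_def a_def b_def r1_def r2_def \<Delta>_def)
  qed
  \<comment> \<open>The window difference with exact shifts; \<open>D\<close> deviates from it only
    through the truncated table \<open>h\<close>.\<close>
  define X where "X = G j - (G p * (1 - \<theta>) + G (Suc p) * \<theta>)"
  have X: "X = (GM j - (GM p * 2 powr - r1 * (1 - \<theta>) + GM (Suc p) * 2 powr - r2 * \<theta>)) * ?u"
    by (simp add: X_def u algebra_simps)
  have "a * (1 - \<theta>) + b * \<theta> \<le> GM p * 2 powr - r1 * (1 - \<theta>) + GM (Suc p) * 2 powr - r2 * \<theta>"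
    using a b \<theta> by (intro add_mono mult_right_mono) auto
  then have X1: "X \<le> D * ?u" unfolding X D by (intro mult_right_mono) auto
  \<comment> \<open>Each shift loses at most 1 and the interpolation weights add up to 1, so
    \<open>D\<close> exceeds the exact difference by at most one unit. With the two units of
    \<open>G_step\<close> this makes \<open>N + 3\<close>.\<close>
  have "GM p * 2 powr - r1 * (1 - \<theta>) + GM (Suc p) * 2 powr - r2 * \<theta> \<le> (a + 1) * (1 - \<theta>) + (b + 1) * \<theta>"
    using a b \<theta> by (intro add_mono mult_right_mono) auto
  then have "D \<le> GM j - (GM p * 2 powr - r1 * (1 - \<theta>) + GM (Suc p) * 2 powr - r2 * \<theta>) + 1"
    unfolding D by (simp add: algebra_simps)
  then have "D * ?u \<le> (GM j - (GM p * 2 powr - r1 * (1 - \<theta>) + GM (Suc p) * 2 powr - r2 * \<theta>) + 1) * ?u"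
    by (intro mult_right_mono) auto
  then have X2: "D * ?u \<le> X + ?u" unfolding X by (simp add: algebra_simps)
  have X_eq: "X = (G (Suc p) - G p) * (1 - \<theta>) + (G j - G (Suc p))"
    by (simp add: X_def algebra_simps)
  have w: "w = H (Suc p) * \<Delta> * (1 - \<theta>) + S"
  proof -
    have "T (Suc p) - U = \<Delta> * (1 - \<theta>)" using \<theta>(3) \<Delta> by (simp add: field_simps)
    then show ?thesis by (simp add: w_def S_def mult.assoc)
  qed
  have st: "real N * H (Suc p) * \<Delta> \<le> G (Suc p) - G p"
      "G (Suc p) - G p \<le> \<kappa> * (real N + 2) * H (Suc p) * \<Delta>"
    using G_step[of p] p by (auto simp: \<Delta>_def)
  have df: "real N * S \<le> G j - G (Suc p)" "G j - G (Suc p) \<le> \<kappa> * (real N + 2) * S"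
    using G_diff[of "Suc p" j] p by (auto simp: S_def)
  have "real N * w = real N * H (Suc p) * \<Delta> * (1 - \<theta>) + real N * S"
    unfolding w by (simp add: algebra_simps)
  also have "\<dots> \<le> X" unfolding X_eq using st(1) df(1) \<theta> by (intro add_mono mult_right_mono) auto
  finally show 1: "real N * w \<le> D * ?u" using X1 by linarith
  have "X \<le> \<kappa> * (real N + 2) * H (Suc p) * \<Delta> * (1 - \<theta>) + \<kappa> * (real N + 2) * S"
    unfolding X_eq using st(2) df(2) \<theta> by (intro add_mono mult_right_mono) auto
  also have "\<dots> = \<kappa> * (real N + 2) * w" unfolding w by (simp add: algebra_simps)
  finally have X3: "X \<le> \<kappa> * (real N + 2) * w" .
  have terms: "0 \<le> H i * (T i - T (i - 1))" if "i \<in> {Suc p<..j}" for i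
    using H_pos[of i] that p T_mono[of "i - 1" i] by (intro mult_nonneg_nonneg) auto
  have Hw: "H j \<le> w"
  proof (cases "j = Suc p")
    case True
    then have "H j * 1 \<le> H j * (T (Suc p) - U)"
      using p H_pos[of j] by (intro mult_left_mono) auto
    then show ?thesis using True by (simp add: w_def)
  next
    case False
    then have jp: "j \<in> {Suc p<..j}" using p by auto
    have "H j * 1 \<le> H j * (T j - T (j - 1))"
      using T_step[of "j - 1"] p H_pos[of j] by (intro mult_left_mono) auto
    also have "\<dots> \<le> S" unfolding S_def
      using terms by (intro member_le_sum[OF jp]) auto
    also have "\<dots> \<le> w" unfolding w_def S_def using H_pos[of "Suc p"] p by simp
    finally show ?thesis by simp
  qed
  have uj: "?u \<le> \<kappa> * H j" using ulp_le[of j] p by simp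
  also have "\<dots> \<le> \<kappa> * w" using Hw \<kappa> by (intro mult_left_mono) auto
  finally have "X + ?u \<le> \<kappa> * (real N + 3) * w" using X3 by (simp add: algebra_simps)
  with X2 show "D * ?u \<le> \<kappa> * (real N + 3) * w" by linarith
  have "0 \<le> a * (1 - \<theta>)" "0 \<le> b * \<theta>" using a b \<theta> by auto
  then show "D \<le> GM j" unfolding D by linarith
  \<comment> \<open>Cancelling \<open>H j\<close> shows that the difference keeps a mantissa of at
    least \<open>N / \<kappa>\<close>, which later limits the number of doublings.\<close>
  have "real N * H j \<le> real N * w" using Hw by (intro mult_left_mono) auto
  with 1 have "real N * H j \<le> D * ?u" by linarith
  also have "\<dots> \<le> D * (\<kappa> * H j)"
  proof (rule mult_left_mono[OF uj])
    have "0 \<le> real N * w" using Hw H_pos[of j] p by auto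
    with 1 have "0 \<le> D * ?u" by linarith
    then show "0 \<le> D" by (simp add: zero_le_mult_iff)
  qed
  finally have "real N * H j \<le> (\<kappa> * D) * H j" by (simp add: mult_ac)
  then show "real N \<le> \<kappa> * D" using H_pos[of j] p by simp
qed

end

text \<open>Three factors \<open>1 + 1/N\<close> pay for \<open>(N + 3) / N\<close> by Bernoulli,
  the fourth for raising a mantissa of at least \<open>N\<close> by at most 1. Strictness of
  \<open>x < 2 N\<close> keeps the rounded mantissa within \<open>2 N\<close>.\<close>

lemma round_up_mantissa:
  fixes x e w D A \<kappa> :: real
  assumes x: "real N \<le> x" "x < 2 * real N" and N: "N > 0" and A: "A > 0" and \<kappa>: "\<kappa> \<ge> 1" and w: "w \<ge> 0"
    and D: "real N * (A * w) \<le> D * 2 powr g" "D * 2 powr g \<le> \<kappa> * (real N + 3) * (A * w)"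
    and e: "x * 2 powr e = D / A * 2 powr g"
  shows "real N \<le> of_int \<lfloor>x\<rfloor> + 1" "of_int \<lfloor>x\<rfloor> + 1 \<le> 2 * real N"
    "real N * w \<le> (of_int \<lfloor>x\<rfloor> + 1) * 2 powr e"
    "(of_int \<lfloor>x\<rfloor> + 1) * 2 powr e \<le> (\<kappa> * (1 + 1 / real N) ^ 4) * (real N * w)"
proof -
  let ?l = "1 + 1 / real N"
  show "real N \<le> of_int \<lfloor>x\<rfloor> + 1" using x by linarith
  have "\<lfloor>x\<rfloor> < 2 * int N" using x(2) by (simp add: floor_less_iff)
  then have "of_int (\<lfloor>x\<rfloor> + 1) \<le> (of_int (2 * int N) :: real)" unfolding of_int_le_iff by simp
  then show "of_int \<lfloor>x\<rfloor> + 1 \<le> 2 * real N" by simp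
  have "A * (real N * w) \<le> A * (x * 2 powr e)" using D(1) A e by (simp add: mult_ac)
  then have "real N * w \<le> x * 2 powr e" using A by simp
  also have "\<dots> \<le> (of_int \<lfloor>x\<rfloor> + 1) * 2 powr e" by (intro mult_right_mono, linarith, simp)
  finally show "real N * w \<le> (of_int \<lfloor>x\<rfloor> + 1) * 2 powr e" .
  have "A * (x * 2 powr e) \<le> A * (\<kappa> * (real N + 3) * w)" using D(2) A e by (simp add: mult_ac)
  then have u: "x * 2 powr e \<le> \<kappa> * (real N + 3) * w" using A by simp
  have "(of_int \<lfloor>x\<rfloor> + 1) \<le> x * ?l"
  proof -
    have "1 \<le> x / real N" using x N by simp
    with of_int_floor_le[of x] have "of_int \<lfloor>x\<rfloor> + 1 \<le> x + x / real N" by linarith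
    then show ?thesis by (simp add: algebra_simps)
  qed
  then have "(of_int \<lfloor>x\<rfloor> + 1) * 2 powr e \<le> x * ?l * 2 powr e"
    by (intro mult_right_mono) auto
  also have "\<dots> = (x * 2 powr e) * ?l" by simp
  also have "\<dots> \<le> \<kappa> * (real N + 3) * w * ?l"
    by (intro mult_right_mono u) auto
  also have "\<dots> = \<kappa> * (real N * w) * ((1 + 3 * (1 / real N)) * ?l)"
    using N by (simp add: field_simps)
  also have "\<dots> \<le> \<kappa> * (real N * w) * (?l ^ 3 * ?l)"
  proof (intro mult_left_mono mult_right_mono)
    show "1 + 3 * (1 / real N) \<le> ?l ^ 3"
      using Bernoulli_inequality[of "1 / real N" 3] by (simp add: order.trans[of "-1" 0])
  qed (use \<kappa> w in auto)
  also have "\<dots> = (\<kappa> * ?l ^ 4) * (real N * w)"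
    by (simp add: eval_nat_numeral mult_ac)
  finally show "(of_int \<lfloor>x\<rfloor> + 1) * 2 powr e \<le> (\<kappa> * ?l ^ 4) * (real N * w)" .
qed

section \<open>Bit lengths and weakest preconditions\<close>

text \<open>Representations need not be in lowest terms, so sums and products can be bounded without
  computing a gcd.\<close>

definition fractions :: "real \<Rightarrow> real set" where
  "fractions X = {of_int p / of_int q | p q :: int. 0 < q \<and> of_int q \<le> X \<and> of_int \<bar>p\<bar> \<le> X}"

lemma fractionsI:
  "v = of_int p / of_int q \<Longrightarrow> 0 < q \<Longrightarrow> of_int q \<le> X \<Longrightarrow> of_int \<bar>p\<bar> \<le> X \<Longrightarrow> v \<in> fractions X"
  unfolding fractions_def by blast

lemma fractions_Ints:
  assumes "v \<in> \<int>" "\<bar>v\<bar> \<le> X" "1 \<le> X" shows "v \<in> fractions X"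
  using assms by (elim Ints_cases) (auto intro!: fractionsI[of _ _ 1])

lemma fractions_mono: "X \<le> Y \<Longrightarrow> fractions X \<subseteq> fractions Y"
  unfolding fractions_def by force

text \<open>\<open>enc_len\<close> measures the reduced fraction, whose denominator divides
  \<open>q\<close> and whose numerator is no larger than \<open>p\<close>: reduction only
  shortens.\<close>

lemma enc_len_le:
  fixes p q :: int
  assumes q: "0 < q" "of_int q \<le> X" and p: "of_int \<bar>p\<bar> \<le> X"
  shows "real (enc_len (of_int p / of_int q)) \<le> 2 * (log 2 (X + 1) + 1)"
proof -
  obtain p' q' where pq: "quotient_of (of_int p / of_int q) = (p', q')" by fastforce
  have q': "q' > 0" using quotient_of_denom_pos[OF pq] .
  have "(of_int p / of_int q :: rat) = of_int p' / of_int q'" using quotient_of_div[OF pq] .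
  then have "(of_int (p * q') :: rat) = of_int (p' * q)" using q q' by (simp add: field_simps)
  then have eq: "p * q' = p' * q" by (simp only: of_int_eq_iff)
  have co: "coprime p' q'" using quotient_of_coprime[OF pq] .
  have "q' dvd q" using eq co by (metis coprime_commute coprime_dvd_mult_right_iff dvd_triv_right)
  then have q'q: "q' \<le> q" using q by (simp add: zdvd_imp_le)
  have "\<bar>p'\<bar> * q = \<bar>p\<bar> * q'" using arg_cong[OF eq, of abs] q q' by (simp add: abs_mult)
  also have "\<dots> \<le> \<bar>p\<bar> * q" using q'q by (intro mult_left_mono) auto
  finally have p'p: "\<bar>p'\<bar> \<le> \<bar>p\<bar>" using q by simp
  have l: "real (nat \<lceil>log 2 (of_int z + 1)\<rceil>) \<le> log 2 (X + 1) + 1"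
    if "0 \<le> z" "real_of_int z \<le> X" for z :: int
  proof -
    have "0 \<le> log 2 (real_of_int z + 1)" using that by simp
    then have "real (nat \<lceil>log 2 (of_int z + 1)\<rceil>) = of_int \<lceil>log 2 (real_of_int z + 1)\<rceil>" by simp
    also have "\<dots> \<le> log 2 (real_of_int z + 1) + 1" by linarith
    also have "log 2 (real_of_int z + 1) \<le> log 2 (X + 1)" using that by simp
    finally show ?thesis by simp
  qed
  have "real_of_int q' \<le> X" "real_of_int \<bar>p'\<bar> \<le> X"
    using q'q p'p p q by (meson of_int_le_iff order.trans)+
  with l[of "\<bar>p'\<bar>"] l[of q'] q' show ?thesis
    unfolding enc_len_def pq by simp
qed

lemma is_bit_number_fractions:
  assumes "v \<in> fractions X" "2 * (log 2 (X + 1) + 1) \<le> k"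
  shows "is_bit_number k v"
proof -
  obtain p q :: int where pq: "v = of_int p / of_int q" "0 < q" "of_int q \<le> X" "of_int \<bar>p\<bar> \<le> X"
    using assms(1) unfolding fractions_def by blast
  have "v = of_rat (of_int p / of_int q)" by (simp add: pq(1) of_rat_divide)
  moreover have "real (enc_len (of_int p / of_int q)) \<le> k"
    using enc_len_le[OF pq(2-4)] assms(2) by linarith
  ultimately show ?thesis unfolding is_bit_number_def by blast
qed

text \<open>Numerators and denominators multiply, so exponents add. The extra 1 absorbs the factor 2
  of a sum over a common denominator, as \<open>2 \<le> Z\<close>.\<close>

lemma fractions_arith:
  assumes u: "u \<in> fractions (Z ^ i)" and v: "v \<in> fractions (Z ^ j)" and Z: "2 \<le> Z"
  shows "arith_val f u v \<in> fractions (Z ^ (i + j + 1))"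
proof -
  obtain p q where u: "u = of_int p / of_int q" "0 < q" "of_int q \<le> Z ^ i" "of_int \<bar>p\<bar> \<le> Z ^ i"
    using u unfolding fractions_def by blast
  obtain r s where v: "v = of_int r / of_int s" "0 < s" "of_int s \<le> Z ^ j" "of_int \<bar>r\<bar> \<le> Z ^ j"
    using v unfolding fractions_def by blast
  have m: "of_int (x * y) \<le> Z ^ (i + j)"
    if "of_int x \<le> Z ^ i" "of_int y \<le> Z ^ j" "0 \<le> x" "0 \<le> y" for x y
    using mult_mono[OF that(1,2)] that(3,4) Z by (simp add: power_add)
  have pos: "0 < Z ^ (i + j)" using Z by simp
  have le: "Z ^ (i + j) \<le> Z ^ (i + j + 1)" "2 * Z ^ (i + j) \<le> Z ^ (i + j + 1)"
    using Z pos by (simp_all add: mult_right_mono power_increasing)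
  have qs: "of_int (q * s) \<le> Z ^ (i + j)" using m[of q s] u v by simp
  have ps: "of_int \<bar>p * s\<bar> \<le> Z ^ (i + j)" using m[of "\<bar>p\<bar>" s] u v by (simp add: abs_mult)
  have rq: "of_int \<bar>r * q\<bar> \<le> Z ^ (i + j)" using m[of q "\<bar>r\<bar>"] u v by (simp add: abs_mult mult.commute)
  have pr: "of_int \<bar>p * r\<bar> \<le> Z ^ (i + j)" using m[of "\<bar>p\<bar>" "\<bar>r\<bar>"] u v by (simp add: abs_mult)
  show ?thesis
  proof (cases f)
    case Plus
    have "u + v = of_int (p * s + r * q) / of_int (q * s)"
      unfolding u(1) v(1) using u(2) v(2) by (simp add: field_simps)
    moreover have "real_of_int \<bar>p * s + r * q\<bar> \<le> of_int \<bar>p * s\<bar> + of_int \<bar>r * q\<bar>" by simp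
    then have "real_of_int \<bar>p * s + r * q\<bar> \<le> Z ^ (i + j + 1)" using ps rq le by linarith
    moreover have "of_int (q * s) \<le> Z ^ (i + j + 1)" using qs le by linarith
    ultimately show ?thesis using u(2) v(2) Plus
      by (intro fractionsI[of _ "p * s + r * q" "q * s"]) simp_all
  next
    case Minus
    have "u - v = of_int (p * s - r * q) / of_int (q * s)"
      unfolding u(1) v(1) using u(2) v(2) by (simp add: field_simps)
    moreover have "real_of_int \<bar>p * s - r * q\<bar> \<le> of_int \<bar>p * s\<bar> + of_int \<bar>r * q\<bar>" by simp
    then have "real_of_int \<bar>p * s - r * q\<bar> \<le> Z ^ (i + j + 1)" using ps rq le by linarith
    moreover have "of_int (q * s) \<le> Z ^ (i + j + 1)" using qs le by linarith
    ultimately show ?thesis using u(2) v(2) Minus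
      by (intro fractionsI[of _ "p * s - r * q" "q * s"]) simp_all
  next
    case Times
    then show ?thesis using qs pr le u v
      by (intro fractionsI[of _ "p * r" "q * s"]) simp_all
  next
    case Divide
    show ?thesis
    \<comment> \<open>Division by zero yields 0 in HOL, so this case also needs a
      representation.\<close>
    proof (cases "r = 0")
      case True
      then show ?thesis using Divide v le Z
        by (intro fractionsI[of _ 0 1]) (simp_all add: one_le_power[of Z "Suc (i + j)", simplified])
    next
      case False
      have "real_of_int \<bar>q * r\<bar> \<le> Z ^ (i + j + 1)" "real_of_int \<bar>p * s\<bar> \<le> Z ^ (i + j + 1)"
        using rq ps le by (simp_all add: mult.commute)
      moreover have "u / v = of_int (p * s * sgn r) / of_int (\<bar>q * r\<bar>)"
      proof (cases "r > 0")
        case True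
        then show ?thesis unfolding u(1) v(1) using u(2) v(2) by (simp add: abs_mult field_simps)
      next
        case neg: False
        then have "r < 0" using False by simp
        then show ?thesis unfolding u(1) v(1) using u(2) v(2) by (simp add: abs_mult field_simps)
      qed
      moreover have "\<bar>p * s * sgn r\<bar> = \<bar>p * s\<bar>" using False by (simp add: abs_mult)
      ultimately show ?thesis using Divide False u
        by (intro fractionsI[of _ "p * s * sgn r" "\<bar>q * r\<bar>"]) simp_all
    qed
  qed
qed

lemma fractions_floor:
  assumes u: "u \<in> fractions (Z ^ i)" and Z: "2 \<le> Z"
  shows "of_int \<lfloor>u\<rfloor> \<in> fractions (Z ^ (i + 1))"
proof -
  obtain p q where u: "u = of_int p / of_int q" "0 < q" "of_int q \<le> Z ^ i" "of_int \<bar>p\<bar> \<le> Z ^ i"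
    using u unfolding fractions_def by blast
  have "\<bar>u\<bar> \<le> of_int \<bar>p\<bar>"
    unfolding u(1) abs_divide using u(2) by (simp add: divide_le_eq mult_le_cancel_left1)
  then have "\<bar>u\<bar> \<le> Z ^ i" using u by linarith
  moreover have "1 \<le> Z ^ i" using Z by (intro one_le_power) auto
  moreover have "2 * Z ^ i \<le> Z ^ (i + 1)" using Z by (simp add: mult_right_mono)
  ultimately have "\<bar>of_int \<lfloor>u\<rfloor>\<bar> \<le> Z ^ (i + 1)" "1 \<le> Z ^ (i + 1)" by linarith+
  then show ?thesis by (intro fractions_Ints) auto
qed

text \<open>16 is the largest constant of the program. The input accuracy has no bounded
  representation and must not enter a computed expression.\<close>

fun admissible :: "aexp \<Rightarrow> bool" where
  "admissible (Num k) \<longleftrightarrow> \<bar>k\<bar> \<le> 16"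
| "admissible (Read x i) \<longleftrightarrow> x \<noteq> ''eps'' \<and> admissible i"
| "admissible (Arith f e1 e2) \<longleftrightarrow> admissible e1 \<and> admissible e2"
| "admissible (Floor e) \<longleftrightarrow> admissible e"

text \<open>The exponent of \<open>Z\<close> that bounds the value and all intermediate results,
  following \<open>fractions_arith\<close> and \<open>fractions_floor\<close>. A read resets the
  value to a memory cell, so only its index counts.\<close>

fun weight :: "aexp \<Rightarrow> nat" where
  "weight (Num k) = 1"
| "weight (Read x i) = weight i"
| "weight (Arith f e1 e2) = weight e1 + weight e2 + 1"
| "weight (Floor e) = weight e + 1"

text \<open>The accuracy may appear as the right side of a comparison, where it contributes only its
  index 0 to \<open>bnums\<close>.\<close>

fun admissible_test :: "bexp \<Rightarrow> bool" where
  "admissible_test (Leq e1 e2) \<longleftrightarrow> admissible e1 \<and> weight e1 \<le> 64 \<and>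
     (e2 = Read ''eps'' (Num 0) \<or> admissible e2 \<and> weight e2 \<le> 64)"
| "admissible_test (Not t) \<longleftrightarrow> admissible_test t"
| "admissible_test (And t1 t2) \<longleftrightarrow> admissible_test t1 \<and> admissible_test t2"

definition bounded_memory :: "real \<Rightarrow> state \<Rightarrow> bool" where
  "bounded_memory Z s \<longleftrightarrow> (\<forall>x i. x \<noteq> ''eps'' \<longrightarrow> s x i \<in> fractions Z)"

lemma weight_pos: "1 \<le> weight e"
  by (induction e) auto

lemma anums_bounded:
  assumes "bounded_memory Z s" "admissible e" "16 \<le> Z"
  shows "insert (aval e s) (anums e s) \<subseteq> fractions (Z ^ weight e)"
  using assms(2)
proof (induction e)
  case (Num k)
  then have "of_int k \<in> fractions Z"
    using assms(3) by (intro fractions_Ints) (auto simp: abs_le_iff)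
  then show ?case by simp
next
  case (Read x i)
  have "Z \<le> Z ^ weight i" using weight_pos[of i] assms(3) by (intro self_le_power) auto
  then have "s x (nat \<lfloor>aval i s\<rfloor>) \<in> fractions (Z ^ weight i)"
    using assms(1) Read.prems fractions_mono unfolding bounded_memory_def by fastforce
  then show ?case using Read by simp
next
  case (Arith f e1 e2)
  have "arith_val f (aval e1 s) (aval e2 s) \<in> fractions (Z ^ (weight e1 + weight e2 + 1))"
    using Arith assms(3) by (intro fractions_arith) auto
  moreover have "fractions (Z ^ weight e1) \<subseteq> fractions (Z ^ (weight e1 + weight e2 + 1))"
    "fractions (Z ^ weight e2) \<subseteq> fractions (Z ^ (weight e1 + weight e2 + 1))"
    using assms(3) by (intro fractions_mono power_increasing; simp)+
  ultimately show ?case using Arith by auto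
next
  case (Floor e)
  have "of_int \<lfloor>aval e s\<rfloor> \<in> fractions (Z ^ (weight e + 1))"
    using Floor assms(3) by (intro fractions_floor) auto
  moreover have "fractions (Z ^ weight e) \<subseteq> fractions (Z ^ (weight e + 1))"
    using assms(3) by (intro fractions_mono power_increasing; simp)
  ultimately show ?case using Floor by auto
qed

lemma anums_bounded_64:
  assumes "bounded_memory Z s" "admissible e" "16 \<le> Z" "weight e \<le> 64"
  shows "anums e s \<subseteq> fractions (Z ^ 64)"
proof -
  have "fractions (Z ^ weight e) \<subseteq> fractions (Z ^ 64)"
    using assms by (intro fractions_mono power_increasing) auto
  then show ?thesis using anums_bounded[OF assms(1-3)] by blast
qed

lemma bnums_bounded:
  assumes "bounded_memory Z s" "16 \<le> Z"
  shows "admissible_test t \<Longrightarrow> bnums t s \<subseteq> fractions (Z ^ 64)"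
proof (induction t)
  case (Leq e1 e2)
  have "0 \<in> fractions (Z ^ 64)"
    using assms(2) by (intro fractions_Ints) (auto intro!: one_le_power)
  then show ?case using Leq anums_bounded_64[OF assms(1) _ assms(2)] by auto
qed auto

section \<open>Total correctness with bounds on time and on all computed numbers\<close>

fun stores :: "com \<Rightarrow> string set" where
  "stores Skip = {}"
| "stores (Store x i e) = {x}"
| "stores (Seq c1 c2) = stores c1 \<union> stores c2"
| "stores (If t c1 c2) = stores c1 \<union> stores c2"
| "stores (While t c) = stores c"

lemma exec_frame: "exec c s T W s' \<Longrightarrow> x \<notin> stores c \<Longrightarrow> s' x = s x"
  by (induction rule: exec.induct) auto

text \<open>
  Keeping every memory cell a fraction with numerator and denominator at most \<open>Z\<close> bounds all
  intermediate results of expressions of weight at most 64 by \<open>Z ^ 64\<close>.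
\<close>

definition wp :: "real \<Rightarrow> nat \<Rightarrow> com \<Rightarrow> (state \<Rightarrow> bool) \<Rightarrow> state \<Rightarrow> bool" where
  "wp Z t c Q s \<longleftrightarrow> (bounded_memory Z s \<longrightarrow>
     (\<exists>T W s'. exec c s T W s' \<and> T \<le> t \<and> W \<subseteq> fractions (Z ^ 64) \<and> bounded_memory Z s' \<and> Q s'))"

lemma wp_mono:
  assumes "wp Z t c Q s" "t \<le> t'" "\<And>s'. (\<And>x. x \<notin> stores c \<Longrightarrow> s' x = s x) \<Longrightarrow> Q s' \<Longrightarrow> Q' s'"
  shows "wp Z t' c Q' s"
  unfolding wp_def
proof
  assume "bounded_memory Z s"
  then obtain T W s' where *: "exec c s T W s'" "T \<le> t" "W \<subseteq> fractions (Z ^ 64)"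
      "bounded_memory Z s'" "Q s'"
    using assms(1) unfolding wp_def by blast
  moreover have "T \<le> t'" using *(2) assms(2) by linarith
  moreover have "Q' s'" using assms(3) exec_frame[OF *(1)] *(5) by blast
  ultimately show "\<exists>T W s'. exec c s T W s' \<and> T \<le> t' \<and> W \<subseteq> fractions (Z ^ 64) \<and>
      bounded_memory Z s' \<and> Q' s'" by blast
qed

lemma wp_time: "wp Z t c Q s \<Longrightarrow> t \<le> t' \<Longrightarrow> wp Z t' c Q s"
  by (rule wp_mono)

lemma wp_Skip: "Q s \<Longrightarrow> wp Z 0 Skip Q s"
  unfolding wp_def using exec_Skip by fastforce

lemma wp_Store:
  assumes "16 \<le> Z" "admissible i" "weight i \<le> 64" "admissible e" "weight e \<le> 64"
    and "aval e s \<in> fractions Z"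
    and "Q (s(x := (s x)(nat \<lfloor>aval i s\<rfloor> := aval e s)))"
  shows "wp Z (Suc (aops i + aops e)) (Store x i e) Q s"
  unfolding wp_def
proof
  assume b: "bounded_memory Z s"
  let ?s = "s(x := (s x)(nat \<lfloor>aval i s\<rfloor> := aval e s))"
  have "bounded_memory Z ?s" using b assms(6) by (simp add: bounded_memory_def)
  moreover have "anums i s \<union> anums e s \<subseteq> fractions (Z ^ 64)"
    using anums_bounded_64[OF b _ assms(1)] assms by simp
  ultimately show "\<exists>T W s'. exec (Store x i e) s T W s' \<and> T \<le> Suc (aops i + aops e) \<and>
      W \<subseteq> fractions (Z ^ 64) \<and> bounded_memory Z s' \<and> Q s'"
    using exec_Store[of x i e s] assms(7) by blast
qed

lemma wp_Seq:
  assumes "wp Z t1 c1 (wp Z t2 c2 Q) s"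
  shows "wp Z (t1 + t2) (Seq c1 c2) Q s"
  unfolding wp_def
proof
  assume "bounded_memory Z s"
  then obtain T1 W1 s1 where 1: "exec c1 s T1 W1 s1" "T1 \<le> t1" "W1 \<subseteq> fractions (Z ^ 64)"
      "bounded_memory Z s1" "wp Z t2 c2 Q s1"
    using assms unfolding wp_def[of Z t1] by blast
  then obtain T2 W2 s2 where 2: "exec c2 s1 T2 W2 s2" "T2 \<le> t2" "W2 \<subseteq> fractions (Z ^ 64)"
      "bounded_memory Z s2" "Q s2"
    unfolding wp_def by blast
  have "exec (Seq c1 c2) s (T1 + T2) (W1 \<union> W2) s2" using 1(1) 2(1) by (rule exec_Seq)
  with 1 2 show "\<exists>T W s'. exec (Seq c1 c2) s T W s' \<and> T \<le> t1 + t2 \<and>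
      W \<subseteq> fractions (Z ^ 64) \<and> bounded_memory Z s' \<and> Q s'"
    by (meson Un_least add_mono)
qed

lemma wp_If:
  assumes "16 \<le> Z" "admissible_test t"
    and "bval t s \<Longrightarrow> wp Z t1 c1 Q s" "\<not> bval t s \<Longrightarrow> wp Z t2 c2 Q s"
  shows "wp Z (Suc (bops t + (t1 + t2))) (If t c1 c2) Q s"
  unfolding wp_def
proof
  assume b: "bounded_memory Z s"
  note n = bnums_bounded[OF b assms(1,2)]
  show "\<exists>T W s'. exec (If t c1 c2) s T W s' \<and> T \<le> Suc (bops t + (t1 + t2)) \<and>
      W \<subseteq> fractions (Z ^ 64) \<and> bounded_memory Z s' \<and> Q s'"
  proof (cases "bval t s")
    case True
    then obtain T W s' where 1: "exec c1 s T W s'" "T \<le> t1" "W \<subseteq> fractions (Z ^ 64)"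
      "bounded_memory Z s'" "Q s'" using assms(3) b unfolding wp_def by blast
    have "Suc (bops t + T) \<le> Suc (bops t + (t1 + t2))" using 1(2) by simp
    with exec_If_True[OF True 1(1), of c2] 1 n show ?thesis by (meson Un_least)
  next
    case False
    then obtain T W s' where 1: "exec c2 s T W s'" "T \<le> t2" "W \<subseteq> fractions (Z ^ 64)"
      "bounded_memory Z s'" "Q s'" using assms(4) b unfolding wp_def by blast
    have "Suc (bops t + T) \<le> Suc (bops t + (t1 + t2))" using 1(2) by simp
    with exec_If_False[OF False 1(1), of c1] 1 n show ?thesis by (meson Un_least)
  qed
qed

text \<open>The ghost index of the invariant lets a measure on pairs drive the two-pointer loop of
  \<open>windows\<close>. Agreement with \<open>s0\<close> on arrays that the body does not store is
  supplied here, so invariants speak only of what changes.\<close>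

lemma wp_While:
  fixes \<mu> :: "'i \<Rightarrow> nat"
  assumes "16 \<le> Z" "admissible_test t" and "I start s0" "\<mu> start \<le> m"
    and step: "\<And>i s. I i s \<Longrightarrow> (\<And>x. x \<notin> stores c \<Longrightarrow> s x = s0 x) \<Longrightarrow> bval t s \<Longrightarrow>
      wp Z tc c (\<lambda>s'. \<exists>i'. I i' s' \<and> \<mu> i' < \<mu> i) s"
    and exit: "\<And>i s. I i s \<Longrightarrow> (\<And>x. x \<notin> stores c \<Longrightarrow> s x = s0 x) \<Longrightarrow> \<not> bval t s \<Longrightarrow> Q s"
  shows "wp Z (Suc (bops t) + m * (Suc (bops t) + tc)) (While t c) Q s0"
proof -
  have "\<exists>T W s'. exec (While t c) s T W s' \<and> T \<le> Suc (bops t) + m * (Suc (bops t) + tc) \<and>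
      W \<subseteq> fractions (Z ^ 64) \<and> bounded_memory Z s' \<and> Q s'"
    if "I i s" "\<And>x. x \<notin> stores c \<Longrightarrow> s x = s0 x" "bounded_memory Z s" "\<mu> i \<le> m" for i s
    using that
  proof (induction m arbitrary: i s rule: less_induct)
    case (less m)
    note n = bnums_bounded[OF less.prems(3) assms(1,2)]
    show ?case
    proof (cases "bval t s")
      case True
      from step[OF less.prems(1,2) True] less.prems(3)
      obtain T W s' i' where 1: "exec c s T W s'" "T \<le> tc" "W \<subseteq> fractions (Z ^ 64)"
        "bounded_memory Z s'" "I i' s'" "\<mu> i' < \<mu> i" unfolding wp_def by blast
      have fr: "s' x = s0 x" if "x \<notin> stores c" for x
        using exec_frame[OF 1(1) that] less.prems(2)[OF that] by simp
      have "\<mu> i' < m" using 1(6) less.prems(4) by simp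
      from less.IH[OF this 1(5) fr 1(4)]
      obtain T2 W2 s2 where 2: "exec (While t c) s' T2 W2 s2"
        "T2 \<le> Suc (bops t) + \<mu> i' * (Suc (bops t) + tc)"
        "W2 \<subseteq> fractions (Z ^ 64)" "bounded_memory Z s2" "Q s2" by blast
      have "Suc (\<mu> i') * (Suc (bops t) + tc) \<le> m * (Suc (bops t) + tc)"
        using \<open>\<mu> i' < m\<close> by (intro mult_right_mono) auto
      then have "Suc (bops t + T + T2) \<le> Suc (bops t) + m * (Suc (bops t) + tc)"
        using 1(2) 2(2) by simp
      with exec_While_True[OF True 1(1) 2(1)] 1 2 n show ?thesis by (meson Un_least)
    next
      case False
      have "Suc (bops t) \<le> Suc (bops t) + m * (Suc (bops t) + tc)" by simp
      with exec_While_False[OF False, of c] exit[OF less.prems(1,2) False] less.prems(3) n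
      show ?thesis by blast
    qed
  qed
  from this[OF assms(3) _ _ assms(4)] show ?thesis unfolding wp_def by blast
qed

lemma wp_For:
  assumes "16 \<le> Z" "admissible_test t" and init: "I 0 s0"
    and test: "\<And>i s. I i s \<Longrightarrow> (\<And>x. x \<notin> stores c \<Longrightarrow> s x = s0 x) \<Longrightarrow> i \<le> m \<Longrightarrow> bval t s \<longleftrightarrow> i < m"
    and step: "\<And>i s. I i s \<Longrightarrow> (\<And>x. x \<notin> stores c \<Longrightarrow> s x = s0 x) \<Longrightarrow> i < m \<Longrightarrow> wp Z tc c (I (Suc i)) s"
  shows "wp Z (Suc (bops t) + m * (Suc (bops t) + tc)) (While t c) (I m) s0"
proof (rule wp_While[where I = "\<lambda>i s. i \<le> m \<and> I i s" and start = 0 and \<mu> = "\<lambda>i. m - i"])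
  fix i s
  assume I: "i \<le> m \<and> I i s" and fr: "\<And>x. x \<notin> stores c \<Longrightarrow> s x = s0 x" and t: "bval t s"
  with test have i: "i < m" by blast
  with I fr step have "wp Z tc c (I (Suc i)) s" by blast
  then show "wp Z tc c (\<lambda>s'. \<exists>i'. (i' \<le> m \<and> I i' s') \<and> m - i' < m - i) s"
    by (rule wp_mono) (use i in \<open>auto intro!: exI[of _ "Suc i"]\<close>)
next
  fix i s
  assume I: "i \<le> m \<and> I i s" and "\<And>x. x \<notin> stores c \<Longrightarrow> s x = s0 x" and "\<not> bval t s"
  with test have "i = m" using le_neq_implies_less by blast
  with I show "I m s" by simp
qed (use assms in auto)

text \<open>\<open>cost\<close> and \<open>vc\<close> are meaningful for loop-free programs only.\<close>

fun straight_line :: "com \<Rightarrow> bool" where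
  "straight_line Skip \<longleftrightarrow> True"
| "straight_line (Store x i e) \<longleftrightarrow> admissible i \<and> weight i \<le> 64 \<and> admissible e \<and> weight e \<le> 64"
| "straight_line (Seq c1 c2) \<longleftrightarrow> straight_line c1 \<and> straight_line c2"
| "straight_line (If t c1 c2) \<longleftrightarrow> admissible_test t \<and> straight_line c1 \<and> straight_line c2"
| "straight_line (While t c) \<longleftrightarrow> False"

fun cost :: "com \<Rightarrow> nat" where
  "cost Skip = 0"
| "cost (Store x i e) = Suc (aops i + aops e)"
| "cost (Seq c1 c2) = cost c1 + cost c2"
| "cost (If t c1 c2) = Suc (bops t + (cost c1 + cost c2))"
| "cost (While t c) = 0"

fun vc :: "real \<Rightarrow> com \<Rightarrow> (state \<Rightarrow> bool) \<Rightarrow> state \<Rightarrow> bool" where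
  "vc Z Skip Q s = Q s"
| "vc Z (Store x i e) Q s \<longleftrightarrow> aval e s \<in> fractions Z \<and>
     Q (s(x := (s x)(nat \<lfloor>aval i s\<rfloor> := aval e s)))"
| "vc Z (Seq c1 c2) Q s = vc Z c1 (vc Z c2 Q) s"
| "vc Z (If t c1 c2) Q s = (if bval t s then vc Z c1 Q s else vc Z c2 Q s)"
| "vc Z (While t c) Q s = False"

lemma vc_mono: "vc Z c Q s \<Longrightarrow> (\<And>s. Q s \<Longrightarrow> Q' s) \<Longrightarrow> vc Z c Q' s"
proof (induction c arbitrary: s Q Q')
  case (Seq c1 c2)
  from Seq.prems(1) have "vc Z c1 (vc Z c2 Q) s" by simp
  then have "vc Z c1 (vc Z c2 Q') s"
    by (rule Seq.IH(1)) (rule Seq.IH(2)[OF _ Seq.prems(2)])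
  then show ?case by simp
qed (auto split: if_splits)

lemma wp_cost:
  assumes Z: "16 \<le> Z"
  shows "straight_line c \<Longrightarrow> vc Z c Q s \<Longrightarrow> wp Z (cost c) c Q s"
proof (induction c arbitrary: s Q)
  case Skip
  then show ?case by (simp add: wp_Skip)
next
  case (Store x i e)
  then show ?case unfolding cost.simps straight_line.simps vc.simps
    by (intro wp_Store[OF Z]) blast+
next
  case (Seq c1 c2)
  have "wp Z (cost c1) c1 (wp Z (cost c2) c2 Q) s"
    using Seq.prems by (intro Seq.IH(1)) (auto elim!: vc_mono intro: Seq.IH(2))
  then show ?case unfolding cost.simps by (rule wp_Seq)
next
  case (If t c1 c2)
  then show ?case unfolding cost.simps by (intro wp_If[OF Z]) auto
qed simp

lemma wp_straight_line:
  "16 \<le> Z \<Longrightarrow> straight_line c \<Longrightarrow> cost c \<le> t \<Longrightarrow> vc Z c Q s \<Longrightarrow> wp Z t c Q s"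
  using wp_time[OF wp_cost] by blast

lemma wp_straight_line_Seq:
  assumes "16 \<le> Z" "straight_line c1" "vc Z c1 (wp Z t' c2 Q) s" "cost c1 + t' \<le> t"
  shows "wp Z t (Seq c1 c2) Q s"
  using wp_time[OF wp_Seq[OF wp_cost[OF assms(1-3)]] assms(4)] .

section \<open>The algorithm\<close>

abbreviation var :: "string \<Rightarrow> aexp" ("$_" [100] 100) where "$x \<equiv> Read x (Num 0)"
abbreviation plus_exp (infixl "\<oplus>" 65) where "e \<oplus> f \<equiv> Arith Plus e f"
abbreviation minus_exp (infixl "\<ominus>" 65) where "e \<ominus> f \<equiv> Arith Minus e f"
abbreviation times_exp (infixl "\<otimes>" 70) where "e \<otimes> f \<equiv> Arith Times e f"
abbreviation divide_exp (infixl "\<oslash>" 70) where "e \<oslash> f \<equiv> Arith Divide e f"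
abbreviation assign (infix "::=" 61) where "x ::= e \<equiv> Store x (Num 0) e"
abbreviation seq_com (infixr ";;" 60) where "c ;; d \<equiv> Seq c d"

text \<open>
  The accuracy may be irrational, so it is only ever compared with the rational \<open>1/m\<close>.
\<close>

definition find_scale :: com where
  "find_scale =
     ''m'' ::= Num 1;;
     While (Not (Leq (Num 1 \<oslash> $''m'') ($''eps''))) (''m'' ::= Num 2 \<otimes> $''m'')"

text \<open>The sum \<open>q\<close> of the weights serves twice: to recognize the case of all
  weights zero and to make \<open>2 ^ K\<close> bound every weight. Counters such as
  \<open>i\<close>, \<open>J\<close>, \<open>K\<close>, \<open>k\<close> start from the zero that
  \<open>input_state\<close> puts into every cell outside the inputs.\<close>

definition reduce :: com where
  "reduce =
     ''N'' ::= Num 16 \<otimes> ($''n'' \<otimes> $''n'') \<otimes> $''m'';;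
     ''B'' ::= $''N'' \<otimes> $''b'';;
     While (Not (Leq ($''n'') ($''i''))) (
       If (Leq (Read ''a'' ($''i'')) (Num 0))
         (Store ''A'' ($''i'') (Num 0 \<ominus> $''N'' \<otimes> Read ''a'' ($''i''));;
          ''B'' ::= $''B'' \<oplus> Read ''A'' ($''i''))
         (Store ''A'' ($''i'') ($''N'' \<otimes> Read ''a'' ($''i'')));;
       ''q'' ::= $''q'' \<oplus> Read ''A'' ($''i'');;
       ''i'' ::= $''i'' \<oplus> Num 1)"

definition make_grid :: com where
  "make_grid =
     While (Not (Leq ($''B'') (Read ''T'' ($''J'')))) (
       Store ''T'' ($''J'' \<oplus> Num 1)
         (Read ''T'' ($''J'') \<oplus> Num 1 \<oplus> Floor (Read ''T'' ($''J'') \<oslash> $''N''));;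
       ''J'' ::= $''J'' \<oplus> Num 1)"

text \<open>The machine has no logarithm, so \<open>K\<close> is found by halving. The first summand
  of the test bounds the mantissas of the prefix sums, \<open>q\<close> the weights by which
  \<open>windows\<close> divides.\<close>

definition make_powers :: com where
  "make_powers =
     ''h'' ::= Num 1;;
     While (Not (Leq (Read ''h'' ($''K'') \<otimes>
         ((Num 2 \<otimes> $''N'' \<oplus> Num 2) \<otimes> Read ''T'' ($''J'') \<oplus> $''q'')) (Num 1))) (
       Store ''h'' ($''K'' \<oplus> Num 1) (Read ''h'' ($''K'') \<oslash> Num 2);;
       ''K'' ::= $''K'' \<oplus> Num 1)"

text \<open>In dimension zero the volume is 1 at every grid point: mantissa \<open>N\<close>, and
  exponent 0 as the initial content of \<open>E\<close>.\<close>

definition init_values :: com where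
  "init_values =
     ''j'' ::= Num 1;;
     While (Leq ($''j'') ($''J'')) (
       Store ''M'' ($''j'') ($''N'');;
       ''j'' ::= $''j'' \<oplus> Num 1)"

text \<open>\<open>G\<close> and \<open>F\<close> hold the mantissas \<open>GM\<close> and exponents
  \<open>GE\<close> of \<open>float_prefix_sums\<close>; \<open>G\<close> at 0 is the untouched zero
  cell.\<close>

definition prefix_sums :: com where
  "prefix_sums =
     ''F'' ::= Read ''E'' (Num 1);;
     ''j'' ::= Num 1;;
     While (Leq ($''j'') ($''J'')) (
       If (Leq (Read ''F'' ($''j'' \<ominus> Num 1)) (Read ''E'' ($''j'')))
         (Store ''F'' ($''j'') (Read ''E'' ($''j'')))
         (Store ''F'' ($''j'') (Read ''F'' ($''j'' \<ominus> Num 1)));;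
       Store ''G'' ($''j'')
         (Floor (Read ''G'' ($''j'' \<ominus> Num 1) \<otimes>
            Read ''h'' (Read ''F'' ($''j'') \<ominus> Read ''F'' ($''j'' \<ominus> Num 1))) \<oplus>
          Floor (Read ''M'' ($''j'') \<otimes> (Read ''T'' ($''j'') \<ominus> Read ''T'' ($''j'' \<ominus> Num 1)) \<otimes>
            Read ''h'' (Read ''F'' ($''j'') \<ominus> Read ''E'' ($''j''))) \<oplus> Num 2);;
       ''j'' ::= $''j'' \<oplus> Num 1)"

text \<open>Doubling suffices because \<open>windows\<close> first multiplies by
  \<open>2 ^ - K\<close> and adds \<open>K\<close> to the exponent, which puts the start below
  \<open>2 N\<close>.\<close>

definition normalize :: com where
  "normalize =
     While (Not (Leq ($''N'') ($''x''))) (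
       ''x'' ::= Num 2 \<otimes> $''x'';;
       ''e'' ::= $''e'' \<ominus> Num 1)"

text \<open>
  The cell of the grid containing the lower end of the window moves to the right with the upper end,
  so one loop advances either \<open>p\<close> or \<open>j\<close>.
\<close>

definition windows :: com where
  "windows =
     ''j'' ::= Num 1;;
     ''p'' ::= Num 1;;
     While (Leq ($''j'') ($''J'')) (
       If (Leq (Read ''T'' ($''j'')) (Read ''A'' ($''k'')))
         (''U'' ::= Num 0)
         (''U'' ::= Read ''T'' ($''j'') \<ominus> Read ''A'' ($''k''));;
       If (Not (Leq ($''U'') (Read ''T'' ($''p''))))
         (''p'' ::= $''p'' \<oplus> Num 1)
         (''x'' ::= (Read ''G'' ($''j'') \<ominus>
            (Read ''G'' ($''p'' \<ominus> Num 1) \<otimes>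
               Read ''h'' (Read ''F'' ($''j'') \<ominus> Read ''F'' ($''p'' \<ominus> Num 1)) \<otimes>
               (Read ''T'' ($''p'') \<ominus> $''U'') \<oplus>
             Read ''G'' ($''p'') \<otimes>
               Read ''h'' (Read ''F'' ($''j'') \<ominus> Read ''F'' ($''p'')) \<otimes>
               ($''U'' \<ominus> Read ''T'' ($''p'' \<ominus> Num 1))) \<oslash>
            (Read ''T'' ($''p'') \<ominus> Read ''T'' ($''p'' \<ominus> Num 1))) \<oslash>
            Read ''A'' ($''k'') \<otimes> Read ''h'' ($''K'');;
          ''e'' ::= Read ''F'' ($''j'') \<oplus> $''K'';;
          normalize;;
          Store ''M'' ($''j'') (Floor ($''x'') \<oplus> Num 1);;
          Store ''E'' ($''j'') ($''e'');;
          ''j'' ::= $''j'' \<oplus> Num 1))"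

text \<open>A zero weight leaves the volume function unchanged and would be a divisor in
  \<open>windows\<close>.\<close>

definition rounds :: com where
  "rounds =
     While (Not (Leq ($''n'') ($''k''))) (
       If (Leq (Read ''A'' ($''k'')) (Num 0)) Skip (prefix_sums;; windows);;
       ''k'' ::= $''k'' \<oplus> Num 1)"

text \<open>For capacity at most 0 the volume is 1 if capacity and all weights are 0, and otherwise
  0, which is what the untouched cells of \<open>Z\<close> already represent.\<close>

definition knapsack_volume :: com where
  "knapsack_volume =
     find_scale;;
     reduce;;
     If (Leq ($''B'') (Num 0))
       (If (And (Leq (Num 0) ($''B'')) (Leq ($''q'') (Num 0))) (''Z'' ::= Num 1) Skip)
       (make_grid;;
        make_powers;;
        init_values;;
        rounds;;
        ''Z'' ::= Read ''M'' ($''J'') \<oslash> $''N'';;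
        Store ''Z'' (Num 1) (Read ''E'' ($''J'')))"

lemma nat_floor_simps [simp]:
  "nat \<lfloor>real j - 1\<rfloor> = j - 1" "nat \<lfloor>real j + 1\<rfloor> = Suc j" "nat \<lfloor>1 + real j\<rfloor> = Suc j"
proof -
  have *: "\<lfloor>real j - 1\<rfloor> = int j - 1" "\<lfloor>real j + 1\<rfloor> = int j + 1" "\<lfloor>1 + real j\<rfloor> = int j + 1"
    by linarith+
  show "nat \<lfloor>real j - 1\<rfloor> = j - 1" "nat \<lfloor>real j + 1\<rfloor> = Suc j" "nat \<lfloor>1 + real j\<rfloor> = Suc j"
    unfolding * by auto
qed

section \<open>Correctness of the algorithm\<close>

lemma nat_one_plus_int [simp]: "nat (1 + int j) = Suc j"
  by simp

lemma ex_inverse_power_le: "0 < (\<epsilon>::real) \<Longrightarrow> \<exists>i. 1 / 2 ^ i \<le> \<epsilon>"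
  using real_arch_pow_inv[of \<epsilon> "1/2"] by (auto simp: power_divide intro: less_imp_le)

lemma find_scale_wp:
  assumes Z: "16 \<le> Z" and s: "s ''eps'' 0 = \<epsilon>" and \<epsilon>: "\<epsilon> > 0"
    and i0: "i0 = (LEAST i. 1 / 2 ^ i \<le> \<epsilon>)" "2 ^ i0 \<le> Z"
  shows "wp Z (20 * (i0 + 1)) find_scale (\<lambda>s'. s' ''m'' 0 = 2 ^ i0) s"
proof -
  let ?t = "Not (Leq (Num 1 \<oslash> $''m'') ($''eps''))"
  note ex = ex_inverse_power_le[OF \<epsilon>]
  have iff: "\<epsilon> < 1 / 2 ^ i \<longleftrightarrow> i < i0" if "i \<le> i0" for i
    using that i0(1) LeastI_ex[OF ex] not_less_Least[of i "\<lambda>i. 1 / 2 ^ i \<le> \<epsilon>"]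
    by (cases "i = i0") auto
  have pw: "(2::real) ^ i \<in> fractions Z" if "i \<le> i0" for i
  proof -
    have "(2::real) ^ i \<le> 2 ^ i0" using that by (rule power_increasing) simp
    with i0(2) have "(2::real) ^ i \<le> Z" by linarith
    then show ?thesis using Z by (intro fractions_Ints) auto
  qed
  have loop: "wp Z (Suc (bops ?t) + i0 * (Suc (bops ?t) + 4)) (While ?t (''m'' ::= Num 2 \<otimes> $''m''))
      (\<lambda>s'. s' ''m'' 0 = 2 ^ i0) s" if "s ''m'' 0 = 1" "s ''eps'' 0 = \<epsilon>" for s
  proof (rule wp_For[where I = "\<lambda>i s. s ''m'' 0 = 2 ^ i", OF Z])
    fix i and s' :: state assume "s' ''m'' 0 = 2 ^ i" "\<And>x. x \<notin> stores (''m'' ::= Num 2 \<otimes> $''m'') \<Longrightarrow> s' x = s x" "i \<le> i0"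
    then show "bval ?t s' \<longleftrightarrow> i < i0" using iff[of i] that by (simp add: not_le)
  next
    fix i and s' :: state assume i: "s' ''m'' 0 = 2 ^ i" "i < i0"
    then have "2 * 2 ^ i \<in> fractions Z" using pw[of "Suc i"] by simp
    then show "wp Z 4 (''m'' ::= Num 2 \<otimes> $''m'') (\<lambda>s. s ''m'' 0 = 2 ^ Suc i) s'"
      by (intro wp_straight_line[OF Z]) (use i in auto)
  qed (use that in auto)
  show ?thesis unfolding find_scale_def
    by (rule wp_time, rule wp_Seq, rule wp_Store, rule Z)
       (use Z s fractions_Ints[of 1 Z] in \<open>auto intro: loop\<close>)
qed

lemma reduce_wp:
  fixes a :: "nat \<Rightarrow> int"
  assumes Z: "16 \<le> Z" and n: "n \<ge> 1"
    and s: "s ''n'' 0 = real n" "s ''m'' 0 = real m" "\<And>i. i < n \<Longrightarrow> s ''a'' i = of_int (a i)" "s ''b'' 0 = of_int b"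
      "s ''i'' 0 = 0" "s ''q'' 0 = 0"
    and N: "N = 16 * n ^ 2 * m" "N > 0"
    and bound: "real N * (\<bar>of_int b\<bar> + (\<Sum>i<n. \<bar>of_int (a i)\<bar>)) \<le> Z" "real N \<le> Z"
  shows "wp Z (60 * (n + 1)) reduce (\<lambda>s'. s' ''N'' 0 = real N \<and>
    (\<forall>i<n. s' ''A'' i = real N * \<bar>of_int (a i)\<bar>) \<and>
    s' ''B'' 0 = real N * (of_int b + (\<Sum>i<n. max 0 (- of_int (a i)))) \<and>
    s' ''q'' 0 = (\<Sum>i<n. real N * \<bar>of_int (a i)\<bar>)) s"
proof -
  let ?a = "\<lambda>i. real_of_int (a i)"
  define B where "B l = real N * (of_int b + (\<Sum>i<l. max 0 (- ?a i)))" for l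
  define q where "q l = (\<Sum>i<l. real N * \<bar>?a i\<bar>)" for l
  let ?body = "If (Leq (Read ''a'' ($''i'')) (Num 0))
         (Store ''A'' ($''i'') (Num 0 \<ominus> $''N'' \<otimes> Read ''a'' ($''i''));;
          ''B'' ::= $''B'' \<oplus> Read ''A'' ($''i''))
         (Store ''A'' ($''i'') ($''N'' \<otimes> Read ''a'' ($''i'')));;
       ''q'' ::= $''q'' \<oplus> Read ''A'' ($''i'');;
       ''i'' ::= $''i'' \<oplus> Num 1"
  let ?I = "\<lambda>l s. s ''i'' 0 = real l \<and> (\<forall>i<l. s ''A'' i = real N * \<bar>?a i\<bar>) \<and>
     s ''B'' 0 = B l \<and> s ''q'' 0 = q l"
  let ?Q = "\<lambda>s'. s' ''N'' 0 = real N \<and> (\<forall>i<n. s' ''A'' i = real N * \<bar>?a i\<bar>) \<and>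
    s' ''B'' 0 = real N * (of_int b + (\<Sum>i<n. max 0 (- ?a i))) \<and> s' ''q'' 0 = (\<Sum>i<n. real N * \<bar>?a i\<bar>)"
  let ?t = "Not (Leq ($''n'') ($''i''))"
  have q_le: "0 \<le> q l" "q l \<le> Z" if "l \<le> n" for l
  proof -
    show "0 \<le> q l" unfolding q_def by (intro sum_nonneg) auto
    have "q l \<le> q n" unfolding q_def using that by (intro sum_mono2) auto
    also have "q n = real N * (\<Sum>i<n. \<bar>?a i\<bar>)" by (simp add: q_def sum_distrib_left)
    also have "\<dots> \<le> real N * (\<bar>of_int b\<bar> + (\<Sum>i<n. \<bar>?a i\<bar>))" by (intro mult_left_mono) auto
    finally show "q l \<le> Z" using bound(1) by linarith
  qed
  have B_le: "\<bar>B l\<bar> \<le> Z" if "l \<le> n" for l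
  proof -
    have "(\<Sum>i<l. max 0 (- ?a i)) \<le> (\<Sum>i<l. \<bar>?a i\<bar>)" by (intro sum_mono) auto
    also have "\<dots> \<le> (\<Sum>i<n. \<bar>?a i\<bar>)" using that by (intro sum_mono2) auto
    finally have 1: "(\<Sum>i<l. max 0 (- ?a i)) \<le> (\<Sum>i<n. \<bar>?a i\<bar>)" .
    have "0 \<le> (\<Sum>i<l. max 0 (- ?a i))" by (intro sum_nonneg) auto
    with 1 have "\<bar>of_int b + (\<Sum>i<l. max 0 (- ?a i))\<bar> \<le> \<bar>of_int b\<bar> + (\<Sum>i<n. \<bar>?a i\<bar>)"
      by linarith
    then have "\<bar>B l\<bar> \<le> real N * (\<bar>of_int b\<bar> + (\<Sum>i<n. \<bar>?a i\<bar>))"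
      unfolding abs_mult B_def by (simp add: mult_left_mono)
    with bound(1) show ?thesis by linarith
  qed
  have q_Suc: "q (Suc l) = q l + real N * \<bar>?a l\<bar>" for l by (simp add: q_def)
  have B_Suc: "B (Suc l) = (if a l \<le> 0 then B l + real N * \<bar>?a l\<bar> else B l)" for l
    by (simp add: B_def algebra_simps)
  have n_le: "real n \<le> Z"
  proof -
    have "n \<le> N" using N n by (auto simp: power2_eq_square)
    then show ?thesis using bound(2) by linarith
  qed
  have q_Ints: "q l \<in> \<int>" and B_Ints: "B l \<in> \<int>" for l
    unfolding q_def B_def by (auto intro!: Ints_sum Ints_mult Ints_add simp: max_def)
  have step: "wp Z 50 ?body (?I (Suc l)) s" if l: "l < n" "?I l s" 
    and f: "s ''N'' 0 = real N" "s ''a'' l = ?a l" for l s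
  proof -
    have rb: "real N * \<bar>?a l\<bar> \<in> fractions Z" "B (Suc l) \<in> fractions Z"
      "q (Suc l) \<in> fractions Z" "real (Suc l) \<in> fractions Z"
    proof -
      have "0 \<le> real N * \<bar>?a l\<bar>" "real N * \<bar>?a l\<bar> \<le> Z" using q_Suc[of l] q_le[of l] q_le[of "Suc l"] l by auto
      then show "real N * \<bar>?a l\<bar> \<in> fractions Z" using Z by (intro fractions_Ints) auto
      show "B (Suc l) \<in> fractions Z" "q (Suc l) \<in> fractions Z"
        using B_le[of "Suc l"] q_le[of "Suc l"] l Z by (auto intro!: fractions_Ints B_Ints q_Ints)
      show "real (Suc l) \<in> fractions Z"
        using n_le l Z by (intro fractions_Ints) auto
    qed
    have neg: "- (real N * ?a l) = real N * \<bar>?a l\<bar>" "B l + real N * \<bar>?a l\<bar> = B (Suc l)" if "a l \<le> 0"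
      using that B_Suc[of l] by simp_all
    have pos: "real N * ?a l = real N * \<bar>?a l\<bar>" "B (Suc l) = B l" if "\<not> a l \<le> 0"
      using that B_Suc[of l] by simp_all
    show ?thesis
      apply (rule wp_straight_line[OF Z])
      subgoal by simp subgoal by simp using f l neg pos q_Suc[of l] rb by (auto simp: less_Suc_eq add.commute)
  qed
  have loop: "wp Z (Suc (bops ?t) + n * (Suc (bops ?t) + 50)) (While ?t ?body) (?I n) s"
    if "s ''N'' 0 = real N" "s ''n'' 0 = real n" "\<And>i. i < n \<Longrightarrow> s ''a'' i = ?a i"
      "s ''B'' 0 = B 0" "s ''q'' 0 = 0" "s ''i'' 0 = 0" for s
  proof (rule wp_For[where I = ?I, OF Z])
    fix i and s' :: state
    assume I: "?I i s'" and fr: "\<And>x. x \<notin> stores ?body \<Longrightarrow> s' x = s x" and i: "i \<le> n"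
    from fr[of "''n''"] that have "s' ''n'' 0 = real n" by simp
    with I i show "bval ?t s' \<longleftrightarrow> i < n" by (auto simp del: of_nat_Suc)
  next
    fix i and s' :: state
    assume I: "?I i s'" and fr: "\<And>x. x \<notin> stores ?body \<Longrightarrow> s' x = s x" and i: "i < n"
    from fr[of "''N''"] fr[of "''a''"] that i have "s' ''N'' 0 = real N" "s' ''a'' i = ?a i" by simp_all
    with step[OF i I] show "wp Z 50 ?body (?I (Suc i)) s'" by blast
  qed (use that in \<open>auto simp: q_def\<close>)
  show ?thesis unfolding reduce_def
  proof (rule wp_straight_line_Seq[OF Z, where t' = "8 + 57 * n + 5"])
    have N_real: "16 * (real n * real n) * real m = real N"
      by (simp add: N(1) power2_eq_square)
    let ?s1 = "s(''N'' := (s ''N'')(0 := real N))"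
    have rb: "real N \<in> fractions Z" "B 0 \<in> fractions Z"
      using bound(2) Z B_le[of 0] B_Ints[of 0] by (auto intro!: fractions_Ints)
    have "wp Z (8 + 57 * n + 5) (''B'' ::= $''N'' \<otimes> $''b'';; While ?t ?body) ?Q ?s1"
    proof (rule wp_straight_line_Seq[OF Z, where t' = "8 + 57 * n"])
      let ?s2 = "?s1(''B'' := (?s1 ''B'')(0 := B 0))"
      have "wp Z (8 + 57 * n) (While ?t ?body) ?Q ?s2"
      proof (rule wp_mono[OF loop])
        fix s' :: state
        assume fr: "\<And>x. x \<notin> stores (While ?t ?body) \<Longrightarrow> s' x = ?s2 x" and I: "?I n s'"
        from fr[of "''N''"] have "s' ''N'' 0 = real N" by simp
        with I show "?Q s'"
          by (simp add: B_def q_def)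
      qed (use s in auto)
      then show "vc Z (''B'' ::= $''N'' \<otimes> $''b'') (wp Z (8 + 57 * n) (While ?t ?body) ?Q) ?s1"
        using rb s by (simp add: B_def)
    qed simp_all
    then show "vc Z (''N'' ::= Num 16 \<otimes> ($''n'' \<otimes> $''n'') \<otimes> $''m'')
      (wp Z (8 + 57 * n + 5) (''B'' ::= $''N'' \<otimes> $''b'';; While ?t ?body) ?Q) s"
      using rb s N_real by simp
  qed simp_all
qed

lemma make_grid_wp:
  assumes Z: "16 \<le> Z"
    and s: "s ''B'' 0 = B" "s ''N'' 0 = real N" "s ''T'' 0 = 0" "s ''J'' 0 = 0"
    and N: "N > 0" and J: "J = (LEAST j. B \<le> real (grid N j))" "real (grid N J) \<le> Z"
  shows "wp Z (10 + 30 * J) make_grid (\<lambda>s'. s' ''J'' 0 = real J \<and> (\<forall>i\<le>J. s' ''T'' i = real (grid N i))) s"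
proof -
  let ?t = "Not (Leq ($''B'') (Read ''T'' ($''J'')))"
  let ?body = "Store ''T'' ($''J'' \<oplus> Num 1)
         (Read ''T'' ($''J'') \<oplus> Num 1 \<oplus> Floor (Read ''T'' ($''J'') \<oslash> $''N''));;
       ''J'' ::= $''J'' \<oplus> Num 1"
  let ?I = "\<lambda>j s. s ''J'' 0 = real j \<and> (\<forall>i\<le>j. s ''T'' i = real (grid N i))"
  have iff: "\<not> B \<le> real (grid N j) \<longleftrightarrow> j < J" if "j \<le> J" for j
    using that J(1) LeastI_ex[OF ex_grid_ge[of B N]] not_less_Least[of j "\<lambda>j. B \<le> real (grid N j)"]
    by (cases "j = J") auto
  have T_le: "real (grid N j) \<le> Z" if "j \<le> J" for j
  proof -
    have "real (grid N j) \<le> real (grid N J)" using that by simp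
    then show ?thesis using J(2) by linarith
  qed
  have step: "wp Z 20 ?body (?I (Suc j)) s" if j: "j < J" "?I j s" and f: "s ''N'' 0 = real N" for j and s :: state
  proof (rule wp_straight_line[OF Z])
    have "real (Suc j) \<le> real (grid N (Suc j))" using le_grid[of "Suc j" N] by linarith
    then have rb: "real (grid N (Suc j)) \<in> fractions Z" "real (Suc j) \<in> fractions Z"
      using T_le[of "Suc j"] j Z by (auto intro!: fractions_Ints)
    have T: "real (grid N j) + 1 + of_int \<lfloor>real (grid N j) / real N\<rfloor> = real (grid N (Suc j))"
      by (simp add: grid.simps floor_divide_of_nat_eq)
    show "vc Z ?body (?I (Suc j)) s"
      using j f rb T by (auto simp: le_Suc_eq add.commute)
  qed simp_all
  have "wp Z (Suc (bops ?t) + J * (Suc (bops ?t) + 20)) (While ?t ?body) (?I J) s"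
  proof (rule wp_For[where I = ?I, OF Z])
    fix i and s' :: state
    assume I: "?I i s'" and fr: "\<And>x. x \<notin> stores ?body \<Longrightarrow> s' x = s x" and i: "i \<le> J"
    from fr[of "''B''"] s have "s' ''B'' 0 = B" by simp
    with I iff[OF i] show "bval ?t s' \<longleftrightarrow> i < J" by simp
  next
    fix i and s' :: state
    assume I: "?I i s'" and fr: "\<And>x. x \<notin> stores ?body \<Longrightarrow> s' x = s x" and i: "i < J"
    from fr[of "''N''"] s have "s' ''N'' 0 = real N" by simp
    with step[OF i I] show "wp Z 20 ?body (?I (Suc i)) s'" by blast
  qed (use s in auto)
  then show ?thesis unfolding make_grid_def by (rule wp_time) simp
qed

lemma make_powers_wp:
  assumes Z: "16 \<le> Z"
    and s: "s ''N'' 0 = real N" "s ''J'' 0 = real J" "s ''T'' J = real (grid N J)" "s ''q'' 0 = q" "s ''K'' 0 = 0"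
      "\<And>i. s ''h'' i = 0"
    and X: "X = (2 * real N + 2) * real (grid N J) + q"
    and K: "K = (LEAST k. X \<le> 2 ^ k)" "2 ^ K \<le> Z"
  shows "wp Z (30 + 40 * K) make_powers
    (\<lambda>s'. s' ''K'' 0 = real K \<and> (\<forall>i. s' ''h'' i = (if i \<le> K then 1 / 2 ^ i else 0))) s"
proof -
  let ?t = "Not (Leq (Read ''h'' ($''K'') \<otimes>
         ((Num 2 \<otimes> $''N'' \<oplus> Num 2) \<otimes> Read ''T'' ($''J'') \<oplus> $''q'')) (Num 1))"
  let ?body = "Store ''h'' ($''K'' \<oplus> Num 1) (Read ''h'' ($''K'') \<oslash> Num 2);;
       ''K'' ::= $''K'' \<oplus> Num 1"
  let ?I = "\<lambda>k s. s ''K'' 0 = real k \<and> (\<forall>i. s ''h'' i = (if i \<le> k then 1 / 2 ^ i else 0))"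
  have ex: "\<exists>k. X \<le> 2 ^ k" using real_arch_pow[of 2 X] by (auto intro: less_imp_le)
  have iff: "\<not> 1 / 2 ^ k * X \<le> 1 \<longleftrightarrow> k < K" if "k \<le> K" for k
    using that K(1) LeastI_ex[OF ex] not_less_Least[of k "\<lambda>k. X \<le> 2 ^ k"]
    by (cases "k = K") (auto simp: field_simps)
  have step: "wp Z 20 ?body (?I (Suc k)) s" if k: "k < K" "?I k s" for k and s :: state
  proof (rule wp_straight_line[OF Z])
    have pw: "(2::real) ^ Suc k \<le> 2 ^ K" using k(1) by (intro power_increasing) auto
    then have "(2::real) ^ Suc k \<le> Z" using K(2) by linarith
    then have rb1: "1 / 2 ^ Suc k \<in> fractions Z"
      using Z by (intro fractionsI[of _ 1 "2 ^ Suc k"]) auto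
    have "real (Suc k) < 2 ^ Suc k" using of_nat_less_two_power[of "Suc k", where 'a = real] .
    then have rb2: "real (Suc k) \<in> fractions Z"
      using \<open>2 ^ Suc k \<le> Z\<close> Z by (intro fractions_Ints) auto
    show "vc Z ?body (?I (Suc k)) s"
      using k rb1 rb2 by (auto simp: le_Suc_eq add.commute mult.commute)
  qed simp_all
  have loop: "wp Z (Suc (bops ?t) + K * (Suc (bops ?t) + 20)) (While ?t ?body) (?I K) s"
    if "s ''N'' 0 = real N" "s ''J'' 0 = real J" "s ''T'' J = real (grid N J)" "s ''q'' 0 = q" "?I 0 s"
    for s :: state
  proof (rule wp_For[where I = ?I, OF Z])
    fix i and s' :: state
    assume I: "?I i s'" and fr: "\<And>x. x \<notin> stores ?body \<Longrightarrow> s' x = s x" and i: "i \<le> K"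
    from fr[of "''N''"] fr[of "''J''"] fr[of "''T''"] fr[of "''q''"] that
    have "s' ''N'' 0 = real N" "s' ''J'' 0 = real J" "s' ''T'' J = real (grid N J)" "s' ''q'' 0 = q"
      by simp_all
    with I iff[OF i] show "bval ?t s' \<longleftrightarrow> i < K" by (simp add: X)
  next
    fix i and s' :: state
    assume I: "?I i s'" and i: "i < K"
    from step[OF i I] show "wp Z 20 ?body (?I (Suc i)) s'" .
  qed (use that in auto)
  show ?thesis unfolding make_powers_def
  proof (rule wp_straight_line_Seq[OF Z, where t' = "Suc (bops ?t) + K * (Suc (bops ?t) + 20)"])
    show "vc Z (''h'' ::= Num 1) (wp Z (Suc (bops ?t) + K * (Suc (bops ?t) + 20)) (While ?t ?body) (?I K)) s"
      unfolding vc.simps using Z by (intro conjI loop) (auto simp: s intro!: fractions_Ints)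
  qed simp_all
qed

lemma init_values_wp:
  assumes Z: "16 \<le> Z"
    and s: "s ''N'' 0 = real N" "s ''J'' 0 = real J" and bound: "real N \<le> Z" "real J + 1 \<le> Z"
  shows "wp Z (20 + 20 * J) init_values (\<lambda>s'. \<forall>j. 1 \<le> j \<and> j \<le> J \<longrightarrow> s' ''M'' j = real N) s"
proof -
  let ?t = "Leq ($''j'') ($''J'')"
  let ?body = "Store ''M'' ($''j'') ($''N'');; ''j'' ::= $''j'' \<oplus> Num 1"
  let ?I = "\<lambda>l s. s ''j'' 0 = real (Suc l) \<and> (\<forall>j. 1 \<le> j \<and> j \<le> l \<longrightarrow> s ''M'' j = real N)"
  have step: "wp Z 10 ?body (?I (Suc l)) s" if l: "l < J" "?I l s" and f: "s ''N'' 0 = real N"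
    for l and s :: state
  proof (rule wp_straight_line[OF Z])
    have rb: "real N \<in> fractions Z" "real (Suc (Suc l)) \<in> fractions Z"
      using bound l Z by (auto intro!: fractions_Ints)
    show "vc Z ?body (?I (Suc l)) s"
      using l f rb by (auto simp: le_Suc_eq add.commute)
  qed simp_all
  have loop: "wp Z (Suc (bops ?t) + J * (Suc (bops ?t) + 10)) (While ?t ?body) (?I J) s"
    if "s ''N'' 0 = real N" "s ''J'' 0 = real J" "s ''j'' 0 = 1" for s :: state
  proof (rule wp_For[where I = ?I, OF Z])
    fix i and s' :: state
    assume I: "?I i s'" and fr: "\<And>x. x \<notin> stores ?body \<Longrightarrow> s' x = s x" and i: "i \<le> J"
    from fr[of "''J''"] that have "s' ''J'' 0 = real J" by simp
    with I i show "bval ?t s' \<longleftrightarrow> i < J" by (auto simp del: of_nat_Suc)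
  next
    fix i and s' :: state
    assume I: "?I i s'" and fr: "\<And>x. x \<notin> stores ?body \<Longrightarrow> s' x = s x" and i: "i < J"
    from fr[of "''N''"] that have "s' ''N'' 0 = real N" by simp
    with step[OF i I] show "wp Z 10 ?body (?I (Suc i)) s'" by blast
  qed (use that in auto)
  show ?thesis unfolding init_values_def
  proof (rule wp_straight_line_Seq[OF Z, where t' = "Suc (bops ?t) + J * (Suc (bops ?t) + 10)"])
    have "1 \<in> fractions Z" using Z by (intro fractions_Ints) auto
    then show "vc Z (''j'' ::= Num 1) (wp Z (Suc (bops ?t) + J * (Suc (bops ?t) + 10)) (While ?t ?body)
        (\<lambda>s'. \<forall>j. 1 \<le> j \<and> j \<le> J \<longrightarrow> s' ''M'' j = real N)) s"
      unfolding vc.simps using s by (intro conjI wp_mono[OF loop]) auto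
  qed simp_all
qed

text \<open>Doubling changes only the numerator over the fixed denominator \<open>q0\<close>. Before
  the last doubling the value is below \<open>N\<close>, so it never reaches \<open>2 N\<close> and
  the numerator stays below \<open>2 N q0 \<le> Z\<close>.\<close>

lemma normalize_wp:
  fixes x0 e0 :: real and c q0 :: int
  assumes Z: "16 \<le> Z" and s: "s ''N'' 0 = real N" "s ''x'' 0 = x0" "s ''e'' 0 = e0"
    and x0: "0 < x0" "x0 < 2 * real N" "real N \<le> x0 * 2 ^ R"
    and e0: "e0 \<in> \<int>" "\<bar>e0\<bar> + real R \<le> Z"
    and c: "x0 = of_int c / of_int q0" "0 < q0" "2 * real N * of_int q0 \<le> Z" and N: "N > 0"
  shows "wp Z (10 + 20 * R) normalize (\<lambda>s'. \<exists>r\<le>R. s' ''x'' 0 = x0 * 2 ^ r \<and> s' ''e'' 0 = e0 - real r \<and>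
    real N \<le> s' ''x'' 0 \<and> s' ''x'' 0 < 2 * real N) s"
proof -
  define R' where "R' = (LEAST r. real N \<le> x0 * 2 ^ r)"
  let ?t = "Not (Leq ($''N'') ($''x''))"
  let ?body = "''x'' ::= Num 2 \<otimes> $''x'';; ''e'' ::= $''e'' \<ominus> Num 1"
  let ?I = "\<lambda>r s. s ''x'' 0 = x0 * 2 ^ r \<and> s ''e'' 0 = e0 - real r"
  have R': "R' \<le> R" "real N \<le> x0 * 2 ^ R'"
    unfolding R'_def using x0(3) by (rule Least_le, rule LeastI)
  have iff: "\<not> real N \<le> x0 * 2 ^ r \<longleftrightarrow> r < R'" if "r \<le> R'" for r
    using that R'(2) not_less_Least[of r "\<lambda>r. real N \<le> x0 * 2 ^ r"]
    by (cases "r = R'") (auto simp: R'_def)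
  have lt: "x0 * 2 ^ r < 2 * real N" if "r \<le> R'" for r
  proof (cases r)
    case (Suc r')
    with iff[of r'] that have "x0 * 2 ^ r' < real N" by simp
    with Suc show ?thesis by simp
  qed (use x0 in simp)
  have step: "wp Z 10 ?body (?I (Suc r)) s" if r: "r < R'" "?I r s" for r and s :: state
  proof (rule wp_straight_line[OF Z])
    have q0: "1 \<le> real_of_int q0" using c(2) by simp
    have l: "x0 * 2 ^ Suc r < 2 * real N" using lt[of "Suc r"] r by simp
    have eq: "x0 * 2 ^ Suc r = of_int (c * 2 ^ Suc r) / of_int q0" using c by simp
    have "\<bar>real_of_int (c * 2 ^ Suc r)\<bar> = x0 * 2 ^ Suc r * of_int q0"
      using x0(1) c(1,2) by (simp add: field_simps abs_mult zero_less_divide_iff)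
    also have "\<dots> \<le> 2 * real N * of_int q0" using l q0 by (intro mult_right_mono) auto
    finally have 1: "real_of_int \<bar>c * 2 ^ Suc r\<bar> \<le> Z" using c(3) by simp
    have "1 * of_int q0 \<le> 2 * real N * of_int q0" using N q0 by (intro mult_right_mono) auto
    then have "of_int q0 \<le> Z" using c(3) by simp
    with eq 1 c(2) have "x0 * 2 ^ Suc r \<in> fractions Z"
      by (intro fractionsI[of _ "c * 2 ^ Suc r" q0]) auto
    then have rb1: "2 * (x0 * 2 ^ r) \<in> fractions Z" by (simp add: mult.left_commute)
    have "\<bar>e0 - real (Suc r)\<bar> \<le> Z" using e0(2) r(1) R'(1) by linarith
    then have rb2: "e0 - real r - 1 \<in> fractions Z"
      using e0(1) Z by (intro fractions_Ints) (auto simp: algebra_simps)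
    show "vc Z ?body (?I (Suc r)) s"
      using r rb1 rb2 by simp
  qed simp_all
  have "wp Z (Suc (bops ?t) + R' * (Suc (bops ?t) + 10)) (While ?t ?body) (?I R') s"
  proof (rule wp_For[where I = ?I, OF Z])
    fix i and s' :: state
    assume I: "?I i s'" and fr: "\<And>x. x \<notin> stores ?body \<Longrightarrow> s' x = s x" and i: "i \<le> R'"
    from fr[of "''N''"] s have "s' ''N'' 0 = real N" by simp
    with I iff[OF i] show "bval ?t s' \<longleftrightarrow> i < R'" by simp
  next
    fix i and s' :: state
    assume I: "?I i s'" and i: "i < R'"
    then show "wp Z 10 ?body (?I (Suc i)) s'" using step[OF i, of s'] by blast
  qed (use s in auto)
  then show ?thesis unfolding normalize_def
  proof (rule wp_mono)
    show "Suc (bops ?t) + R' * (Suc (bops ?t) + 10) \<le> 10 + 20 * R" using R'(1) by simp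
  next
    fix s' :: state assume "?I R' s'"
    with R' lt[of R'] show "\<exists>r\<le>R. s' ''x'' 0 = x0 * 2 ^ r \<and> s' ''e'' 0 = e0 - real r \<and>
      real N \<le> s' ''x'' 0 \<and> s' ''x'' 0 < 2 * real N" by (intro exI[of _ R']) auto
  qed
qed

section \<open>Correctness of a single round of the program\<close>

lemma prefix_sums_wp:
  assumes Z: "16 \<le> Z"
    and s: "s ''J'' 0 = real J" "\<And>j. j \<le> J \<Longrightarrow> s ''T'' j = real (grid N j)" "s ''G'' 0 = 0"
    and N: "N > 0" and J: "J > 0" and \<kappa>: "\<kappa> \<ge> 1"
    and K: "(2 * real N + 2) * real (grid N J) \<le> 2 ^ K"
    and h: "\<And>i. s ''h'' i = (if i \<le> K then 1 / 2 ^ i else 0)"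
    and H_mono: "\<And>i j. i \<le> j \<Longrightarrow> H i \<le> H j"
    and M_Ints: "\<And>j. 1 \<le> j \<Longrightarrow> j \<le> J \<Longrightarrow> s ''M'' j \<in> \<int>"
    and M_ge: "\<And>j. 1 \<le> j \<Longrightarrow> j \<le> J \<Longrightarrow> real N \<le> s ''M'' j"
    and M_le: "\<And>j. 1 \<le> j \<Longrightarrow> j \<le> J \<Longrightarrow> s ''M'' j \<le> 2 * real N"
    and E_Ints: "\<And>j. 1 \<le> j \<Longrightarrow> j \<le> J \<Longrightarrow> s ''E'' j \<in> \<int>"
    and E_abs: "\<And>j. 1 \<le> j \<Longrightarrow> j \<le> J \<Longrightarrow> \<bar>s ''E'' j\<bar> \<le> Z"
    and lower: "\<And>j. 1 \<le> j \<Longrightarrow> j \<le> J \<Longrightarrow> real N * H j \<le> s ''M'' j * 2 powr s ''E'' j"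
    and upper: "\<And>j. 1 \<le> j \<Longrightarrow> j \<le> J \<Longrightarrow> s ''M'' j * 2 powr s ''E'' j \<le> \<kappa> * (real N * H j)"
    and bound: "2 ^ K \<le> Z" "real J + 1 \<le> Z"
  shows "wp Z (30 + 80 * J) prefix_sums (\<lambda>s'.
    float_prefix_sums N J K \<kappa> H (s ''M'') (s ''E'') (s' ''G'') (s' ''F'') (s ''h'')) s"
proof -
  let ?t = "Leq ($''j'') ($''J'')"
  let ?body = "If (Leq (Read ''F'' ($''j'' \<ominus> Num 1)) (Read ''E'' ($''j'')))
         (Store ''F'' ($''j'') (Read ''E'' ($''j'')))
         (Store ''F'' ($''j'') (Read ''F'' ($''j'' \<ominus> Num 1)));;
       Store ''G'' ($''j'')
         (Floor (Read ''G'' ($''j'' \<ominus> Num 1) \<otimes>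
            Read ''h'' (Read ''F'' ($''j'') \<ominus> Read ''F'' ($''j'' \<ominus> Num 1))) \<oplus>
          Floor (Read ''M'' ($''j'') \<otimes> (Read ''T'' ($''j'') \<ominus> Read ''T'' ($''j'' \<ominus> Num 1)) \<otimes>
            Read ''h'' (Read ''F'' ($''j'') \<ominus> Read ''E'' ($''j''))) \<oplus> Num 2);;
       ''j'' ::= $''j'' \<oplus> Num 1"
  define M E h where "M = s ''M''" and "E = s ''E''" and "h = s ''h''"
  define rec where "rec l G F \<longleftrightarrow> F (Suc l) = max (F l) (E (Suc l)) \<and>
    G (Suc l) = of_int \<lfloor>G l * h (nat \<lfloor>F (Suc l) - F l\<rfloor>)\<rfloor> +
      of_int \<lfloor>M (Suc l) * (real (grid N (Suc l)) - real (grid N l)) *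
        h (nat \<lfloor>F (Suc l) - E (Suc l)\<rfloor>)\<rfloor> + 2" for l and G F :: "nat \<Rightarrow> real"
  have K_le: "(2 * real N + 2) * real (grid N j) \<le> 2 ^ K" if "j \<le> J" for j
  proof -
    have "(2 * real N + 2) * real (grid N j) \<le> (2 * real N + 2) * real (grid N J)"
      using that by (intro mult_left_mono) auto
    with K show ?thesis by linarith
  qed
  \<comment> \<open>The locale is instantiated for every initial segment of length \<open>i\<close>.
    During the loop its mantissa bounds thus apply to the entry about to be stored, which must be
    known to lie in \<open>fractions Z\<close>.\<close>
  have sums: "float_prefix_sums N i K \<kappa> H M E G F h"
    if "G 0 = 0" "F 0 = E 1" "\<And>l. l < i \<Longrightarrow> rec l G F" "0 < i" "i \<le> J" for G F i
    unfolding float_prefix_sums_def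
    using that N \<kappa> K_le[of i] assms(9) H_mono M_Ints M_ge M_le E_Ints lower upper
    unfolding rec_def M_def E_def h_def by auto
  let ?I = "\<lambda>i s. s ''j'' 0 = real (Suc i) \<and> s ''G'' 0 = 0 \<and> s ''F'' 0 = E 1 \<and>
    (\<forall>l\<le>i. \<bar>s ''F'' l\<bar> \<le> Z \<and> s ''F'' l \<in> \<int>) \<and> (\<forall>l<i. rec l (s ''G'') (s ''F''))"
  have step: "wp Z 60 ?body (?I (Suc i)) s'" if i: "i < J" "?I i s'"
    and f: "s' ''M'' = M" "s' ''E'' = E" "s' ''h'' = h" "s' ''T'' (Suc i) = real (grid N (Suc i))"
      "s' ''T'' i = real (grid N i)" for i and s' :: state
  proof (rule wp_straight_line[OF Z])
    define F where "F = (s' ''F'')(Suc i := max (s' ''F'' i) (E (Suc i)))"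
    define G where "G = (s' ''G'')(Suc i := of_int \<lfloor>s' ''G'' i * h (nat \<lfloor>F (Suc i) - F i\<rfloor>)\<rfloor> +
      of_int \<lfloor>M (Suc i) * (real (grid N (Suc i)) - real (grid N i)) *
        h (nat \<lfloor>F (Suc i) - E (Suc i)\<rfloor>)\<rfloor> + 2)"
    have F_Suc: "F (Suc i) = (if s' ''F'' i \<le> E (Suc i) then E (Suc i) else s' ''F'' i)"
      by (simp add: F_def max_def)
    have F_bd: "\<bar>F (Suc i)\<bar> \<le> Z" "F (Suc i) \<in> \<int>"
      using i E_abs[of "Suc i"] E_Ints[of "Suc i"] by (auto simp: F_Suc E_def)
    have r: "rec l G F" if "l < Suc i" for l
    proof (cases "l = i")
      case True
      then show ?thesis by (simp add: rec_def G_def F_def)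
    next
      case False
      then have "l < i" using that by simp
      then have "rec l (s' ''G'') (s' ''F'')" using i by blast
      then show ?thesis using \<open>l < i\<close> by (simp add: rec_def G_def F_def)
    qed
    have "float_prefix_sums N (Suc i) K \<kappa> H M E G F h"
      by (rule sums) (use i r in \<open>auto simp: G_def F_def\<close>)
    then have "G (Suc i) \<in> \<int>" "0 \<le> G (Suc i)" "G (Suc i) \<le> 2 ^ K"
      using float_prefix_sums.GM_bounds[of N "Suc i" K \<kappa> H M E G F h "Suc i"]
        float_prefix_sums.GM_le_2K[of N "Suc i" K \<kappa> H M E G F h "Suc i"] by auto
    then have G_rb: "G (Suc i) \<in> fractions Z"
      using bound(1) Z by (intro fractions_Ints) auto
    have F_rb: "F (Suc i) \<in> fractions Z" using F_bd Z by (intro fractions_Ints) auto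
    have j_rb: "real (Suc (Suc i)) \<in> fractions Z"
      using i(1) bound(2) Z by (intro fractions_Ints) auto
    have fin: "?I (Suc i) (s'(''F'' := F, ''G'' := G, ''j'' := (s' ''j'')(0 := real (Suc (Suc i)))))"
      using i F_bd r by (auto simp: le_Suc_eq F_def G_def)
    have G_Suc: "G (Suc i) = of_int \<lfloor>s' ''G'' i * h (nat \<lfloor>F (Suc i) - F i\<rfloor>)\<rfloor> +
      of_int \<lfloor>M (Suc i) * (real (grid N (Suc i)) - real (grid N i)) *
        h (nat \<lfloor>F (Suc i) - E (Suc i)\<rfloor>)\<rfloor> + 2" by (simp add: G_def)
    have F_i: "F i = s' ''F'' i" by (simp add: F_def)
    have F_upd: "(s' ''F'')(Suc i := F (Suc i)) = F" by (simp add: F_def)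
    have G_upd: "(s' ''G'')(Suc i := G (Suc i)) = G" by (simp add: G_def)
    let ?old = "Read ''F'' ($''j'' \<ominus> Num 1)" and ?new = "Read ''E'' ($''j'')"
    have "vc Z (Store ''F'' ($''j'') ?old) Q s' \<longleftrightarrow> Q (s'(''F'' := F))" if "\<not> s' ''F'' i \<le> E (Suc i)" for Q
    proof -
      have "s' ''F'' i = F (Suc i)" using that F_Suc by simp
      with F_rb F_upd i show ?thesis by simp
    qed
    moreover have "vc Z (Store ''F'' ($''j'') ?new) Q s' \<longleftrightarrow> Q (s'(''F'' := F))" if "s' ''F'' i \<le> E (Suc i)" for Q
    proof -
      have "E (Suc i) = F (Suc i)" using that F_Suc by simp
      with F_rb F_upd i f show ?thesis by simp
    qed
    moreover have "bval (Leq ?old ?new) s' \<longleftrightarrow> s' ''F'' i \<le> E (Suc i)"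
      using i f by simp
    ultimately have ifc: "vc Z (If (Leq ?old ?new) (Store ''F'' ($''j'') ?new) (Store ''F'' ($''j'') ?old)) Q s' \<longleftrightarrow>
      Q (s'(''F'' := F))" for Q
      unfolding vc.simps(4) by simp
    show "vc Z ?body (?I (Suc i)) s'"
      unfolding vc.simps(3) ifc
      using fin G_rb j_rb i f F_i G_upd unfolding G_Suc by (simp add: add.commute)
  qed simp_all
  have loop: "wp Z (Suc (bops ?t) + J * (Suc (bops ?t) + 60)) (While ?t ?body) (?I J) s'"
    if "s' ''M'' = M" "s' ''E'' = E" "s' ''h'' = h" "s' ''T'' = s ''T''" "s' ''J'' 0 = real J" "?I 0 s'" for s' :: state
  proof (rule wp_For[where I = ?I, OF Z])
    fix i and s'' :: state
    assume I: "?I i s''" and fr: "\<And>x. x \<notin> stores ?body \<Longrightarrow> s'' x = s' x" and i: "i \<le> J"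
    from fr[of "''J''"] that have "s'' ''J'' 0 = real J" by simp
    with I i show "bval ?t s'' \<longleftrightarrow> i < J" by (auto simp del: of_nat_Suc)
  next
    fix i and s'' :: state
    assume I: "?I i s''" and fr: "\<And>x. x \<notin> stores ?body \<Longrightarrow> s'' x = s' x" and i: "i < J"
    from fr[of "''M''"] fr[of "''E''"] fr[of "''h''"] fr[of "''T''"] that
    have "s'' ''M'' = M" "s'' ''E'' = E" "s'' ''h'' = h" "s'' ''T'' = s ''T''" by simp_all
    then show "wp Z 60 ?body (?I (Suc i)) s''" using s(2) i by (intro step[OF i I]) auto
  qed (use that in auto)
  let ?t' = "Suc (bops ?t) + J * (Suc (bops ?t) + 60)"
  let ?Q = "\<lambda>s'. float_prefix_sums N J K \<kappa> H M E (s' ''G'') (s' ''F'') h"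
  let ?s = "s(''F'' := (s ''F'')(0 := E 1))"
  have E1: "E 1 \<in> fractions Z" "E 1 \<in> \<int>" "\<bar>E 1\<bar> \<le> Z"
    using E_Ints[of 1] E_abs[of 1] J Z by (auto simp: E_def intro!: fractions_Ints)
  have one: "1 \<in> fractions Z" using Z by (intro fractions_Ints) auto
  have "wp Z ?t' (While ?t ?body) ?Q (?s(''j'' := (?s ''j'')(0 := 1)))"
  proof (rule wp_mono[OF loop])
    fix s' :: state assume I: "?I J s'"
    show "?Q s'" by (rule sums) (use I J in auto)
  qed (use s E1 in \<open>auto simp: M_def E_def h_def\<close>)
  then have "wp Z (5 + ?t') (''j'' ::= Num 1;; While ?t ?body) ?Q ?s"
    using one by (intro wp_straight_line_Seq[OF Z, where t' = ?t']) simp_all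
  then have "wp Z (30 + 80 * J) (''F'' ::= Read ''E'' (Num 1);; ''j'' ::= Num 1;; While ?t ?body) ?Q s"
    using E1 by (intro wp_straight_line_Seq[OF Z, where t' = "5 + ?t'"]) (simp_all add: E_def)
  then show ?thesis unfolding prefix_sums_def M_def E_def h_def .
qed

text \<open>Each pass advances one of the two pointers, so there are at most \<open>2 J\<close>
  passes, each of cost O(\<open>K\<close>) for the normalization. The hypothesis on
  \<open>H'\<close> has the shape that \<open>cvol_grid_Suc\<close> delivers.\<close>

lemma windows_wp:
  fixes A :: nat and H H' M0 E0 :: "nat \<Rightarrow> real"
  assumes Z: "16 \<le> Z"
    and s: "s ''N'' 0 = real N" "s ''J'' 0 = real J" "\<And>j. j \<le> J \<Longrightarrow> s ''T'' j = real (grid N j)"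
      "s ''K'' 0 = real K" "s ''k'' 0 = real k" "s ''A'' k = real A"
    and fps: "float_prefix_sums N J K \<kappa> H M0 E0 (s ''G'') (s ''F'') (s ''h'')" and \<kappa>_le: "\<kappa> \<le> 2"
    and E0: "\<And>j. 1 \<le> j \<Longrightarrow> j \<le> J \<Longrightarrow> \<bar>E0 j\<bar> \<le> e"
    and A: "1 \<le> A" "real A \<le> 2 ^ K"
    and H': "\<And>j. 0 \<le> H' j" "\<And>j p U. 1 \<le> j \<Longrightarrow> j \<le> J \<Longrightarrow> p < j \<Longrightarrow> U = max 0 (real (grid N j) - real A) \<Longrightarrow>
      real (grid N p) \<le> U \<Longrightarrow> U \<le> real (grid N (Suc p)) \<Longrightarrow>
      real A * H' j = H (Suc p) * (real (grid N (Suc p)) - U) +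
        (\<Sum>i\<in>{Suc p<..j}. H i * (real (grid N i) - real (grid N (i - 1))))"
    and bound: "2 ^ (6 * K) \<le> Z" "e + 3 * real K + 2 \<le> Z" "real J + 1 \<le> Z"
  shows "wp Z (40 + 2 * J * (270 + 40 * K)) windows (\<lambda>s'. \<forall>j. 1 \<le> j \<and> j \<le> J \<longrightarrow>
    s' ''M'' j \<in> \<int> \<and> real N \<le> s' ''M'' j \<and> s' ''M'' j \<le> 2 * real N \<and>
    s' ''E'' j \<in> \<int> \<and> \<bar>s' ''E'' j\<bar> \<le> e + real K + 1 \<and>
    real N * H' j \<le> s' ''M'' j * 2 powr s' ''E'' j \<and>
    s' ''M'' j * 2 powr s' ''E'' j \<le> (\<kappa> * (1 + 1 / real N) ^ 4) * (real N * H' j)) s"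
proof -
  interpret float_prefix_sums N J K \<kappa> H M0 E0 "s ''G''" "s ''F''" "s ''h''" by (rule fps)
  let ?T = "\<lambda>j. real (grid N j)"
  let ?x = "(Read ''G'' ($''j'') \<ominus>
            (Read ''G'' ($''p'' \<ominus> Num 1) \<otimes>
               Read ''h'' (Read ''F'' ($''j'') \<ominus> Read ''F'' ($''p'' \<ominus> Num 1)) \<otimes>
               (Read ''T'' ($''p'') \<ominus> $''U'') \<oplus>
             Read ''G'' ($''p'') \<otimes>
               Read ''h'' (Read ''F'' ($''j'') \<ominus> Read ''F'' ($''p'')) \<otimes>
               ($''U'' \<ominus> Read ''T'' ($''p'' \<ominus> Num 1))) \<oslash>
            (Read ''T'' ($''p'') \<ominus> Read ''T'' ($''p'' \<ominus> Num 1))) \<oslash>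
            Read ''A'' ($''k'') \<otimes> Read ''h'' ($''K'')"
  let ?fin = "Store ''M'' ($''j'') (Floor ($''x'') \<oplus> Num 1);;
          Store ''E'' ($''j'') ($''e'');;
          ''j'' ::= $''j'' \<oplus> Num 1"
  let ?cell = "''x'' ::= ?x;;
          ''e'' ::= Read ''F'' ($''j'') \<oplus> $''K'';;
          normalize;; ?fin"
  let ?if1 = "If (Leq (Read ''T'' ($''j'')) (Read ''A'' ($''k'')))
         (''U'' ::= Num 0)
         (''U'' ::= Read ''T'' ($''j'') \<ominus> Read ''A'' ($''k''))"
  let ?if2 = "If (Not (Leq ($''U'') (Read ''T'' ($''p''))))
         (''p'' ::= $''p'' \<oplus> Num 1) ?cell"
  let ?body = "?if1;; ?if2"
  let ?t = "Leq ($''j'') ($''J'')"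
  define U where "U j = max 0 (?T j - real A)" for j
  define good where "good M E j \<longleftrightarrow> M \<in> \<int> \<and> real N \<le> M \<and> M \<le> 2 * real N \<and>
    E \<in> \<int> \<and> \<bar>E\<bar> \<le> e + real K + 1 \<and> real N * H' j \<le> M * 2 powr E \<and>
    M * 2 powr E \<le> (\<kappa> * (1 + 1 / real N) ^ 4) * (real N * H' j)" for M E :: real and j
  define frame where "frame s' \<longleftrightarrow> s' ''N'' = s ''N'' \<and> s' ''J'' = s ''J'' \<and> s' ''T'' = s ''T'' \<and>
    s' ''K'' = s ''K'' \<and> s' ''k'' = s ''k'' \<and> s' ''A'' = s ''A'' \<and> s' ''G'' = s ''G'' \<and>
    s' ''F'' = s ''F'' \<and> s' ''h'' = s ''h''" for s' :: state
  \<comment> \<open>The program variables are one ahead of \<open>j\<close> and \<open>p\<close>: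
    \<open>j\<close> points are finished and \<open>p\<close> is the left end of the current cell.
    Only the lower condition \<open>T p \<le> U\<close> is invariant; the upper one is the branch
    test.\<close>
  define I where "I jp s' \<longleftrightarrow> (case jp of (j, p) \<Rightarrow> s' ''j'' 0 = real (Suc j) \<and> s' ''p'' 0 = real (Suc p) \<and>
    j \<le> J \<and> p \<le> J \<and> (j < J \<longrightarrow> ?T p \<le> U (Suc j)) \<and> (\<forall>i. 1 \<le> i \<and> i \<le> j \<longrightarrow> good (s' ''M'' i) (s' ''E'' i) i))"
    for jp and s' :: state
  define \<mu> where "\<mu> jp = (case jp of (j, p) \<Rightarrow> (J - j) + (J - p))" for jp
  have TJ: "1 \<le> ?T J"
  proof -
    have "1 \<le> grid N J" using le_grid[of J N] J by linarith
    then show ?thesis by simp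
  qed
  have NT: "real N * 1 \<le> real N * ?T J" using TJ by (intro mult_left_mono) auto
  have TJK: "?T J \<le> 2 ^ K" "2 * real N \<le> 2 ^ K"
  proof -
    have "(2 * real N + 2) * ?T J = 2 * (real N * ?T J) + 2 * ?T J" by (simp add: algebra_simps)
    moreover have "0 \<le> real N * ?T J" by simp
    ultimately show "?T J \<le> 2 ^ K" "2 * real N \<le> 2 ^ K" using K NT TJ by linarith+
  qed
  have T_le: "?T j \<le> 2 ^ K" if "j \<le> J" for j using T_mono[OF that] TJK by linarith
  have "(2::real) ^ K \<le> 2 ^ (6 * K)" by (intro power_increasing) auto
  then have KZ': "2 ^ K \<le> Z" using bound(1) by linarith
  then have NZ: "2 * real N \<le> Z" using TJK(2) by linarith
  have U_props: "0 \<le> U j" "U j \<le> ?T j" "U j \<in> \<int>" for j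
    using A by (auto simp: U_def max_def)
  have U_rb: "U j \<in> fractions Z" if "j \<le> J" for j
  proof -
    have "U j \<le> Z" using U_props(2)[of j] T_le[OF that] KZ' by linarith
    then show ?thesis using U_props[of j] Z by (intro fractions_Ints) auto
  qed
  \<comment> \<open>Integral weights and grid points give the window at least unit length, as
    \<open>window\<close> requires.\<close>
  have U_less: "U (Suc j) \<le> ?T (Suc j) - 1" for j
  proof -
    have "1 \<le> grid N (Suc j)" using le_grid[of "Suc j" N] by linarith
    then have "1 \<le> ?T (Suc j)" by simp
    then show ?thesis using A by (auto simp: U_def max_def)
  qed
  have pow_2K: "(2::real) ^ (2 * K) = 2 ^ K * 2 ^ K"
    unfolding mult_2 by (rule power_add)
  have cell: "wp Z (230 + 40 * K) ?cell (\<lambda>s'. I (Suc j, p) s') s'"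
    if fr: "frame s'" and I: "I (j, p) s'" and j: "j < J" and UT: "U (Suc j) \<le> ?T (Suc p)" and s'U: "s' ''U'' 0 = U (Suc j)"
    for j p and s' :: state
  proof -
    let ?h1 = "s ''h'' (nat \<lfloor>s ''F'' (Suc j) - s ''F'' p\<rfloor>)"
    let ?h2 = "s ''h'' (nat \<lfloor>s ''F'' (Suc j) - s ''F'' (Suc p)\<rfloor>)"
    define D where "D = s ''G'' (Suc j) - (s ''G'' p * ?h1 * (?T (Suc p) - U (Suc j)) +
      s ''G'' (Suc p) * ?h2 * (U (Suc j) - ?T p)) / (?T (Suc p) - ?T p)"
    define w where "w = H (Suc p) * (?T (Suc p) - U (Suc j)) +
      (\<Sum>i\<in>{Suc p<..Suc j}. H i * (?T i - ?T (i - 1)))"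
    define x0 where "x0 = D / real A * s ''h'' K"
    define e0 where "e0 = s ''F'' (Suc j) + real K"
    have Ij: "s' ''j'' 0 = real (Suc j)" "s' ''p'' 0 = real (Suc p)" "?T p \<le> U (Suc j)"
      "\<And>i. 1 \<le> i \<Longrightarrow> i \<le> j \<Longrightarrow> good (s' ''M'' i) (s' ''E'' i) i"
      using I j by (auto simp: I_def)
    have "?T p < ?T (Suc j)" using Ij(3) U_less[of j] by linarith
    then have pj: "p < Suc j" by simp
    have w: "real A * H' (Suc j) = w" unfolding w_def
      using H'(2)[of "Suc j" p "U (Suc j)"] pj j Ij(3) UT by (simp add: U_def)
    note W = window[of p "Suc j" "U (Suc j)", folded D_def w_def]
    have D: "real N * w \<le> D * 2 powr s ''F'' (Suc j)" "D * 2 powr s ''F'' (Suc j) \<le> \<kappa> * (real N + 3) * w"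
      "D \<le> s ''G'' (Suc j)" "real N \<le> \<kappa> * D"
      using W pj j Ij(3) UT U_less[of j] by auto
    have N1: "1 \<le> real N" using N by simp
    have D_pos: "0 < D"
    proof (rule ccontr)
      assume "\<not> 0 < D"
      then have "\<kappa> * D \<le> 0" using \<kappa> by (simp add: mult_nonneg_nonpos)
      with D(4) N1 show False by linarith
    qed
    have "\<kappa> * D \<le> 2 * D" using \<kappa>_le D_pos by (intro mult_right_mono) auto
    then have ND: "real N \<le> 2 * D" using D(4) by linarith
    have hK: "s ''h'' K = 1 / 2 ^ K" using h by simp
    have A_pos: "0 < real A" using A by simp
    have x0_pos: "0 < x0" unfolding x0_def hK using D_pos A_pos by simp
    \<comment> \<open>\<open>D \<le> 2 ^ K\<close> and \<open>A \<ge> 1\<close>, so after the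
      prescaling the value is at most 1.\<close>
    have x0_lt: "x0 < 2 * real N"
    proof -
      have "D \<le> 2 ^ K" using D(3) GM_le_2K[of "Suc j"] j by simp
      moreover have "1 * 2 ^ K \<le> real A * (2::real) ^ K" using A by (intro mult_right_mono) auto
      ultimately have "D \<le> real A * 2 ^ K" by linarith
      then have "x0 \<le> 1" unfolding x0_def hK using A_pos by (simp add: divide_simps mult.commute)
      then show ?thesis using N1 by linarith
    qed
    \<comment> \<open>\<open>D \<ge> N / 2\<close> because \<open>\<kappa> \<le> 2\<close>; the
      division by \<open>A \<le> 2 ^ K\<close> and the prescaling cost at most \<open>2 ^ K\<close>
      each.\<close>
    have x0_R: "real N \<le> x0 * 2 ^ (2 * K + 1)"
    proof -
      have "real N * real A \<le> (2 * D) * 2 ^ K" using ND A by (intro mult_mono) auto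
      then have "real N \<le> 2 * D * 2 ^ K / real A" using A_pos by (simp add: divide_simps)
      also have "\<dots> = x0 * 2 ^ (2 * K + 1)"
      proof -
        have "(2::real) ^ (2 * K + 1) = 2 * (2 ^ K * 2 ^ K)" using pow_2K by simp
        moreover have "2 * D * y / real A = D / real A * (1 / y) * (2 * (y * y))" if "y \<noteq> 0" for y
          using that by simp
        ultimately show ?thesis unfolding x0_def hK by simp
      qed
      finally show ?thesis .
    qed
    have F_bd: "s ''F'' (Suc j) \<in> \<int>" "\<bar>s ''F'' (Suc j)\<bar> \<le> e"
    proof -
      show "s ''F'' (Suc j) \<in> \<int>" using GE_Ints[of "Suc j"] j by simp
      obtain i where "1 \<le> i" "i \<le> Suc j" "s ''F'' (Suc j) = E0 i" using GE_spec[of "Suc j"] j by auto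
      with E0[of i] j show "\<bar>s ''F'' (Suc j)\<bar> \<le> e" by simp
    qed
    have e0: "e0 \<in> \<int>" "\<bar>e0\<bar> \<le> e + real K" unfolding e0_def using F_bd by auto
    obtain c q0 :: int where cq: "x0 = of_int c / of_int q0" "0 < q0" "2 * real N * of_int q0 \<le> Z"
    proof -
      \<comment> \<open>A common denominator of \<open>x0\<close>: one factor \<open>2 ^ K\<close>
        from the prescaling, one from the table \<open>h\<close>, then the cell length and the
        weight. Each of the four factors, and \<open>2 N\<close>, is at most \<open>2 ^ K\<close>,
        hence \<open>5 K\<close> below.\<close>
      define q where "q = 2 ^ (2 * K) * (int (grid N (Suc p)) - int (grid N p)) * int A"
      have \<Delta>: "int (grid N (Suc p)) - int (grid N p) > 0" by (simp add: grid.simps)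
      then have q_pos: "0 < q" using A by (simp add: q_def)
      have qr: "real_of_int q = 2 ^ (2 * K) * (?T (Suc p) - ?T p) * real A" by (simp add: q_def)
      have hint: "s ''h'' i * 2 ^ K \<in> \<int>" for i
      proof (cases "i \<le> K")
        case True
        then have "s ''h'' i * 2 ^ K = 2 ^ (K - i)" using h by (simp add: power_diff)
        then show ?thesis by simp
      qed (simp add: h)
      define h1 h2 where "h1 = ?h1 * 2 ^ K"
        and "h2 = ?h2 * 2 ^ K"
      have hi: "h1 \<in> \<int>" "h2 \<in> \<int>" unfolding h1_def h2_def by (rule hint)+
      have \<Delta>r: "?T (Suc p) - ?T p \<noteq> 0" using T_step[of p] by linarith
      have "x0 * real_of_int q = (D * (?T (Suc p) - ?T p)) * 2 ^ K"
      proof -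
        have "D / real A * (1 / y) * (y * y * \<Delta> * real A) = D * \<Delta> * y" if "y \<noteq> 0" for y \<Delta>
          using that A_pos by simp
        then show ?thesis unfolding x0_def hK qr pow_2K by simp
      qed
      also have "D * (?T (Suc p) - ?T p) = s ''G'' (Suc j) * (?T (Suc p) - ?T p) -
        (s ''G'' p * ?h1 * (?T (Suc p) - U (Suc j)) +
        s ''G'' (Suc p) * ?h2 * (U (Suc j) - ?T p))"
        unfolding D_def left_diff_distrib using \<Delta>r by simp
      also have "\<dots> * 2 ^ K = s ''G'' (Suc j) * (?T (Suc p) - ?T p) * 2 ^ K -
        (s ''G'' p * h1 * (?T (Suc p) - U (Suc j)) + s ''G'' (Suc p) * h2 * (U (Suc j) - ?T p))"
        unfolding h1_def h2_def by (simp add: algebra_simps)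
      also have "\<dots> \<in> \<int>"
        using hi GM_bounds[of "Suc j"] GM_bounds[of p] GM_bounds[of "Suc p"] pj j U_props(3)[of "Suc j"]
        by (intro Ints_diff Ints_add Ints_mult) auto
      finally obtain c where c: "x0 * real_of_int q = of_int c" by (auto elim: Ints_cases)
      have "?T (Suc p) - ?T p \<le> ?T (Suc p)" by simp
      also have "\<dots> \<le> 2 ^ K" using pj j by (intro T_le) simp
      finally have "real_of_int q \<le> 2 ^ (2 * K) * 2 ^ K * 2 ^ K"
        unfolding qr using T_step[of p] A by (intro mult_mono) auto
      then have "2 * real N * of_int q \<le> 2 ^ K * (2 ^ (2 * K) * 2 ^ K * 2 ^ K)"
        using TJK(2) q_pos by (intro mult_mono) auto
      also have "\<dots> = 2 ^ (5 * K)" by (simp add: power_add[symmetric])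
      also have "\<dots> \<le> (2::real) ^ (6 * K)" by (intro power_increasing) auto
      finally have "2 * real N * of_int q \<le> Z" using bound(1) by linarith
      moreover have "x0 = of_int c / of_int q" using c q_pos by (simp add: field_simps)
      ultimately show ?thesis using that q_pos by blast
    qed
    have x0_rb: "x0 \<in> fractions Z"
    proof -
      have "x0 * of_int q0 = of_int c" using cq(1,2) by simp
      moreover have "0 < x0 * of_int q0" using x0_pos cq(2) by simp
      ultimately have "\<bar>real_of_int c\<bar> = x0 * of_int q0" by linarith
      also have "\<dots> \<le> 2 * real N * of_int q0" using x0_lt cq by (intro mult_right_mono) auto
      finally have "of_int \<bar>c\<bar> \<le> Z" using cq(3) by simp
      moreover have "1 * of_int q0 \<le> 2 * real N * of_int q0" using N1 cq(2) by (intro mult_right_mono) auto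
      then have "of_int q0 \<le> Z" using cq(3) by linarith
      ultimately show ?thesis using cq by (intro fractionsI[of _ c q0]) auto
    qed
    have e0_rb: "e0 \<in> fractions Z" using e0 bound(2) Z by (intro fractions_Ints) auto
    have xval: "aval ?x s' = x0"
      using fr s s'U Ij pj j unfolding x0_def D_def frame_def by simp
    let ?s2 = "s'(''x'' := (s' ''x'')(0 := x0))"
    let ?s3 = "?s2(''e'' := (?s2 ''e'')(0 := e0))"
    have fin: "wp Z 20 ?fin (\<lambda>s'. I (Suc j, p) s') s''"
      if fr'': "\<And>x. x \<notin> {''x'', ''e''} \<Longrightarrow> s'' x = s' x" and r: "r \<le> 2 * K + 1"
        and x: "s'' ''x'' 0 = x0 * 2 ^ r" "s'' ''e'' 0 = e0 - real r" "real N \<le> s'' ''x'' 0" "s'' ''x'' 0 < 2 * real N"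
      for s'' :: state and r
    proof (rule wp_straight_line[OF Z])
      have xe: "s'' ''x'' 0 * 2 powr s'' ''e'' 0 = D / real A * 2 powr s ''F'' (Suc j)"
        unfolding x x0_def e0_def hK by (simp add: powr_add powr_diff powr_realpow)
      have D1: "real N * (real A * H' (Suc j)) \<le> D * 2 powr s ''F'' (Suc j)"
        "D * 2 powr s ''F'' (Suc j) \<le> \<kappa> * (real N + 3) * (real A * H' (Suc j))"
        using D w by auto
      note R = round_up_mantissa[OF x(3,4) N A_pos \<kappa> H'(1) D1 xe]
      \<comment> \<open>The prescaling adds \<open>K\<close> and the doublings remove between 0 and
        \<open>2 K + 1\<close>, so the exponent moves by at most \<open>K + 1\<close>.\<close>
      have e1: "\<bar>e0 - real r\<bar> \<le> e + real K + 1" "e0 - real r \<in> \<int>"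
      proof -
        have "real r \<le> 2 * real K + 1" using r by linarith
        then show "\<bar>e0 - real r\<bar> \<le> e + real K + 1" using F_bd(2) unfolding e0_def by linarith
        show "e0 - real r \<in> \<int>" using e0(1) by simp
      qed
      have g: "good (of_int \<lfloor>s'' ''x'' 0\<rfloor> + 1) (e0 - real r) (Suc j)"
        unfolding good_def using R e1 x(2) by auto
      have rb: "of_int \<lfloor>s'' ''x'' 0\<rfloor> + 1 \<in> fractions Z" "e0 - real r \<in> fractions Z"
        "real (Suc (Suc j)) \<in> fractions Z"
        using R(1,2) N1 NZ bound(2,3) e1 Z j by (auto intro!: fractions_Ints)
      \<comment> \<open>The lower end of the window moves right with \<open>j\<close>, so the
        pointer \<open>p\<close> never has to go back.\<close>
      have UU: "?T p \<le> U (Suc (Suc j))" 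
      proof -
        have "U (Suc j) \<le> U (Suc (Suc j))" unfolding U_def by (intro max.mono) auto
        then show ?thesis using Ij(3) by linarith
      qed
      have jj: "s'' ''j'' = s' ''j''" "s'' ''p'' = s' ''p''" "s'' ''M'' = s' ''M''" "s'' ''E'' = s' ''E''"
        using fr'' by auto
      let ?s4 = "s''(''M'' := (s'' ''M'')(Suc j := of_int \<lfloor>s'' ''x'' 0\<rfloor> + 1))"
      let ?s5 = "?s4(''E'' := (?s4 ''E'')(Suc j := e0 - real r))"
      have "I (Suc j, p) (?s5(''j'' := (?s5 ''j'')(0 := real (Suc (Suc j)))))"
        unfolding I_def using I[unfolded I_def] jj g Ij(4) UU j by (auto simp: le_Suc_eq)
      then show "vc Z ?fin (\<lambda>s'. I (Suc j, p) s') s''"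
        using rb jj Ij x(2) by (simp add: add.commute)
    qed simp_all
    have nz: "wp Z (30 + 40 * K) normalize (wp Z 20 ?fin (\<lambda>s'. I (Suc j, p) s')) ?s3"
    proof (rule wp_mono[OF normalize_wp[OF Z _ _ _ x0_pos x0_lt x0_R e0(1) _ cq N]])
      show "\<bar>e0\<bar> + real (2 * K + 1) \<le> Z" using e0 bound(2) by simp
      fix s'' :: state
      assume fr3: "\<And>x. x \<notin> stores normalize \<Longrightarrow> s'' x = ?s3 x"
        and "\<exists>r\<le>2 * K + 1. s'' ''x'' 0 = x0 * 2 ^ r \<and> s'' ''e'' 0 = e0 - real r \<and> real N \<le> s'' ''x'' 0 \<and> s'' ''x'' 0 < 2 * real N"
      then obtain r where "r \<le> 2 * K + 1" "s'' ''x'' 0 = x0 * 2 ^ r" "s'' ''e'' 0 = e0 - real r"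
         "real N \<le> s'' ''x'' 0" "s'' ''x'' 0 < 2 * real N" by blast
      moreover have "s'' x = s' x" if "x \<notin> {''x'', ''e''}" for x
        using fr3[of x] that by (auto simp: normalize_def)
      ultimately show "wp Z 20 ?fin (\<lambda>s'. I (Suc j, p) s') s''" by (intro fin)
    qed (use fr s in \<open>auto simp: frame_def\<close>)
    have "wp Z (100 + 40 * K) (''e'' ::= Read ''F'' ($''j'') \<oplus> $''K'';; normalize;; ?fin) (\<lambda>s'. I (Suc j, p) s') ?s2"
    proof (rule wp_straight_line_Seq[OF Z, where t' = "(30 + 40 * K) + 20"])
      have "aval (Read ''F'' ($''j'') \<oplus> $''K'') ?s2 = e0"
        using fr s Ij by (simp add: e0_def frame_def)
      then show "vc Z (''e'' ::= Read ''F'' ($''j'') \<oplus> $''K'') (wp Z (30 + 40 * K + 20) (normalize;; ?fin) (\<lambda>s'. I (Suc j, p) s')) ?s2"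
        using wp_Seq[OF nz] e0_rb unfolding vc.simps by simp
    qed simp_all
    then show ?thesis
    proof (intro wp_straight_line_Seq[OF Z, where t' = "100 + 40 * K"])
      assume 1: "wp Z (100 + 40 * K) (''e'' ::= Read ''F'' ($''j'') \<oplus> $''K'';; normalize;; ?fin) (\<lambda>s'. I (Suc j, p) s') ?s2"
      show "vc Z (''x'' ::= ?x) (wp Z (100 + 40 * K) (''e'' ::= Read ''F'' ($''j'') \<oplus> $''K'';; normalize;; ?fin) (\<lambda>s'. I (Suc j, p) s')) s'"
        unfolding vc.simps xval using 1 x0_rb by simp
    qed simp_all
  qed
  have step: "wp Z (260 + 40 * K) ?body (\<lambda>s'. \<exists>jp'. I jp' s' \<and> \<mu> jp' < \<mu> jp) s'"
    if fr: "frame s'" and I: "I jp s'" and b: "bval ?t s'" for jp and s' :: state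
  proof -
    obtain j p where jp: "jp = (j, p)" by fastforce
    have Ij: "s' ''j'' 0 = real (Suc j)" "s' ''p'' 0 = real (Suc p)"
      using I by (auto simp: I_def jp)
    have j: "j < J" using b Ij fr s by (simp add: frame_def)
    have Tp: "?T p \<le> U (Suc j)" using I j by (simp add: I_def jp)
    have "?T p < ?T (Suc j)" using Tp U_less[of j] by linarith
    then have pj: "p < Suc j" by simp
    let ?s1 = "s'(''U'' := (s' ''U'')(0 := U (Suc j)))"
    have fr1: "frame ?s1" using fr by (simp add: frame_def)
    have I1: "I (j, p) ?s1" using I by (simp add: I_def jp)
    have A': "s' ''A'' k = real A" "s' ''k'' 0 = real k" "s' ''T'' (Suc j) = ?T (Suc j)" "s' ''T'' (Suc p) = ?T (Suc p)"
      using fr s j pj by (auto simp: frame_def)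
    have if1: "vc Z ?if1 Q s'" if "Q ?s1" for Q
    proof (cases "?T (Suc j) \<le> real A")
      case True
      then have "U (Suc j) = 0" by (simp add: U_def)
      then show ?thesis using that U_rb[of "Suc j"] j Ij A' True by simp
    next
      case False
      then have "U (Suc j) = ?T (Suc j) - real A" by (simp add: U_def)
      then show ?thesis using that U_rb[of "Suc j"] j Ij A' False by simp
    qed
    have if2: "wp Z (240 + 40 * K) ?if2 (\<lambda>s'. \<exists>jp'. I jp' s' \<and> \<mu> jp' < \<mu> jp) ?s1"
    proof (rule wp_time[OF wp_If[OF Z, where ?t1.0 = 4 and ?t2.0 = "230 + 40 * K"]])
      assume "bval (Not (Leq ($''U'') (Read ''T'' ($''p'')))) ?s1"
      then have lt: "?T (Suc p) < U (Suc j)" using Ij A' by simp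
      with U_less[of j] have "?T (Suc p) < ?T (Suc j)" by linarith
      then have pj': "Suc p < Suc j" by simp
      show "wp Z 4 (''p'' ::= $''p'' \<oplus> Num 1) (\<lambda>s'. \<exists>jp'. I jp' s' \<and> \<mu> jp' < \<mu> jp) ?s1"
      proof (rule wp_straight_line[OF Z])
        have rb: "real (Suc (Suc p)) \<in> fractions Z"
          using pj' j bound(3) Z by (intro fractions_Ints) auto
        have "I (j, Suc p) (?s1(''p'' := (?s1 ''p'')(0 := real (Suc (Suc p)))))"
          using I1 lt pj' j by (auto simp: I_def)
        moreover have "\<mu> (j, Suc p) < \<mu> jp" using pj' j by (simp add: \<mu>_def jp)
        ultimately show "vc Z (''p'' ::= $''p'' \<oplus> Num 1) (\<lambda>s'. \<exists>jp'. I jp' s' \<and> \<mu> jp' < \<mu> jp) ?s1"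
          using rb Ij by (auto simp: add.commute)
      qed simp_all
    next
      assume "\<not> bval (Not (Leq ($''U'') (Read ''T'' ($''p'')))) ?s1"
      then have "U (Suc j) \<le> ?T (Suc p)" using Ij A' by simp
      from cell[OF fr1 I1 j this] have "wp Z (230 + 40 * K) ?cell (\<lambda>s'. I (Suc j, p) s') ?s1" by simp
      then show "wp Z (230 + 40 * K) ?cell (\<lambda>s'. \<exists>jp'. I jp' s' \<and> \<mu> jp' < \<mu> jp) ?s1"
      proof (rule wp_mono)
        fix s'' :: state assume "I (Suc j, p) s''"
        moreover have "\<mu> (Suc j, p) < \<mu> jp" using j by (simp add: \<mu>_def jp)
        ultimately show "\<exists>jp'. I jp' s'' \<and> \<mu> jp' < \<mu> jp" by blast
      qed simp
    qed simp_all
    show ?thesis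
    proof (rule wp_straight_line_Seq[OF Z, where t' = "240 + 40 * K"])
      show "vc Z ?if1 (wp Z (240 + 40 * K) ?if2 (\<lambda>s'. \<exists>jp'. I jp' s' \<and> \<mu> jp' < \<mu> jp)) s'"
        by (rule if1, rule if2)
    qed simp_all
  qed
  let ?Q = "\<lambda>s'. \<forall>j. 1 \<le> j \<and> j \<le> J \<longrightarrow> good (s' ''M'' j) (s' ''E'' j) j"
  have loop: "wp Z (Suc (bops ?t) + (2 * J) * (Suc (bops ?t) + (260 + 40 * K))) (While ?t ?body) ?Q s0"
    if fr0: "frame s0" and i0: "I (0, 0) s0" for s0 :: state
  proof (rule wp_While[where I = I and \<mu> = \<mu> and start = "(0, 0)", OF Z])
    show "\<mu> (0, 0) \<le> 2 * J" by (simp add: \<mu>_def)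
    fix jp and s' :: state
    assume I: "I jp s'" and fr: "\<And>x. x \<notin> stores ?body \<Longrightarrow> s' x = s0 x"
    have fr': "frame s'"
      using fr0 fr[of "''N''"] fr[of "''J''"] fr[of "''T''"] fr[of "''K''"] fr[of "''k''"] fr[of "''A''"]
        fr[of "''G''"] fr[of "''F''"] fr[of "''h''"] by (simp add: frame_def normalize_def)
    {
      assume "bval ?t s'"
      then show "wp Z (260 + 40 * K) ?body (\<lambda>s'. \<exists>jp'. I jp' s' \<and> \<mu> jp' < \<mu> jp) s'"
        by (rule step[OF fr' I])
    next
      assume b: "\<not> bval ?t s'"
      obtain j p where jp: "jp = (j, p)" by fastforce
      have "j = J" using b I fr' s by (auto simp: frame_def I_def jp)
      then show "?Q s'" using I by (auto simp: I_def jp)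
    }
  qed (use i0 in auto)
  let ?t' = "Suc (bops ?t) + (2 * J) * (Suc (bops ?t) + (260 + 40 * K))"
  have one: "1 \<in> fractions Z" using Z by (intro fractions_Ints) auto
  let ?s1 = "s(''j'' := (s ''j'')(0 := 1))"
  let ?s2 = "?s1(''p'' := (?s1 ''p'')(0 := 1))"
  have "wp Z ?t' (While ?t ?body) ?Q ?s2"
    by (rule loop) (use U_props(1) in \<open>auto simp: frame_def I_def\<close>)
  then have "wp Z (5 + ?t') (''p'' ::= Num 1;; While ?t ?body) ?Q ?s1"
    using one by (intro wp_straight_line_Seq[OF Z, where t' = ?t']) simp_all
  then have "wp Z (10 + ?t') windows ?Q s" unfolding windows_def
    using one by (intro wp_straight_line_Seq[OF Z, where t' = "5 + ?t'"]) simp_all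
  then show ?thesis
    by (rule wp_mono) (auto simp: good_def algebra_simps)
qed

text \<open>A round costs a factor \<open>(1 + 1/N) ^ 4\<close> in accuracy and \<open>K + 1\<close>
  in the size of exponents. Keeping the accumulated factor below 2 is what guarantees each window
  difference half of its mantissa.\<close>

lemma rounds_wp:
  fixes A :: "nat \<Rightarrow> nat"
  assumes Z: "16 \<le> Z"
    and s: "s ''n'' 0 = real n" "s ''N'' 0 = real N" "s ''J'' 0 = real J" "\<And>j. j \<le> J \<Longrightarrow> s ''T'' j = real (grid N j)"
      "s ''K'' 0 = real K" "s ''k'' 0 = 0" "\<And>i. i < n \<Longrightarrow> s ''A'' i = real (A i)" "s ''G'' 0 = 0"
      "\<And>j. 1 \<le> j \<Longrightarrow> j \<le> J \<Longrightarrow> s ''M'' j = real N" "\<And>j. s ''E'' j = 0"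
    and h: "\<And>i. s ''h'' i = (if i \<le> K then 1 / 2 ^ i else 0)"
    and N: "N > 0" and J: "J > 0"
    and K: "(2 * real N + 2) * real (grid N J) \<le> 2 ^ K" "\<And>i. i < n \<Longrightarrow> real (A i) \<le> 2 ^ K"
    and \<kappa>: "(1 + 1 / real N) ^ (4 * n) \<le> 2"
    and bound: "2 ^ (6 * K) \<le> Z" "real n * (real K + 1) + 3 * real K + 2 \<le> Z" "real J + 1 \<le> Z"
  defines "H \<equiv> \<lambda>k j. cvol (grid_up N) (\<lambda>i. real (A i)) k (real (grid N j))"
  shows "wp Z (10 + n * (150 + J * (650 + 80 * K))) rounds (\<lambda>s'.
    s' ''M'' J \<in> \<int> \<and> 0 \<le> s' ''M'' J \<and> s' ''M'' J \<le> 2 * real N \<and> s' ''E'' J \<in> \<int> \<and> \<bar>s' ''E'' J\<bar> \<le> Z \<and>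
    real N * H n J \<le> s' ''M'' J * 2 powr s' ''E'' J \<and>
    s' ''M'' J * 2 powr s' ''E'' J \<le> (1 + 1 / real N) ^ (4 * n) * (real N * H n J)) s"
proof -
  let ?t = "Not (Leq ($''n'') ($''k''))"
  let ?if = "If (Leq (Read ''A'' ($''k'')) (Num 0)) Skip (prefix_sums;; windows)"
  let ?body = "?if;; ''k'' ::= $''k'' \<oplus> Num 1"
  define \<kappa> where "\<kappa> k = (1 + 1 / real N) ^ (4 * k)" for k
  define good where "good k M E \<longleftrightarrow> (\<forall>j. 1 \<le> j \<and> j \<le> J \<longrightarrow>
    M j \<in> \<int> \<and> real N \<le> M j \<and> M j \<le> 2 * real N \<and> E j \<in> \<int> \<and> \<bar>E j\<bar> \<le> real k * (real K + 1) \<and>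
    real N * H k j \<le> M j * 2 powr E j \<and> M j * 2 powr E j \<le> \<kappa> k * (real N * H k j))"
    for k and M E :: "nat \<Rightarrow> real"
  define frame where "frame s' \<longleftrightarrow> s' ''n'' = s ''n'' \<and> s' ''N'' = s ''N'' \<and> s' ''J'' = s ''J'' \<and> s' ''T'' = s ''T'' \<and>
    s' ''K'' = s ''K'' \<and> s' ''A'' = s ''A'' \<and> s' ''h'' = s ''h''" for s' :: state
  let ?I = "\<lambda>k s'. s' ''k'' 0 = real k \<and> s' ''G'' 0 = 0 \<and> good k (s' ''M'') (s' ''E'')"
  have \<kappa>_mono: "\<kappa> i \<le> \<kappa> j" if "i \<le> j" for i j
    unfolding \<kappa>_def using that by (intro power_increasing) auto
  have \<kappa>_1: "1 \<le> \<kappa> k" for k unfolding \<kappa>_def by (intro one_le_power) auto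
  have \<kappa>_2: "\<kappa> k \<le> 2" if "k \<le> n" for k using \<kappa>_mono[OF that] \<kappa> unfolding \<kappa>_def by linarith
  have \<kappa>_Suc: "\<kappa> (Suc k) = \<kappa> k * (1 + 1 / real N) ^ 4" for k
    unfolding \<kappa>_def by (simp add: power_add[symmetric] add.commute)
  have H_nonneg: "0 \<le> H k j" for k j unfolding H_def by (rule cvol_nonneg[OF grid_up_mono])
  have H_mono: "H k i \<le> H k j" if "i \<le> j" for k i j
    unfolding H_def using that by (intro cvol_mono[OF grid_up_mono]) simp
  have "(2::real) ^ K \<le> 2 ^ (6 * K)" by (intro power_increasing) auto
  then have KZ: "2 ^ K \<le> Z" using bound(1) by linarith
  have E_le: "real k * (real K + 1) \<le> real n * (real K + 1)" if "k \<le> n" for k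
    using that by (intro mult_right_mono) auto
  have process: "wp Z (70 + J * (620 + 80 * K)) (prefix_sums;; windows)
      (\<lambda>s''. s'' ''k'' 0 = real k \<and> s'' ''G'' 0 = 0 \<and> good (Suc k) (s'' ''M'') (s'' ''E'')) s'"
    if k: "k < n" "?I k s'" and fr: "frame s'" and A: "0 < A k" for k and s' :: state
  proof -
    let ?Q = "\<lambda>s''. s'' ''k'' 0 = real k \<and> s'' ''G'' 0 = 0 \<and> good (Suc k) (s'' ''M'') (s'' ''E'')"
    let ?e = "real k * (real K + 1)"
    have g: "good k (s' ''M'') (s' ''E'')" using k by simp
    have E_Z: "?e + real K + 1 \<le> Z" "?e + 3 * real K + 2 \<le> Z"
      using E_le[of k] k(1) bound(2) by linarith+
    have fr': "s' ''J'' 0 = real J" "\<And>j. j \<le> J \<Longrightarrow> s' ''T'' j = real (grid N j)" "s' ''N'' 0 = real N"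
      "\<And>i. s' ''h'' i = (if i \<le> K then 1 / 2 ^ i else 0)" "s' ''K'' 0 = real K" "s' ''A'' k = real (A k)"
      using fr s h k(1) by (auto simp: frame_def)
    have P: "wp Z (30 + 80 * J) prefix_sums (\<lambda>s1.
      float_prefix_sums N J K (\<kappa> k) (H k) (s' ''M'') (s' ''E'') (s1 ''G'') (s1 ''F'') (s' ''h'')) s'"
    proof (rule prefix_sums_wp[OF Z])
      show "s' ''J'' 0 = real J" "\<And>j. j \<le> J \<Longrightarrow> s' ''T'' j = real (grid N j)" "s' ''G'' 0 = 0"
        "\<And>i. s' ''h'' i = (if i \<le> K then 1 / 2 ^ i else 0)" using fr' k by auto
      show "\<bar>s' ''E'' j\<bar> \<le> Z" if "1 \<le> j" "j \<le> J" for j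
      proof -
        have "\<bar>s' ''E'' j\<bar> \<le> ?e" using g that by (simp add: good_def)
        then show ?thesis using E_Z(1) of_nat_0_le_iff[of K, where 'a = real] by linarith
      qed
    qed (use g N J \<kappa>_1 K(1) KZ bound(3) H_mono in \<open>auto simp: good_def\<close>)
    have W: "wp Z (40 + 2 * J * (270 + 40 * K)) windows ?Q s1"
      if fps: "float_prefix_sums N J K (\<kappa> k) (H k) (s' ''M'') (s' ''E'') (s1 ''G'') (s1 ''F'') (s' ''h'')"
        and fr1: "\<And>x. x \<notin> stores prefix_sums \<Longrightarrow> s1 x = s' x" for s1 :: state
    proof -
      have eq: "s1 ''N'' = s' ''N''" "s1 ''J'' = s' ''J''" "s1 ''T'' = s' ''T''" "s1 ''K'' = s' ''K''"
        "s1 ''k'' = s' ''k''" "s1 ''A'' = s' ''A''" "s1 ''h'' = s' ''h''"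
        by (rule fr1; simp add: prefix_sums_def)+
      show ?thesis
      proof (rule wp_mono[OF windows_wp[OF Z, where s = s1 and N = N and J = J and K = K and k = k and A = "A k" and
              \<kappa> = "\<kappa> k" and H = "H k" and ?M0.0 = "s' ''M''" and ?E0.0 = "s' ''E''" and e = ?e and H' = "H (Suc k)"]])
        show "float_prefix_sums N J K (\<kappa> k) (H k) (s' ''M'') (s' ''E'') (s1 ''G'') (s1 ''F'') (s1 ''h'')"
          using fps unfolding eq .
        show "\<And>j. 1 \<le> j \<Longrightarrow> j \<le> J \<Longrightarrow> \<bar>s' ''E'' j\<bar> \<le> ?e" using g by (simp add: good_def)
        show "\<kappa> k \<le> 2" using \<kappa>_2 k(1) by simp
        show "real (A k) * H (Suc k) j = H k (Suc p) * (real (grid N (Suc p)) - U) +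
          (\<Sum>i\<in>{Suc p<..j}. H k i * (real (grid N i) - real (grid N (i - 1))))"
          if "1 \<le> j" "j \<le> J" "p < j" "U = max 0 (real (grid N j) - real (A k))"
            "real (grid N p) \<le> U" "U \<le> real (grid N (Suc p))" for j p U
          unfolding H_def using that A by (intro cvol_grid_Suc) auto
        show "s1 ''N'' 0 = real N" "s1 ''J'' 0 = real J" "\<And>j. j \<le> J \<Longrightarrow> s1 ''T'' j = real (grid N j)"
          "s1 ''K'' 0 = real K" "s1 ''k'' 0 = real k" "s1 ''A'' k = real (A k)"
          unfolding eq using fr' k by auto
        show "real (A k) \<le> 2 ^ K" using K(2) k(1) .
        fix s2 :: state
        assume fr2: "\<And>x. x \<notin> stores windows \<Longrightarrow> s2 x = s1 x"
          and *: "\<forall>j. 1 \<le> j \<and> j \<le> J \<longrightarrow>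
            s2 ''M'' j \<in> \<int> \<and> real N \<le> s2 ''M'' j \<and> s2 ''M'' j \<le> 2 * real N \<and>
            s2 ''E'' j \<in> \<int> \<and> \<bar>s2 ''E'' j\<bar> \<le> ?e + real K + 1 \<and>
            real N * H (Suc k) j \<le> s2 ''M'' j * 2 powr s2 ''E'' j \<and>
            s2 ''M'' j * 2 powr s2 ''E'' j \<le> (\<kappa> k * (1 + 1 / real N) ^ 4) * (real N * H (Suc k) j)"
        have "s2 ''k'' = s' ''k''" "s2 ''G'' = s1 ''G''"
          using fr2[of "''k''"] fr2[of "''G''"] eq by (simp_all add: windows_def normalize_def)
        moreover have "s1 ''G'' 0 = 0" by (rule float_prefix_sums.GM_0[OF fps])
        moreover have "real (Suc k) * (real K + 1) = ?e + real K + 1" by (simp add: algebra_simps)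
        ultimately show "?Q s2" using * k unfolding good_def \<kappa>_Suc by simp
      qed (use Z A H_nonneg bound E_Z in auto)
    qed
    have "wp Z ((30 + 80 * J) + (40 + 2 * J * (270 + 40 * K))) (prefix_sums;; windows) ?Q s'"
      by (rule wp_Seq, rule wp_mono[OF P]) (use W in auto)
    then show ?thesis by (rule wp_time) (simp add: algebra_simps)
  qed
  have step: "wp Z (130 + J * (620 + 80 * K)) ?body (?I (Suc k)) s'"
    if k: "k < n" "?I k s'" and fr: "frame s'" for k and s' :: state
  proof -
    let ?Q = "\<lambda>s''. s'' ''k'' 0 = real k \<and> s'' ''G'' 0 = 0 \<and> good (Suc k) (s'' ''M'') (s'' ''E'')"
    have A: "s' ''A'' k = real (A k)" using fr s k(1) by (simp add: frame_def)
    have "wp Z (100 + J * (620 + 80 * K)) ?if ?Q s'"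
    proof (rule wp_time[OF wp_If[OF Z, where ?t1.0 = 0 and ?t2.0 = "70 + J * (620 + 80 * K)"]])
      assume "bval (Leq (Read ''A'' ($''k'')) (Num 0)) s'"
      then have A0: "A k = 0" using A k by simp
      then have H_eq: "H (Suc k) j = H k j" for j unfolding H_def by (intro cvol_grid_Suc_zero) simp
      have \<kappa>_le: "\<kappa> k * (real N * H k j) \<le> \<kappa> (Suc k) * (real N * H k j)" for j
        using \<kappa>_mono[of k "Suc k"] H_nonneg by (intro mult_right_mono) auto
      have e_le: "real k * (real K + 1) \<le> real (Suc k) * (real K + 1)" by (intro mult_right_mono) auto
      \<comment> \<open>Nothing is computed; the allowances for error and exponent only grow with
        \<open>k\<close>.\<close>
      have "good (Suc k) (s' ''M'') (s' ''E'')"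
        unfolding good_def H_eq
      proof (intro allI impI)
        fix j assume j: "1 \<le> j \<and> j \<le> J"
        with k have "s' ''M'' j \<in> \<int> \<and> real N \<le> s' ''M'' j \<and> s' ''M'' j \<le> 2 * real N \<and> s' ''E'' j \<in> \<int>"
          "\<bar>s' ''E'' j\<bar> \<le> real k * (real K + 1)" "real N * H k j \<le> s' ''M'' j * 2 powr s' ''E'' j"
          "s' ''M'' j * 2 powr s' ''E'' j \<le> \<kappa> k * (real N * H k j)"
          unfolding good_def by blast+
        with order.trans[OF _ e_le] order.trans[OF _ \<kappa>_le]
        show "s' ''M'' j \<in> \<int> \<and> real N \<le> s' ''M'' j \<and> s' ''M'' j \<le> 2 * real N \<and> s' ''E'' j \<in> \<int> \<and>
          \<bar>s' ''E'' j\<bar> \<le> real (Suc k) * (real K + 1) \<and> real N * H k j \<le> s' ''M'' j * 2 powr s' ''E'' j \<and>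
          s' ''M'' j * 2 powr s' ''E'' j \<le> \<kappa> (Suc k) * (real N * H k j)" by blast
      qed
      then show "wp Z 0 Skip ?Q s'" using k by (intro wp_Skip) simp
    next
      assume "\<not> bval (Leq (Read ''A'' ($''k'')) (Num 0)) s'"
      then have "0 < A k" using A k by simp
      then show "wp Z (70 + J * (620 + 80 * K)) (prefix_sums;; windows) ?Q s'"
        by (rule process[OF k fr])
    qed simp_all
    then have "wp Z (100 + J * (620 + 80 * K)) ?if (wp Z 4 (''k'' ::= $''k'' \<oplus> Num 1) (?I (Suc k))) s'"
    proof (rule wp_mono)
      fix s'' :: state assume Q: "?Q s''"
      have "real (Suc k) \<le> real n * (real K + 1) + 3 * real K + 2"
      proof -
        have "real (Suc k) * 1 \<le> real n * (real K + 1)" using k(1) by (intro mult_mono) auto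
        then have "real (Suc k) \<le> real n * (real K + 1)" by (simp only: mult_1_right)
        also have "\<dots> \<le> real n * (real K + 1) + 3 * real K + 2" by simp
        finally show ?thesis .
      qed
      then have "real (Suc k) \<in> fractions Z"
        using bound(2) Z by (intro fractions_Ints) auto
      then show "wp Z 4 (''k'' ::= $''k'' \<oplus> Num 1) (?I (Suc k)) s''"
        using Q by (intro wp_straight_line[OF Z]) (simp_all add: add.commute)
    qed simp
    from wp_Seq[OF this] show ?thesis by (rule wp_time) simp
  qed
  have "wp Z (Suc (bops ?t) + n * (Suc (bops ?t) + (130 + J * (620 + 80 * K)))) (While ?t ?body) (?I n) s"
  proof (rule wp_For[where I = ?I, OF Z])
    show "?I 0 s" using s N by (simp add: good_def H_def \<kappa>_def)
    fix i and s' :: state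
    assume I: "?I i s'" and fr: "\<And>x. x \<notin> stores ?body \<Longrightarrow> s' x = s x"
    have fr': "frame s'"
      unfolding frame_def
      by (intro conjI; rule fr; simp add: prefix_sums_def windows_def normalize_def)
    show "bval ?t s' \<longleftrightarrow> i < n" if "i \<le> n" using fr' I s that by (auto simp: frame_def)
    show "wp Z (130 + J * (620 + 80 * K)) ?body (?I (Suc i)) s'" if "i < n"
      by (rule step[OF that _ fr']) (rule I)
  qed simp
  then show ?thesis unfolding rounds_def
  proof (rule wp_mono)
    fix s' :: state assume "?I n s'"
    then have g: "good n (s' ''M'') (s' ''E'')" by simp
    have "\<bar>s' ''E'' J\<bar> \<le> real n * (real K + 1)" using g J by (simp add: good_def)
    then have "\<bar>s' ''E'' J\<bar> \<le> Z" using bound(2) of_nat_0_le_iff[of K, where 'a = real] by linarith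
    moreover have "real N \<le> s' ''M'' J" using g J by (simp add: good_def)
    then have "0 \<le> s' ''M'' J" using of_nat_0_le_iff[of N, where 'a = real] by linarith
    ultimately show "s' ''M'' J \<in> \<int> \<and> 0 \<le> s' ''M'' J \<and> s' ''M'' J \<le> 2 * real N \<and> s' ''E'' J \<in> \<int> \<and> \<bar>s' ''E'' J\<bar> \<le> Z \<and>
      real N * H n J \<le> s' ''M'' J * 2 powr s' ''E'' J \<and>
      s' ''M'' J * 2 powr s' ''E'' J \<le> (1 + 1 / real N) ^ (4 * n) * (real N * H n J)"
      using g J by (simp add: good_def \<kappa>_def)
  qed (simp add: algebra_simps)
qed

section \<open>Degenerate capacities, the error budget and the whole program\<close>

lemma cvol_at_zero:
  assumes "\<And>i. 0 \<le> A i" "i < k" "0 < A i"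
  shows "cvol (\<lambda>u. u) A k 0 = 0"
  using assms(2)
proof (induction k)
  case (Suc k)
  let ?f = "\<lambda>x. cvol (\<lambda>u. u) A k (0 - A k * x)"
  \<comment> \<open>A positive last weight makes the capacity negative except at
    \<open>x = 0\<close>, a null set; if the last weight is 0, the positive one is among the earlier
    ones.\<close>
  have "(?f has_integral 0) {0..1}"
  proof (rule has_integral_spike_finite[OF _ _ has_integral_0])
    show "finite {0::real}" by simp
    fix x :: real assume x: "x \<in> {0..1} - {0}"
    show "?f x = 0"
    proof (cases "A k = 0")
      case True
      then have "i \<noteq> k" using assms(3) by auto
      with Suc True show ?thesis by simp
    next
      case False
      then have "0 < A k * x" using assms(1)[of k] x by simp
      then show ?thesis by (intro cvol_neg assms) auto
    qed
  qed
  then show ?case by (simp add: integral_unique)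
qed simp

lemma cvol_zero_weights: "(\<And>i. i < k \<Longrightarrow> A i = 0) \<Longrightarrow> 0 \<le> t \<Longrightarrow> cvol (\<lambda>u. u) A k t = 1"
  by (induction k) simp_all

text \<open>The origin of 16: the power is at most \<open>exp (8 n\<^sup>2 / N) = exp x\<close> with
  \<open>x = 1 / (2 m)\<close>, and \<open>exp x \<le> 1 + x + x\<^sup>2 \<le> 1 + 2 x\<close>. The
  exponent \<open>8 n\<^sup>2\<close> leaves room for \<open>4 n + 2 n (n + 1)\<close>.\<close>

lemma power_le_Suc_eps:
  assumes n: "n \<ge> 1" and m: "m \<ge> (1::nat)" and N: "N = 16 * n ^ 2 * m" and k: "k \<le> 8 * n ^ 2"
  shows "(1 + 1 / real N) ^ k \<le> 1 + 1 / real m"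
proof -
  have N0: "real N > 0" using n m N by simp
  have "(1 + 1 / real N) ^ k \<le> (1 + 1 / real N) ^ (8 * n ^ 2)"
    using k by (intro power_increasing) auto
  also have "\<dots> \<le> exp (1 / real N) ^ (8 * n ^ 2)"
    by (intro power_mono exp_ge_add_one_self) simp
  also have "\<dots> = exp (real (8 * n ^ 2) * (1 / real N))" by (simp only: exp_of_nat_mult)
  also have "real (8 * n ^ 2) * (1 / real N) = 1 / (2 * real m)"
    using n m by (simp add: N field_simps)
  also have "exp (1 / (2 * real m)) \<le> 1 + 1 / (2 * real m) + (1 / (2 * real m)) ^ 2"
    using m by (intro exp_bound) auto
  also have "\<dots> \<le> 1 + 1 / real m"
  proof -
    have "(1 / (2 * real m)) ^ 2 \<le> 1 / (2 * real m) * 1"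
      unfolding power2_eq_square using m by (intro mult_left_mono) auto
    moreover have "1 / real m = 1 / (2 * real m) + 1 / (2 * real m)" by simp
    ultimately show ?thesis by linarith
  qed
  finally show ?thesis .
qed

lemma knapsack_volume_wp:
  fixes a :: "nat \<Rightarrow> int" and b :: int and n N m J K i0 :: nat and \<epsilon> Z :: real
  defines "A \<equiv> \<lambda>i. N * nat \<bar>a i\<bar>" and "B \<equiv> real N * (of_int b + (\<Sum>i<n. max 0 (- of_int (a i))))"
  assumes n: "n \<ge> 1" and \<epsilon>: "\<epsilon> > 0"
    and i0: "i0 = (LEAST i. 1 / 2 ^ i \<le> \<epsilon>)" and m: "m = 2 ^ i0" and N: "N = 16 * n ^ 2 * m"
    and J: "J = (LEAST j. B \<le> real (grid N j))"
    and K: "K = (LEAST k. (2 * real N + 2) * real (grid N J) + (\<Sum>i<n. real (A i)) \<le> 2 ^ k)"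
    and Z: "16 \<le> Z" "2 ^ i0 \<le> Z" "real N * (\<bar>of_int b\<bar> + (\<Sum>i<n. \<bar>of_int (a i)\<bar>)) \<le> Z" "2 * real N \<le> Z"
      "real (grid N J) \<le> Z" "2 ^ (6 * K) \<le> Z" "real n * (real K + 1) + 3 * real K + 2 \<le> Z" "real J + 1 \<le> Z"
  shows "wp Z (20 * (i0 + 1) + 60 * (n + 1) + 50 * J + 40 * K + n * (150 + J * (650 + 80 * K)) + 140) knapsack_volume
    (\<lambda>s. vol n (knapsack_polytope n a b) \<le> output_value s \<and>
      output_value s \<le> (1 + \<epsilon>) * vol n (knapsack_polytope n a b)) (input_state n a b \<epsilon>)"
proof -
  let ?V = "vol n (knapsack_polytope n a b)"
  let ?Q = "\<lambda>s. ?V \<le> output_value s \<and> output_value s \<le> (1 + \<epsilon>) * ?V"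
  let ?cv = "cvol (\<lambda>u. u) (\<lambda>i. real (A i)) n"
  have m1: "m \<ge> 1" unfolding m by simp
  have N0: "N > 0" using n m1 N by simp
  have A_real: "real (A i) = real N * \<bar>of_int (a i)\<bar>" for i by (simp add: A_def)
  note ex = ex_inverse_power_le[OF \<epsilon>]
  have m_eps: "1 / real m \<le> \<epsilon>" using LeastI_ex[OF ex] by (simp add: m i0)
  have V: "?V = ?cv B"
  proof -
    have "?V = cvol (\<lambda>u. u) (\<lambda>i. \<bar>real_of_int (a i)\<bar>) n (of_int b + (\<Sum>i<n. max 0 (- of_int (a i))))"
      unfolding vol_knapsack_polytope by (rule cvol_flip[symmetric])
    also have "\<dots> = ?cv B" unfolding B_def A_real using N0 by (intro cvol_scale[symmetric]) simp
    finally show ?thesis .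
  qed
  have V0: "0 \<le> ?cv t" for t by (rule cvol_nonneg) simp
  define q where "q = (\<Sum>i<n. real (A i))"
  have q0: "0 \<le> q" unfolding q_def by (intro sum_nonneg) auto
  have one: "1 \<in> fractions Z" using Z by (intro fractions_Ints) auto
  \<comment> \<open>The state after \<open>reduce\<close>, including the zero cells from which the
    later loops start.\<close>
  define R where "R s \<longleftrightarrow> s ''N'' 0 = real N \<and> (\<forall>i<n. s ''A'' i = real (A i)) \<and> s ''B'' 0 = B \<and> s ''q'' 0 = q \<and>
    s ''n'' 0 = real n \<and> (\<forall>x\<in>{''T'', ''J'', ''h'', ''K'', ''k'', ''G'', ''E'', ''Z''}. \<forall>i. s x i = 0)" for s :: state
  let ?small = "If (And (Leq (Num 0) ($''B'')) (Leq ($''q'') (Num 0))) (''Z'' ::= Num 1) Skip"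
  let ?out = "''Z'' ::= Read ''M'' ($''J'') \<oslash> $''N'';; Store ''Z'' (Num 1) (Read ''E'' ($''J''))"
  let ?main = "make_grid;; make_powers;; init_values;; rounds;; ?out"
  have small: "wp Z 20 ?small ?Q s" if R: "R s" and B: "B \<le> 0" for s
  proof (rule wp_straight_line[OF Z(1)])
    have s: "s ''B'' 0 = B" "s ''q'' 0 = q" "s ''Z'' 0 = 0" "s ''Z'' 1 = 0" using R by (auto simp: R_def)
    show "vc Z ?small ?Q s"
    proof (cases "0 \<le> B \<and> q \<le> 0")
      case True
      then have "B = 0" "q = 0" using B q0 by auto
      then have "A i = 0" if "i < n" for i using that by (simp add: q_def sum_nonneg_eq_0_iff)
      then have "?V = 1" unfolding V \<open>B = 0\<close> by (intro cvol_zero_weights) auto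
      then show ?thesis using True s one \<epsilon> by (simp add: output_value_def)
    next
      case False
      have "?V = 0"
      proof (cases "B = 0")
        case True
        with False have "0 < q" by simp
        then obtain i where "i < n" "A i \<noteq> 0" unfolding q_def by (metis lessThan_iff less_irrefl of_nat_0 sum.neutral)
        then show ?thesis unfolding V True by (intro cvol_at_zero[of _ i]) auto
      next
        case False
        with B show ?thesis unfolding V by (intro cvol_neg) auto
      qed
      then show ?thesis using False s by (simp add: output_value_def)
    qed
  qed simp_all
  have main: "wp Z (50 * J + 40 * K + n * (150 + J * (650 + 80 * K)) + 100) ?main ?Q s" if R: "R s" and B: "B > 0" for s
  proof -
    \<comment> \<open>Integrality enters here: a positive capacity is a positive integer multiple of
      \<open>N\<close>.\<close>
    have B_N: "real N \<le> B"
    proof -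
      define c where "c = b + (\<Sum>i<n. max 0 (- a i))"
      have Bc: "B = real N * of_int c" unfolding B_def c_def by (simp add: of_int_max)
      have "0 < real_of_int c" using B N0 unfolding Bc by (simp add: zero_less_mult_iff)
      then have "1 \<le> real_of_int c" by simp
      then show ?thesis unfolding Bc using mult_left_mono[of 1 "real_of_int c" "real N"] by simp
    qed
    have BJ: "B \<le> real (grid N J)" unfolding J by (rule LeastI_ex[OF ex_grid_ge])
    have J0: "J > 0" using BJ B by (cases J) auto
    then obtain J' where J': "J = Suc J'" by (cases J) auto
    \<comment> \<open>The previous grid point lies below \<open>B\<close>, so starting from the grid
      point \<open>J\<close> instead of \<open>B\<close> costs one more rounding.\<close>
    have "real (grid N J') < B" using not_less_Least[of J' "\<lambda>j. B \<le> real (grid N j)"] J J' by (simp add: not_le)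
    then have "(1 + 1 / real N) * real (grid N J') + 1 \<le> (1 + 1 / real N) * B + 1"
      by (intro add_right_mono mult_left_mono) auto
    then have TB: "real (grid N J) \<le> (1 + 1 / real N) * B + 1" using grid_Suc_le[OF N0, of J'] J' by simp
    let ?X = "(2 * real N + 2) * real (grid N J) + q"
    have exK: "\<exists>k. ?X \<le> 2 ^ k" using real_arch_pow[of 2 ?X] by (auto intro: less_imp_le)
    have K': "K = (LEAST k. ?X \<le> 2 ^ k)" unfolding q_def by (rule K)
    have XK: "?X \<le> 2 ^ K" unfolding K' by (rule LeastI_ex[OF exK])
    have "0 \<le> (2 * real N + 2) * real (grid N J)" by simp
    then have K1: "(2 * real N + 2) * real (grid N J) \<le> 2 ^ K" "q \<le> 2 ^ K" using XK q0 by linarith+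
    have K2: "real (A i) \<le> 2 ^ K" if "i < n" for i
    proof -
      have "real (A i) \<le> q" unfolding q_def by (rule member_le_sum) (use that in auto)
      with K1(2) show ?thesis by linarith
    qed
    have "(2::real) ^ K \<le> 2 ^ (6 * K)" by (intro power_increasing) auto
    then have KZ: "2 ^ K \<le> Z" using Z(6) by linarith
    have NZ: "real N \<le> Z" using Z(4) by simp
    have n2: "n \<le> n ^ 2" using n by (simp add: power2_eq_square)
    have "(1 + 1 / real N) ^ (4 * n) \<le> 1 + 1 / real m"
      using n2 by (intro power_le_Suc_eps[OF n m1 N]) simp
    also have "\<dots> \<le> 2" using m1 by simp
    finally have \<kappa>: "(1 + 1 / real N) ^ (4 * n) \<le> 2" .
    let ?H = "cvol (grid_up N) (\<lambda>i. real (A i)) n (real (grid N J))"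
    define good where "good M E \<longleftrightarrow> M \<in> \<int> \<and> 0 \<le> M \<and> M \<le> 2 * real N \<and> E \<in> \<int> \<and> \<bar>E\<bar> \<le> Z \<and>
      real N * ?H \<le> M * 2 powr E \<and> M * 2 powr E \<le> (1 + 1 / real N) ^ (4 * n) * (real N * ?H)" for M E :: real
    let ?l = "1 + 1 / real N"
    have out: "wp Z 10 ?out ?Q s'" if "s' ''J'' 0 = real J" "s' ''N'' 0 = real N" "good (s' ''M'' J) (s' ''E'' J)" for s' :: state
    proof (rule wp_straight_line[OF Z(1)])
      define M E where "M = s' ''M'' J" and "E = s' ''E'' J"
      have g: "M \<in> \<int>" "0 \<le> M" "M \<le> 2 * real N" "E \<in> \<int>" "\<bar>E\<bar> \<le> Z"
        "real N * ?H \<le> M * 2 powr E" "M * 2 powr E \<le> ?l ^ (4 * n) * (real N * ?H)"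
        using that(3) by (auto simp: good_def M_def E_def)
      obtain M' :: int where M': "M = of_int M'" using g(1) by (auto elim: Ints_cases)
      have rb: "M / real N \<in> fractions Z"
        using g(2,3) N0 NZ Z(4) M' by (intro fractionsI[of _ M' "int N"]) auto
      have rbE: "E \<in> fractions Z" using g(4,5) Z(1) by (intro fractions_Ints) auto
      have "(2::real) powi \<lfloor>E\<rfloor> = 2 powr of_int \<lfloor>E\<rfloor>" by (simp add: powr_real_of_int')
      then have val: "(2::real) powi \<lfloor>E\<rfloor> = 2 powr E" using g(4) by simp
      \<comment> \<open>The lower bound is exact: \<open>grid_up\<close> and the choice of
        \<open>J\<close> only raise capacities.\<close>
      have "real N * ?V \<le> real N * ?H"
        unfolding V using BJ
        by (intro mult_left_mono order.trans[OF cvol_mono cvol_le_cvol]) (auto simp: grid_up_mono grid_up_ge)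
      then have "real N * ?V \<le> M * 2 powr E" using g(6) by linarith
      then have lo: "?V \<le> M * 2 powr E / real N" using N0 by (simp add: field_simps)
      have "M * 2 powr E / real N \<le> ?l ^ (4 * n) * ?H"
        using g(7) N0 by (simp add: field_simps)
      also have "\<dots> \<le> ?l ^ (4 * n) * (?l ^ (2 * n * (n + 1)) * ?V)"
        unfolding V using TB B_N by (intro mult_left_mono cvol_grid_upper[OF N0]) auto
      also have "\<dots> = ?l ^ (4 * n + 2 * n * (n + 1)) * ?V"
        by (simp only: power_add mult.assoc)
      also have "\<dots> \<le> (1 + 1 / real m) * ?V"
      proof (intro mult_right_mono power_le_Suc_eps[OF n m1 N])
        have "2 * n * (n + 1) = 2 * n ^ 2 + 2 * n" by (simp add: power2_eq_square)
        then show "4 * n + 2 * n * (n + 1) \<le> 8 * n ^ 2" using n2 by linarith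
      qed (simp add: V V0)
      also have "\<dots> \<le> (1 + \<epsilon>) * ?V" using m_eps by (intro mult_right_mono) (auto simp: V V0)
      finally have hi: "M * 2 powr E / real N \<le> (1 + \<epsilon>) * ?V" .
      have "output_value (s'(''Z'' := f)) = f 0 * 2 powi \<lfloor>f 1\<rfloor>" for f
        by (simp add: output_value_def)
      then show "vc Z ?out ?Q s'"
        using rb rbE that(1,2) lo hi val by (simp add: M_def E_def)
    qed simp_all
    have 4: "wp Z (10 + n * (150 + J * (650 + 80 * K)) + 10) (rounds;; ?out) ?Q s4"
      if "R s" and fr: "\<And>x. x \<in> {''n'', ''N'', ''A'', ''k'', ''G'', ''E''} \<Longrightarrow> s4 x = s x"
        and s4: "s4 ''J'' 0 = real J" "\<And>j. j \<le> J \<Longrightarrow> s4 ''T'' j = real (grid N j)" "s4 ''K'' 0 = real K"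
          "\<And>i. s4 ''h'' i = (if i \<le> K then 1 / 2 ^ i else 0)" "\<And>j. 1 \<le> j \<and> j \<le> J \<Longrightarrow> s4 ''M'' j = real N"
      for s4 :: state
    proof (rule wp_Seq, rule wp_mono[OF rounds_wp[OF Z(1) _ _ s4(1,2,3) _ _ _ _ _ s4(4) N0 J0 K1(1) K2 \<kappa> Z(6,7,8)]])
      fix s5 :: state
      assume fr5: "\<And>x. x \<notin> stores rounds \<Longrightarrow> s5 x = s4 x"
        and "s5 ''M'' J \<in> \<int> \<and> 0 \<le> s5 ''M'' J \<and> s5 ''M'' J \<le> 2 * real N \<and> s5 ''E'' J \<in> \<int> \<and> \<bar>s5 ''E'' J\<bar> \<le> Z \<and>
          real N * ?H \<le> s5 ''M'' J * 2 powr s5 ''E'' J \<and>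
          s5 ''M'' J * 2 powr s5 ''E'' J \<le> ?l ^ (4 * n) * (real N * ?H)"
      then have g: "good (s5 ''M'' J) (s5 ''E'' J)" unfolding good_def by blast
      have "s5 ''J'' = s4 ''J''" "s5 ''N'' = s4 ''N''"
        by (rule fr5; simp add: rounds_def prefix_sums_def windows_def normalize_def)+
      then show "wp Z 10 ?out ?Q s5" using g s4(1) fr[of "''N''"] R by (intro out) (auto simp: R_def)
    qed (use R fr s4(5) in \<open>auto simp: R_def\<close>)
    let ?t4 = "10 + n * (150 + J * (650 + 80 * K)) + 10"
    have 3: "wp Z ((20 + 20 * J) + ?t4) (init_values;; rounds;; ?out) ?Q s3"
      if fr: "\<And>x. x \<in> {''n'', ''N'', ''A'', ''k'', ''G'', ''E''} \<Longrightarrow> s3 x = s x"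
        and s3: "s3 ''J'' 0 = real J" "\<And>j. j \<le> J \<Longrightarrow> s3 ''T'' j = real (grid N j)" "s3 ''K'' 0 = real K"
          "\<And>i. s3 ''h'' i = (if i \<le> K then 1 / 2 ^ i else 0)"
      for s3 :: state
    proof (rule wp_Seq, rule wp_mono[OF init_values_wp[where s = s3 and N = N and J = J, OF Z(1) _ s3(1) NZ Z(8)]])
      show "s3 ''N'' 0 = real N" using fr[of "''N''"] R by (simp add: R_def)
      fix s4 :: state
      assume fr4: "\<And>x. x \<notin> stores init_values \<Longrightarrow> s4 x = s3 x"
        and M: "\<forall>j. 1 \<le> j \<and> j \<le> J \<longrightarrow> s4 ''M'' j = real N"
      have eq: "s4 x = s3 x" if "x \<notin> {''M'', ''j''}" for x
        by (rule fr4) (use that in \<open>auto simp: init_values_def\<close>)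
      show "wp Z ?t4 (rounds;; ?out) ?Q s4"
      proof (rule 4[OF R])
        fix x assume "x \<in> {''n'', ''N'', ''A'', ''k'', ''G'', ''E''}"
        then show "s4 x = s x" using eq[of x] fr[of x] by fastforce
      qed (use M s3 eq[of "''J''"] eq[of "''T''"] eq[of "''K''"] eq[of "''h''"] in simp_all)
    qed simp
    let ?t3 = "(20 + 20 * J) + ?t4"
    have 2: "wp Z ((30 + 40 * K) + ?t3) (make_powers;; init_values;; rounds;; ?out) ?Q s2"
      if fr: "\<And>x. x \<notin> {''T'', ''J''} \<Longrightarrow> s2 x = s x"
        and s2: "s2 ''J'' 0 = real J" "\<forall>j\<le>J. s2 ''T'' j = real (grid N j)" for s2 :: state
    proof (rule wp_Seq, rule wp_mono[OF make_powers_wp[where s = s2 and N = N and J = J and q = q, OF Z(1) _ s2(1) _ _ _ _ refl K' KZ]])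
      show "s2 ''N'' 0 = real N" "s2 ''q'' 0 = q" "s2 ''K'' 0 = 0" "\<And>i. s2 ''h'' i = 0" "s2 ''T'' J = real (grid N J)"
        using fr[of "''N''"] fr[of "''q''"] fr[of "''K''"] fr[of "''h''"] R s2(2) by (auto simp: R_def)
      fix s3 :: state
      assume fr3: "\<And>x. x \<notin> stores make_powers \<Longrightarrow> s3 x = s2 x"
        and M: "s3 ''K'' 0 = real K \<and> (\<forall>i. s3 ''h'' i = (if i \<le> K then 1 / 2 ^ i else 0))"
      have eq: "s3 x = s2 x" if "x \<notin> {''h'', ''K''}" for x
        by (rule fr3) (use that in \<open>auto simp: make_powers_def\<close>)
      show "wp Z ?t3 (init_values;; rounds;; ?out) ?Q s3"
      proof (rule 3)
        fix x assume "x \<in> {''n'', ''N'', ''A'', ''k'', ''G'', ''E''}"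
        then show "s3 x = s x" using eq[of x] fr[of x] by fastforce
      qed (use M s2 eq[of "''J''"] eq[of "''T''"] in simp_all)
    qed simp
    let ?t2 = "(30 + 40 * K) + ?t3"
    have "wp Z ((10 + 30 * J) + ?t2) ?main ?Q s"
    proof (rule wp_Seq, rule wp_mono[OF make_grid_wp[where s = s and N = N and J = J and B = B, OF Z(1) _ _ _ _ N0 J Z(5)]])
      fix s2 :: state
      assume fr2: "\<And>x. x \<notin> stores make_grid \<Longrightarrow> s2 x = s x"
        and M: "s2 ''J'' 0 = real J \<and> (\<forall>i\<le>J. s2 ''T'' i = real (grid N i))"
      have eq: "s2 x = s x" if "x \<notin> {''T'', ''J''}" for x
        by (rule fr2) (use that in \<open>auto simp: make_grid_def\<close>)
      show "wp Z ?t2 (make_powers;; init_values;; rounds;; ?out) ?Q s2"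
        by (rule 2, rule eq) (use M in simp_all)
    qed (use R in \<open>auto simp: R_def\<close>)
    then show ?thesis by (rule wp_time) simp
  qed
  let ?s0 = "input_state n a b \<epsilon>"
  let ?rest = "If (Leq ($''B'') (Num 0)) ?small ?main"
  let ?t1 = "50 * J + 40 * K + n * (150 + J * (650 + 80 * K)) + 100"
  have rest: "wp Z (Suc (2 + (20 + ?t1))) ?rest ?Q s" if "R s" for s
  proof (rule wp_time[OF wp_If[OF Z(1), where ?t1.0 = 20 and ?t2.0 = ?t1]])
    assume "bval (Leq ($''B'') (Num 0)) s"
    then show "wp Z 20 ?small ?Q s" using that by (intro small) (auto simp: R_def)
  next
    assume "\<not> bval (Leq ($''B'') (Num 0)) s"
    then show "wp Z ?t1 ?main ?Q s" using that by (intro main) (auto simp: R_def)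
  qed simp_all
  have red: "wp Z (60 * (n + 1) + Suc (2 + (20 + ?t1))) (reduce;; ?rest) ?Q s1"
    if m': "s1 ''m'' 0 = 2 ^ i0" and fr: "\<And>x. x \<noteq> ''m'' \<Longrightarrow> s1 x = ?s0 x" for s1 :: state
  proof (rule wp_Seq, rule wp_mono[OF reduce_wp[where s = s1 and N = N and m = m and a = a and b = b and n = n, OF Z(1) n _ _ _ _ _ _ N N0 Z(3)]])
    show "s1 ''n'' 0 = real n" "s1 ''m'' 0 = real m" "s1 ''b'' 0 = of_int b" "s1 ''i'' 0 = 0" "s1 ''q'' 0 = 0"
      "\<And>i. i < n \<Longrightarrow> s1 ''a'' i = of_int (a i)"
      using m' by (auto simp: fr input_state_def m)
    show "real N \<le> Z" using Z(4) by simp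
    fix s2 :: state
    assume fr2: "\<And>x. x \<notin> stores reduce \<Longrightarrow> s2 x = s1 x"
      and *: "s2 ''N'' 0 = real N \<and> (\<forall>i<n. s2 ''A'' i = real N * \<bar>of_int (a i)\<bar>) \<and>
        s2 ''B'' 0 = real N * (of_int b + (\<Sum>i<n. max 0 (- of_int (a i)))) \<and>
        s2 ''q'' 0 = (\<Sum>i<n. real N * \<bar>of_int (a i)\<bar>)"
    have st: "stores reduce = {''N'', ''B'', ''A'', ''q'', ''i''}" by (auto simp: reduce_def)
    have "s2 x i = 0" if "x \<in> {''T'', ''J'', ''h'', ''K'', ''k'', ''G'', ''E'', ''Z''}" for x i
    proof -
      have "s2 x = s1 x" using that by (intro fr2) (auto simp: st)
      moreover have "s1 x = ?s0 x" using that by (intro fr) auto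
      ultimately show ?thesis using that by (auto simp: input_state_def)
    qed
    moreover have "s2 ''n'' 0 = real n"
      using fr2[of "''n''"] fr[of "''n''"] by (simp add: st input_state_def)
    ultimately have "R s2" unfolding R_def using * by (simp add: A_real B_def q_def)
    then show "wp Z (Suc (2 + (20 + ?t1))) ?rest ?Q s2" by (rule rest)
  qed simp
  have "wp Z (20 * (i0 + 1) + (60 * (n + 1) + Suc (2 + (20 + ?t1)))) (find_scale;; reduce;; ?rest) ?Q ?s0"
  proof (rule wp_Seq, rule wp_mono[OF find_scale_wp[where s = "?s0", OF Z(1) _ \<epsilon> i0 Z(2)]])
    show "?s0 ''eps'' 0 = \<epsilon>" by (simp add: input_state_def)
    fix s1 :: state
    assume fr1: "\<And>x. x \<notin> stores find_scale \<Longrightarrow> s1 x = ?s0 x" and m': "s1 ''m'' 0 = 2 ^ i0"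
    show "wp Z (60 * (n + 1) + Suc (2 + (20 + ?t1))) (reduce;; ?rest) ?Q s1"
      by (rule red, rule m', rule fr1) (simp add: find_scale_def)
  qed simp
  then show ?thesis unfolding knapsack_volume_def by (rule wp_time) simp
qed

section \<open>Resource bounds\<close>

lemma abs_le_enc_len: "real_of_int \<bar>p\<bar> \<le> 2 ^ enc_len (of_int p)"
proof -
  have q: "quotient_of (of_int p) = (p, 1)" by simp
  have "log 2 (of_int \<bar>p\<bar> + 1) \<le> real (nat \<lceil>log 2 (of_int \<bar>p\<bar> + 1)\<rceil>)"
    by (rule real_nat_ceiling_ge)
  also have "\<dots> \<le> real (enc_len (of_int p))" unfolding enc_len_def q by simp
  finally have "real_of_int \<bar>p\<bar> + 1 \<le> 2 powr real (enc_len (of_int p))"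
    by (simp add: log_le_iff)
  then show ?thesis by (simp add: powr_realpow)
qed

text \<open>The denominator alone contributes a bit. This keeps \<open>\<Lambda> \<ge> 1\<close>
  even for \<open>n = 1\<close> and \<open>\<delta> = 1\<close>, so additive constants can be
  absorbed.\<close>

lemma enc_len_pos: "1 \<le> enc_len r"
proof -
  obtain p q where pq: "quotient_of r = (p, q)" by fastforce
  have "1 \<le> real_of_int q" using quotient_of_denom_pos[OF pq] by simp
  then have "log 2 2 \<le> log 2 (real_of_int q + 1)" by (subst log_le_cancel_iff) auto
  then have "0 < log 2 (real_of_int q + 1)" by simp
  then have "1 \<le> nat \<lceil>log 2 (real_of_int q + 1)\<rceil>" by linarith
  then show ?thesis unfolding enc_len_def pq by simp
qed

lemma max_enc_len_bounds:
  shows "1 \<le> max_enc_len n a b" "real_of_int \<bar>b\<bar> \<le> 2 ^ max_enc_len n a b"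
    "\<And>i. i < n \<Longrightarrow> real_of_int \<bar>a i\<bar> \<le> 2 ^ max_enc_len n a b"
proof -
  let ?S = "insert (enc_len (of_int b)) ((\<lambda>i. enc_len (of_int (a i))) ` {..<n})"
  have fin: "finite ?S" by simp
  have b: "enc_len (of_int b) \<le> max_enc_len n a b"
    unfolding max_enc_len_def by (rule Max_ge[OF fin]) simp
  then show "1 \<le> max_enc_len n a b" using enc_len_pos[of "of_int b"] by linarith
  have pw: "real_of_int \<bar>p\<bar> \<le> 2 ^ max_enc_len n a b" if "enc_len (of_int p) \<le> max_enc_len n a b" for p
  proof -
    have "(2::real) ^ enc_len (of_int p) \<le> 2 ^ max_enc_len n a b" using that by (intro power_increasing) auto
    then show ?thesis using abs_le_enc_len[of p] by linarith
  qed
  show "real_of_int \<bar>b\<bar> \<le> 2 ^ max_enc_len n a b" by (rule pw[OF b])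
  show "real_of_int \<bar>a i\<bar> \<le> 2 ^ max_enc_len n a b" if "i < n" for i
    by (rule pw) (unfold max_enc_len_def, rule Max_ge[OF fin], use that in auto)
qed

text \<open>Everything is measured in powers of
  \<open>Y = 2 powr \<Lambda> = (n / \<delta>) * 2 ^ L \<ge> 2\<close>, constants included. From
  \<open>N \<le> Y ^ 7\<close> follow \<open>Y ^ 9\<close> for the capacity, \<open>Y ^ 11\<close>
  for the last grid point, \<open>Y ^ 21\<close> for the quantity defining \<open>K\<close>, and
  \<open>2 ^ K \<le> Y ^ 22\<close>. The memory bound must cover \<open>2 ^ (6 K)\<close>, whence
  132.\<close>

lemma knapsack_parameter_bounds:
  fixes a :: "nat \<Rightarrow> int" and b :: int and n N m J K i0 :: nat and \<epsilon> :: real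
  defines "A \<equiv> \<lambda>i. N * nat \<bar>a i\<bar>" and "B \<equiv> real N * (of_int b + (\<Sum>i<n. max 0 (- of_int (a i))))"
    and "L \<equiv> max_enc_len n a b" and "\<delta> \<equiv> min 1 \<epsilon>"
  defines "\<Lambda> \<equiv> log 2 (real n / \<delta>) + real L"
  assumes n: "n \<ge> 1" and \<epsilon>: "\<epsilon> > 0"
    and i0: "i0 = (LEAST i. 1 / 2 ^ i \<le> \<epsilon>)" and m: "m = 2 ^ i0" and N: "N = 16 * n ^ 2 * m"
    and J: "J = (LEAST j. B \<le> real (grid N j))"
    and K: "K = (LEAST k. (2 * real N + 2) * real (grid N J) + (\<Sum>i<n. real (A i)) \<le> 2 ^ k)"
    and Z: "Z = (2 powr \<Lambda>) ^ 132"
  shows "16 \<le> Z" "2 ^ i0 \<le> Z" "real N * (\<bar>of_int b\<bar> + (\<Sum>i<n. \<bar>of_int (a i)\<bar>)) \<le> Z" "2 * real N \<le> Z"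
      "real (grid N J) \<le> Z" "2 ^ (6 * K) \<le> Z" "real n * (real K + 1) + 3 * real K + 2 \<le> Z" "real J + 1 \<le> Z"
    and "1 \<le> \<Lambda>" "real i0 \<le> \<Lambda>" "real K \<le> 22 * \<Lambda>" "real J \<le> 11 * \<Lambda> * real N" "real N \<le> 32 * real n ^ 2 / \<delta>"
proof -
  let ?S = "\<bar>of_int b\<bar> + (\<Sum>i<n. \<bar>real_of_int (a i)\<bar>)" and ?X = "(2 * real N + 2) * real (grid N J)"
  define Y where "Y = 2 powr \<Lambda>"
  have \<delta>: "0 < \<delta>" "\<delta> \<le> 1" using \<epsilon> by (auto simp: \<delta>_def)
  have L: "1 \<le> L" "real_of_int \<bar>b\<bar> \<le> 2 ^ L" "\<And>i. i < n \<Longrightarrow> real_of_int \<bar>a i\<bar> \<le> 2 ^ L"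
    unfolding L_def by (rule max_enc_len_bounds; assumption)+
  have nd: "real n \<le> real n / \<delta>" using \<delta> n by (simp add: field_simps mult_le_cancel_left1)
  have nd1: "1 \<le> real n / \<delta>" using nd n by linarith
  have "0 \<le> log 2 (real n / \<delta>)" using nd1 by simp
  then show \<Lambda>1: "1 \<le> \<Lambda>" using L(1) unfolding \<Lambda>_def by linarith
  have Y: "Y = (real n / \<delta>) * 2 ^ L"
    unfolding Y_def \<Lambda>_def powr_add using nd1 by (simp add: powr_realpow)
  have L2: "(2::real) \<le> 2 ^ L" using self_le_power[of 2 L] L(1) by simp
  have Y2: "2 * (real n / \<delta>) \<le> Y" unfolding Y using mult_left_mono[OF L2, of "real n / \<delta>"] nd1 by (simp add: mult.commute)
  have YL: "real n * 2 ^ L \<le> Y" unfolding Y using nd by (intro mult_right_mono) auto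
  have Y_2: "2 \<le> Y" using Y2 nd1 by linarith
  have nY: "real n \<le> Y" using Y2 nd nd1 by linarith
  have pY: "Y ^ i \<le> Y ^ j" if "i \<le> j" for i j using Y_2 that by (intro power_increasing) auto
  have c16: "16 \<le> Y ^ 4" using power_mono[OF Y_2, of 4] by simp
  have c4: "4 \<le> Y ^ 2" using power_mono[OF Y_2, of 2] by simp
  \<comment> \<open>By minimality of \<open>i0\<close>, already \<open>m / 2\<close> fails the test,
    so \<open>m / 2 \<le> 1 / \<delta>\<close>.\<close>
  have m_le: "real m \<le> 2 / \<delta>"
  proof (cases i0)
    case 0
    then show ?thesis using \<delta> by (simp add: m)
  next
    case (Suc i)
    then have "\<not> 1 / 2 ^ i \<le> \<epsilon>" using not_less_Least[of i "\<lambda>i. 1 / 2 ^ i \<le> \<epsilon>"] i0 by simp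
    moreover have "1 / 2 ^ i \<le> (1::real)" by simp
    ultimately have "\<delta> \<le> 1 / 2 ^ i" unfolding \<delta>_def by linarith
    then have "2 ^ i \<le> 1 / \<delta>" using \<delta> by (simp add: field_simps)
    then show ?thesis using Suc by (simp add: m)
  qed
  have "1 / \<delta> \<le> real n / \<delta>" using n \<delta> by (intro divide_right_mono) auto
  then have mY: "real m \<le> Y" using m_le Y2 by linarith
  have N_real: "real N = 16 * real n ^ 2 * real m" by (simp add: N)
  have m1: "1 \<le> real m" unfolding m by simp
  have N0: "N > 0" using n by (simp add: N m)
  have "real N \<le> 16 * real n ^ 2 * (2 / \<delta>)" unfolding N_real using m_le by (intro mult_left_mono) auto
  then show "real N \<le> 32 * real n ^ 2 / \<delta>" by simp
  let ?TJ = "real (grid N J)"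
  have NY: "real N \<le> Y ^ 7"
  proof -
    have "real N \<le> Y ^ 4 * Y ^ 2 * Y" unfolding N_real
      using c16 nY mY Y_2 by (intro mult_mono power_mono) auto
    also have "\<dots> = Y ^ 7" by (simp add: power_add[symmetric] flip: power_Suc2)
    finally show ?thesis .
  qed
  have S_le: "?S \<le> Y ^ 2"
  proof -
    have "(\<Sum>i<n. \<bar>real_of_int (a i)\<bar>) \<le> real n * 2 ^ L"
      using sum_bounded_above[of "{..<n}" "\<lambda>i. \<bar>real_of_int (a i)\<bar>" "2 ^ L"] L(3) by simp
    moreover have "1 * 2 ^ L \<le> real n * (2::real) ^ L" using n by (intro mult_right_mono) auto
    ultimately have "?S \<le> 2 * Y"
      using L(2) YL by (simp only: of_int_abs)
    also have "\<dots> \<le> Y ^ 2" using Y_2 by (simp add: power2_eq_square)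
    finally show ?thesis .
  qed
  have NS: "real N * ?S \<le> Y ^ 9"
  proof -
    have "real N * ?S \<le> Y ^ 7 * Y ^ 2"
      using NY S_le Y_2 by (intro mult_mono add_nonneg_nonneg sum_nonneg) auto
    then show ?thesis by (simp add: power_add[symmetric])
  qed
  have BY: "B \<le> Y ^ 9"
  proof -
    have "of_int b + (\<Sum>i<n. max 0 (- real_of_int (a i))) \<le> ?S"
      by (intro add_mono sum_mono) auto
    then have "B \<le> real N * ?S"
      unfolding B_def by (intro mult_left_mono) auto
    with NS show ?thesis by linarith
  qed
  define q where "q = (\<Sum>i<n. real (A i))"
  have qY: "0 \<le> q" "q \<le> Y ^ 9"
  proof -
    have "q = real N * (\<Sum>i<n. \<bar>real_of_int (a i)\<bar>)" by (simp add: q_def A_def sum_distrib_left)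
    also have "\<dots> \<le> real N * ?S" by (intro mult_left_mono) auto
    finally show "q \<le> Y ^ 9" using NS by linarith
    show "0 \<le> q" unfolding q_def by (intro sum_nonneg) auto
  qed
  have TY: "?TJ \<le> Y ^ 11"
  proof (cases J)
    case 0
    then show ?thesis using Y_2 by simp
  next
    case (Suc j)
    then have "\<not> B \<le> real (grid N j)" using not_less_Least[of j "\<lambda>j. B \<le> real (grid N j)"] J by simp
    then have T: "real (grid N j) \<le> Y ^ 9" using BY by linarith
    have "(1 + 1 / real N) * real (grid N j) \<le> 2 * Y ^ 9" using T N0 by (intro mult_mono) auto
    then have "?TJ \<le> 2 * Y ^ 9 + 1" using grid_Suc_le[OF N0, of j] Suc by simp
    also have "\<dots> \<le> 4 * Y ^ 9" using one_le_power[of Y 9] Y_2 by linarith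
    also have "\<dots> \<le> Y ^ 2 * Y ^ 9" using c4 Y_2 by (intro mult_right_mono) auto
    finally show ?thesis by (simp add: power_add[symmetric])
  qed
  have XY: "?X + q \<le> Y ^ 21"
  proof -
    have "1 \<le> Y ^ 7" using Y_2 by (intro one_le_power) auto
    then have "2 * real N + 2 \<le> 4 * Y ^ 7" using NY by linarith
    also have "\<dots> \<le> Y ^ 2 * Y ^ 7" using c4 Y_2 by (intro mult_right_mono) auto
    also have "\<dots> = Y ^ 9" by (simp add: power_add[symmetric])
    finally have "?X \<le> Y ^ 9 * Y ^ 11"
      using TY Y_2 by (intro mult_mono) auto
    then have 1: "?X \<le> Y ^ 20" by (simp add: power_add[symmetric])
    have "Y ^ 9 \<le> Y ^ 20" by (rule pY) simp
    then have "?X + q \<le> 2 * Y ^ 20" using 1 qY by linarith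
    also have "\<dots> \<le> Y * Y ^ 20" using Y_2 by (intro mult_right_mono) auto
    finally show ?thesis by (simp flip: power_Suc)
  qed
  have KY: "2 ^ K \<le> Y ^ 22"
  proof (cases K)
    case 0
    then show ?thesis using one_le_power[of Y 22] Y_2 by simp
  next
    case (Suc k)
    then have "\<not> ?X + q \<le> 2 ^ k"
      using not_less_Least[of k "\<lambda>k. ?X + q \<le> 2 ^ k"] K by (simp add: q_def)
    then have "2 ^ k \<le> Y ^ 21" using XY by linarith
    then have "2 * 2 ^ k \<le> Y * Y ^ 21" using Y_2 by (intro mult_mono) auto
    then show ?thesis using Suc by (simp flip: power_Suc)
  qed
  have Z': "Z = Y ^ 132" by (simp add: Z Y_def)
  have up: "Y ^ i \<le> Z" if "i \<le> 132" for i unfolding Z' by (rule pY[OF that])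
  have c16Z: "16 \<le> Z" using c16 up[of 4] by linarith
  then show "16 \<le> Z" .
  show "2 ^ i0 \<le> Z" using mY up[of 1] by (simp add: m)
  show "real N * (\<bar>of_int b\<bar> + (\<Sum>i<n. \<bar>of_int (a i)\<bar>)) \<le> Z" using NS up[of 9] by linarith
  have "2 * real N \<le> Y * Y ^ 7" using NY Y_2 by (intro mult_mono) auto
  also have "\<dots> = Y ^ 8" by (simp flip: power_Suc)
  finally show "2 * real N \<le> Z" using up[of 8] by linarith
  show "?TJ \<le> Z" using TY up[of 11] by linarith
  have "(2::real) ^ (6 * K) = (2 ^ K) ^ 6" by (simp add: power_mult[symmetric] mult.commute)
  also have "\<dots> \<le> (Y ^ 22) ^ 6" using KY by (intro power_mono) auto
  also have "\<dots> = Z" by (simp add: Z' power_mult[symmetric])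
  finally show "2 ^ (6 * K) \<le> Z" .
  have "real K \<le> 2 ^ K" using of_nat_less_two_power[of K, where 'a = real] by linarith
  then have K_Y: "real K \<le> Y ^ 22" using KY by linarith
  show "real n * (real K + 1) + 3 * real K + 2 \<le> Z"
  proof -
    have 1: "1 \<le> Y ^ 22" using Y_2 by (intro one_le_power) auto
    have "real K + 1 \<le> 2 * Y ^ 22" using 1 K_Y by linarith
    then have "real n * (real K + 1) \<le> Y * (2 * Y ^ 22)" using nY Y_2 by (intro mult_mono) auto
    also have "\<dots> = 2 * Y ^ 23" by (simp flip: power_Suc)
    finally have 2: "real n * (real K + 1) \<le> 2 * Y ^ 23" .
    have "Y ^ 22 \<le> Y ^ 23" by (rule pY) simp
    then have "real n * (real K + 1) + 3 * real K + 2 \<le> 16 * Y ^ 23" using 1 2 K_Y by linarith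
    also have "\<dots> \<le> Y ^ 4 * Y ^ 23" using c16 Y_2 by (intro mult_right_mono) auto
    also have "\<dots> = Y ^ 27" by (simp add: power_add[symmetric])
    finally show ?thesis using up[of 27] by linarith
  qed
  have "real J \<le> ?TJ" using le_grid[of J N] by simp
  then have "real J \<le> Y ^ 11" using TY by linarith
  moreover have "1 \<le> Y ^ 11" using Y_2 by (intro one_le_power) auto
  ultimately have "real J + 1 \<le> 2 * Y ^ 11" by linarith
  also have "\<dots> \<le> Y * Y ^ 11" using Y_2 by (intro mult_right_mono) auto
  also have "\<dots> = Y ^ 12" by (simp flip: power_Suc)
  finally show "real J + 1 \<le> Z" using up[of 12] by linarith
  have Ypow: "Y ^ i = 2 powr (real i * \<Lambda>)" for i
    by (simp add: Y_def powr_power)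
  have le_powr: "real x \<le> y" if "2 ^ x \<le> 2 powr y" for x y
    using that by (simp add: powr_realpow[symmetric])
  show "real i0 \<le> \<Lambda>" using mY by (intro le_powr) (simp add: m Y_def)
  show "real K \<le> 22 * \<Lambda>" using KY unfolding Ypow by (intro le_powr) simp
  show "real J \<le> 11 * \<Lambda> * real N"
  proof -
    \<comment> \<open>The capacity is at most \<open>Y ^ 9 \<le> 2 ^ i\<close>, and the grid doubles
      every \<open>N\<close> steps.\<close>
    define i where "i = nat \<lceil>9 * \<Lambda>\<rceil>"
    have "9 * \<Lambda> \<le> real i" unfolding i_def by (rule real_nat_ceiling_ge)
    then have "2 powr (9 * \<Lambda>) \<le> 2 powr real i" by simp
    then have "B \<le> 2 ^ i" using BY unfolding Ypow by (simp add: powr_realpow)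
    then have "B \<le> real (grid N (Suc (i * N)))" using grid_ge_power2[OF N0, of i] by linarith
    then have "J \<le> Suc (i * N)" unfolding J by (rule Least_le)
    then have "real J \<le> real (Suc (i * N))" by (simp only: of_nat_le_iff)
    also have "\<dots> = 1 + real i * real N" by simp
    also have "\<dots> \<le> \<Lambda> * real N + (10 * \<Lambda>) * real N"
    proof (intro add_mono mult_right_mono)
      have "1 * 1 \<le> \<Lambda> * real N" using \<Lambda>1 N0 by (intro mult_mono) auto
      then show "1 \<le> \<Lambda> * real N" by simp
      have "real i = of_int \<lceil>9 * \<Lambda>\<rceil>" using \<Lambda>1 by (simp add: i_def)
      then show "real i \<le> 10 * \<Lambda>" using \<Lambda>1 by linarith
    qed simp
    finally show ?thesis by (simp add: algebra_simps)
  qed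
qed

lemma bounded_memory_input_state:
  assumes "1 \<le> Z" "real n \<le> Z" "\<bar>real_of_int b\<bar> \<le> Z" "\<And>i. i < n \<Longrightarrow> \<bar>real_of_int (a i)\<bar> \<le> Z"
  shows "bounded_memory Z (input_state n a b \<epsilon>)"
  unfolding bounded_memory_def input_state_def
  using assms by (auto intro!: fractions_Ints)

text \<open>All terms are multiples of \<open>t = n N \<Lambda>\<^sup>2\<close>, one
  \<open>\<Lambda>\<close> coming from the number of grid points and one from \<open>K\<close>. The
  main term is \<open>11 * 2410 * t\<close> with \<open>2410 = 650 + 80 * 22\<close>; the rest fits
  into 31000, and \<open>31000 * 32\<close> into the constant.\<close>

lemma knapsack_running_time:
  fixes n N J K i0 :: nat and \<Lambda> \<delta> :: real
  assumes n: "n \<ge> 1" and N: "N \<ge> 1" and \<Lambda>: "1 \<le> \<Lambda>" "real i0 \<le> \<Lambda>" "real K \<le> 22 * \<Lambda>" "real J \<le> 11 * \<Lambda> * real N"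
    and N_le: "real N \<le> 32 * real n ^ 2 / \<delta>" and \<delta>: "0 < \<delta>"
    and T: "T \<le> 20 * (i0 + 1) + 60 * (n + 1) + 50 * J + 40 * K + n * (150 + J * (650 + 80 * K)) + 140"
  shows "real T \<le> 1000000 * (real n ^ 3 / \<delta> * \<Lambda> ^ 4)"
proof -
  define t where "t = real n * real N * \<Lambda> ^ 2"
  have \<Lambda>2: "\<Lambda> \<le> \<Lambda> ^ 2" using \<Lambda>(1) by (simp add: power2_eq_square)
  have nN: "1 \<le> real n" "1 \<le> real N" using n N by simp_all
  have prod: "x * y * z \<le> t" if "0 \<le> x" "x \<le> real n" "0 \<le> y" "y \<le> real N" "0 \<le> z" "z \<le> \<Lambda> ^ 2" for x y z
    unfolding t_def using that by (intro mult_mono mult_nonneg_nonneg) auto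
  have t1: "1 \<le> t" using prod[of 1 1 1] nN \<Lambda> \<Lambda>2 by simp
  have t2: "\<Lambda> \<le> t" using prod[of 1 1 \<Lambda>] nN \<Lambda> \<Lambda>2 by simp
  have t3: "real n \<le> t" using prod[of "real n" 1 1] nN \<Lambda> \<Lambda>2 by simp
  have t4: "real N * \<Lambda> \<le> t" using prod[of 1 "real N" \<Lambda>] nN \<Lambda> \<Lambda>2 by simp
  have "11 * \<Lambda> * real N = 11 * (real N * \<Lambda>)" by simp
  then have J_t: "real J \<le> 11 * t" using \<Lambda>(4) t4 by linarith
  have K_t: "real K \<le> 22 * t" using \<Lambda>(3) t2 by linarith
  have JK: "real n * (real J * (650 + 80 * real K)) \<le> (11 * 2410) * t"
  proof -
    have "650 + 80 * real K \<le> 2410 * \<Lambda>" using \<Lambda> by linarith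
    then have "real n * (real J * (650 + 80 * real K)) \<le> real n * ((11 * \<Lambda> * real N) * (2410 * \<Lambda>))"
      using \<Lambda> by (intro mult_left_mono mult_mono) auto
    also have "\<dots> = (11 * 2410) * t" by (simp add: t_def power2_eq_square)
    finally show ?thesis .
  qed
  have "real T \<le> real (20 * (i0 + 1) + 60 * (n + 1) + 50 * J + 40 * K + n * (150 + J * (650 + 80 * K)) + 140)"
    using T by (simp only: of_nat_le_iff)
  also have "\<dots> = 20 * real i0 + 20 + 60 * real n + 60 + 50 * real J + 40 * real K + 150 * real n +
      real n * (real J * (650 + 80 * real K)) + 140"
    by (simp add: algebra_simps)
  also have "\<dots> \<le> 31000 * t" using \<Lambda>(2) t1 t2 t3 J_t K_t JK by linarith
  also have "\<dots> \<le> 31000 * (32 * (real n ^ 3 / \<delta> * \<Lambda> ^ 4))"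
  proof -
    have "\<Lambda> ^ 2 \<le> \<Lambda> ^ 4" using \<Lambda>(1) by (intro power_increasing) auto
    then have "t \<le> real n * (32 * real n ^ 2 / \<delta>) * \<Lambda> ^ 4"
      unfolding t_def using N_le \<delta> by (intro mult_mono) auto
    also have "\<dots> = 32 * (real n ^ 3 / \<delta> * \<Lambda> ^ 4)" by (simp add: power2_eq_square power3_eq_cube)
    finally show ?thesis by simp
  qed
  also have "\<dots> \<le> 1000000 * (real n ^ 3 / \<delta> * \<Lambda> ^ 4)"
  proof -
    have "0 \<le> real n ^ 3 / \<delta> * \<Lambda> ^ 4" using \<delta> by simp
    then show ?thesis by linarith
  qed
  finally show ?thesis .
qed

text \<open>\<open>132 * 64 = 8448\<close>; the additive constants fit into
  \<open>8500 \<Lambda>\<close> as \<open>\<Lambda> \<ge> 1\<close>, and numerator and denominator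
  double it.\<close>

lemma is_bit_number_of_fractions:
  assumes w: "w \<in> fractions (((2 powr \<Lambda>) ^ 132) ^ 64)" and \<Lambda>: "1 \<le> \<Lambda>"
  shows "is_bit_number (17000 * \<Lambda>) w"
proof (rule is_bit_number_fractions[OF w])
  let ?X = "((2 powr \<Lambda>) ^ 132) ^ 64"
  have X: "?X = 2 powr (8448 * \<Lambda>)"
    by (simp add: power_mult[symmetric] powr_power)
  have "1 \<le> ?X" unfolding X using \<Lambda> by (intro ge_one_powr_ge_zero) auto
  then have "log 2 (?X + 1) \<le> log 2 (2 * ?X)" by simp
  also have "\<dots> = 1 + 8448 * \<Lambda>" unfolding X by (simp add: log_mult)
  finally have "log 2 (?X + 1) + 1 \<le> 8500 * \<Lambda>" using \<Lambda> by linarith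
  then show "2 * (log 2 (?X + 1) + 1) \<le> 17000 * \<Lambda>" by simp
qed

text \<open>The bounds use \<open>\<delta> = min 1 \<epsilon>\<close>: for
  \<open>\<epsilon> > n\<close> the logarithm of \<open>n / \<epsilon>\<close> would be negative,
  and for \<open>\<epsilon> \<ge> 1\<close> the program works with \<open>m = 1\<close>
  throughout.\<close>

theorem theorem1p2:
  "\<exists>(alg :: com) (C1 :: real) (C2 :: real).
     \<forall>(n :: nat) (a :: nat \<Rightarrow> int) (b :: int) (\<epsilon> :: real). n \<ge> 1 \<and> \<epsilon> > 0 \<longrightarrow>
       (\<exists>T W s. exec alg (input_state n a b \<epsilon>) T W s \<and>
          (let P = knapsack_polytope n a b;
               Z' = output_value s;
               L = real (max_enc_len n a b);
               \<delta> = min 1 \<epsilon>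
           in vol n P \<le> Z' \<and> Z' \<le> (1 + \<epsilon>) * vol n P \<and>
              real T \<le> C1 * (real n ^ 3 / \<delta> * (log 2 (real n / \<delta>) + L) ^ 4) \<and>
              (\<forall>w\<in>W. is_bit_number (C2 * (L + log 2 (real n / \<delta>))) w)))"
proof (rule exI[of _ knapsack_volume], rule exI[of _ 1000000], rule exI[of _ 17000], intro allI impI)
  fix n :: nat and a :: "nat \<Rightarrow> int" and b :: int and \<epsilon> :: real
  assume "n \<ge> 1 \<and> \<epsilon> > 0"
  then have n: "n \<ge> 1" and \<epsilon>: "\<epsilon> > 0" by auto
  define L where "L = max_enc_len n a b"
  define \<delta> where "\<delta> = min 1 \<epsilon>"
  define \<Lambda> where "\<Lambda> = log 2 (real n / \<delta>) + real L"
  define i0 where "i0 = (LEAST i. 1 / 2 ^ i \<le> \<epsilon>)"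
  define m :: nat where "m = 2 ^ i0"
  define N where "N = 16 * n ^ 2 * m"
  define J where "J = (LEAST j. real N * (of_int b + (\<Sum>i<n. max 0 (- of_int (a i)))) \<le> real (grid N j))"
  define K where "K = (LEAST k. (2 * real N + 2) * real (grid N J) + (\<Sum>i<n. real (N * nat \<bar>a i\<bar>)) \<le> 2 ^ k)"
  define Z where "Z = (2 powr \<Lambda>) ^ 132"
  note bounds = knapsack_parameter_bounds[OF n \<epsilon> i0_def m_def N_def J_def K_def
      Z_def[unfolded \<Lambda>_def L_def \<delta>_def], folded \<delta>_def, folded L_def, folded \<Lambda>_def]
  have N1: "N \<ge> 1" using n by (simp add: N_def m_def)
  let ?S = "\<bar>of_int b\<bar> + (\<Sum>i<n. \<bar>real_of_int (a i)\<bar>)"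
  have mem: "bounded_memory Z (input_state n a b \<epsilon>)"
  proof (rule bounded_memory_input_state)
    show "1 \<le> Z" using bounds(1) by linarith
    have S: "0 \<le> (\<Sum>i<n. \<bar>real_of_int (a i)\<bar>)" by (intro sum_nonneg) auto
    then have "1 * ?S \<le> real N * ?S"
      using N1 by (intro mult_right_mono add_nonneg_nonneg) auto
    then have S_Z: "?S \<le> Z"
      using bounds(3) unfolding mult_1_left by (rule order.trans)
    with S show "\<bar>real_of_int b\<bar> \<le> Z" by linarith
    show "\<bar>real_of_int (a i)\<bar> \<le> Z" if "i < n" for i
    proof -
      have "\<bar>real_of_int (a i)\<bar> \<le> (\<Sum>i<n. \<bar>real_of_int (a i)\<bar>)"
        by (rule member_le_sum) (use that in auto)
      then show ?thesis using S_Z by linarith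
    qed
    have "real n * 1 \<le> real n * (real K + 1)" by (intro mult_left_mono) auto
    then show "real n \<le> Z" using bounds(7) of_nat_0_le_iff[of K, where 'a = real] by linarith
  qed
  from knapsack_volume_wp[OF n \<epsilon> i0_def m_def N_def J_def K_def bounds(1-8)] mem
  obtain T W s where e: "exec knapsack_volume (input_state n a b \<epsilon>) T W s"
    and T: "T \<le> 20 * (i0 + 1) + 60 * (n + 1) + 50 * J + 40 * K + n * (150 + J * (650 + 80 * K)) + 140"
    and W: "W \<subseteq> fractions (Z ^ 64)"
    and out: "vol n (knapsack_polytope n a b) \<le> output_value s"
      "output_value s \<le> (1 + \<epsilon>) * vol n (knapsack_polytope n a b)"
    unfolding wp_def by blast
  have \<delta>: "0 < \<delta>" using \<epsilon> by (simp add: \<delta>_def)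
  have time: "real T \<le> 1000000 * (real n ^ 3 / \<delta> * \<Lambda> ^ 4)"
    using knapsack_running_time[OF n N1 bounds(9-13) \<delta> T] .
  have bits: "is_bit_number (17000 * (real L + log 2 (real n / \<delta>))) w" if "w \<in> W" for w
    using is_bit_number_of_fractions[of w \<Lambda>] W that bounds(9)
    unfolding Z_def \<Lambda>_def by (auto simp: add.commute)
  from e out time bits
  show "\<exists>T W s. exec knapsack_volume (input_state n a b \<epsilon>) T W s \<and>
          (let P = knapsack_polytope n a b;
               Z' = output_value s;
               L = real (max_enc_len n a b);
               \<delta> = min 1 \<epsilon>
           in vol n P \<le> Z' \<and> Z' \<le> (1 + \<epsilon>) * vol n P \<and>
              real T \<le> 1000000 * (real n ^ 3 / \<delta> * (log 2 (real n / \<delta>) + L) ^ 4) \<and>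
              (\<forall>w\<in>W. is_bit_number (17000 * (L + log 2 (real n / \<delta>))) w))"
    unfolding Let_def \<delta>_def[symmetric] L_def[symmetric] \<Lambda>_def[symmetric] by blast
qed

end
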